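(* For both the directed and the undirected complete graph on $n$ vertices with i.i.d. exponential mean-$1$ edge weights, with probability $1-o(1)$ as $n\to\infty$ the mean weight of the minimum mean-weight cycle is at most $$\frac{1+\dfrac{\pi^2/2+o(1)}{\log^2 n}}{en}.$$ That is, there is a sequence $\eta_n\to0$ such that the probability that the minimum mean weight is at most $\frac{1}{en}\big(1+\frac{\pi^2/2+\eta_n}{\log^2 n}\big)$ tends to $1$ as $n\to\infty$.
   Context: The directed complete graph on $n$ vertices has one arc for each ordered pair of distinct vertices; its cycles are simple directed cycles, of length at least $2$. The undirected complete graph has one edge for each unordered pair of distinct vertices; its cycles are simple cycles, of length at least $3$. Edge (arc) weights are i.i.d. exponential with mean $1$. The mean weight of a cycle is the sum of its edge weights divided by its length (number of edges). The minimum mean-weight cycle is the cycle of smallest mean weight. Logarithms are natural. *)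

theory Defs
  imports "HOL-Probability.Probability" "Graph_Theory.Graph_Theory"
begin

text \<open>
  As usual in Graph_Theory, the undirected complete graph is represented by the symmetric digraph
  on the same vertices; the two arcs \<open>(u, v)\<close> and \<open>(v, u)\<close> share the weight of the edge \<open>{u, v}\<close>.
\<close>

definition complete_pair_digraph :: "nat \<Rightarrow> nat pair_pre_digraph" where
  "complete_pair_digraph n = \<lparr>pverts = {..<n}, parcs = {(u, v). u < n \<and> v < n \<and> u \<noteq> v}\<rparr>"

lemma complete_digraph_complete_pair_digraph: "K\<^bsub>n\<^esub> (with_proj (complete_pair_digraph n))"
  by (auto simp: complete_digraph_pair_def complete_pair_digraph_def)

definition undirected_edges :: "nat \<Rightarrow> nat set set" where
  "undirected_edges n = {e. e \<subseteq> {..<n} \<and> card e = 2}"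

text \<open>
  A cycle is a list of arcs with a starting point, and in the undirected case also an orientation;
  neither affects its mean weight. The complete graph has no loops, so directed cycles
  automatically have length at least 2. In the undirected case \<open>[(u, v), (v, u)]\<close> runs twice
  along one edge and has to be excluded.
\<close>

definition directed_cycles :: "nat \<Rightarrow> (nat \<times> nat) awalk set" where
  "directed_cycles n = {p. pre_digraph.cycle (with_proj (complete_pair_digraph n)) p}"

definition undirected_cycles :: "nat \<Rightarrow> (nat \<times> nat) awalk set" where
  "undirected_cycles n = {p. pre_digraph.cycle (with_proj (complete_pair_digraph n)) p \<and> length p \<ge> 3}"

lemma directed_cycles_subset:
  "directed_cycles n \<subseteq> {p. set p \<subseteq> parcs (complete_pair_digraph n) \<and> length p \<le> n}"
proof
  fix p assume "p \<in> directed_cycles n"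
  then obtain u where u: "pre_digraph.awalk (with_proj (complete_pair_digraph n)) u p u"
    "distinct (tl (pre_digraph.awalk_verts (with_proj (complete_pair_digraph n)) u p))" "p \<noteq> []"
    by (auto simp: directed_cycles_def pre_digraph.cycle_def)
  interpret graph "with_proj (complete_pair_digraph n)"
    using complete_digraph_complete_pair_digraph by (simp add: complete_digraph_def)
  have "set (awalk_verts u p) \<subseteq> {..<n}"
    using u(1) unfolding awalk_conv by (simp add: complete_pair_digraph_def)
  then have "set (tl (awalk_verts u p)) \<subseteq> {..<n}" by (cases "awalk_verts u p") auto
  from card_mono[OF _ this] have "length p \<le> n"
    using distinct_card[OF u(2)] length_awalk_verts[of u p] by simp
  moreover have "set p \<subseteq> parcs (complete_pair_digraph n)" using u by (auto simp: awalk_def)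
  ultimately show "p \<in> {p. set p \<subseteq> parcs (complete_pair_digraph n) \<and> length p \<le> n}" by simp
qed

lemma finite_directed_cycles: "finite (directed_cycles n)"
proof (rule finite_subset[OF directed_cycles_subset])
  have "finite (parcs (complete_pair_digraph n))"
    by (rule finite_subset[of _ "{..<n} \<times> {..<n}"]) (auto simp: complete_pair_digraph_def)
  thus "finite {p. set p \<subseteq> parcs (complete_pair_digraph n) \<and> length p \<le> n}" by (rule finite_lists_length_le)
qed

lemma triangle_in_undirected_cycles: "[(0,1),(1,2),(2,0)] \<in> undirected_cycles n" if "n \<ge> 3"
  using that unfolding undirected_cycles_def pre_digraph.cycle_def pre_digraph.awalk_def
  by (auto simp: complete_pair_digraph_def pre_digraph.awalk_verts.simps pre_digraph.cas.simps)

lemma two_cycle_in_directed_cycles: "[(0,1),(1,0)] \<in> directed_cycles n" if "n \<ge> 2"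
  using that unfolding directed_cycles_def pre_digraph.cycle_def pre_digraph.awalk_def
  by (auto simp: complete_pair_digraph_def pre_digraph.awalk_verts.simps pre_digraph.cas.simps)

lemma finite_undirected_cycles: "finite (undirected_cycles n)"
  by (rule finite_subset[OF _ finite_directed_cycles])
     (auto simp: undirected_cycles_def directed_cycles_def)

definition mean_weight :: "(nat \<times> nat \<Rightarrow> real) \<Rightarrow> (nat \<times> nat) awalk \<Rightarrow> real" where
  "mean_weight w p = sum_list (map w p) / real (length p)"

text \<open>
  The set of cycles is finite; it is nonempty when \<open>n \<ge> 2\<close> (directed) or \<open>n \<ge> 3\<close> (undirected).
  The value for smaller \<open>n\<close> is unspecified.
\<close>

definition min_mean_directed :: "nat \<Rightarrow> (nat \<times> nat \<Rightarrow> real) \<Rightarrow> real" where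
  "min_mean_directed n w = Min (mean_weight w ` directed_cycles n)"

definition min_mean_undirected :: "nat \<Rightarrow> (nat set \<Rightarrow> real) \<Rightarrow> real" where
  "min_mean_undirected n w = Min (mean_weight (\<lambda>(u, v). w {u, v}) ` undirected_cycles n)"

definition iid_exponential :: "'a measure \<Rightarrow> 'e set \<Rightarrow> ('e \<Rightarrow> 'a \<Rightarrow> real) \<Rightarrow> bool" where
  "iid_exponential M E W \<longleftrightarrow>
     prob_space M \<and>
     prob_space.indep_vars M (\<lambda>_. borel) W E \<and>
     (\<forall>e\<in>E. distributed M lborel (W e) (exponential_density 1))"

end

theory Submission
  imports Defs "HOL-Real_Asymp.Real_Asymp"
begin

text \<open>
  Weighted second moment method. Rounding the weights up to multiples of a small \<open>h\<close> turns a cycle of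
  \<open>k\<close> arcs with prescribed rounded weights \<open>h i\<^sub>1, \<dots>, h i\<^sub>k\<close> into an event of probability about \<open>h\<^sup>k\<close>.
  Only those cycles are counted whose height, \<open>D\<close> plus the partial sum of the \<open>i\<^sub>j - D\<close>, stays
  between \<open>0\<close> and \<open>B = l D\<close>; the mean weight of such a cycle is at most \<open>h D (1 + l / k)\<close>.
  A cycle counts with weight \<open>z\<close> to the power of its final height. For
  \<open>z = sin (\<alpha> (D - 1)) / sin (\<alpha> D)\<close> a telescoping identity makes sine functions vanishing near the ends
  of the band sub- and superharmonic for the transfer operator, and its growth rate exceeds 1 as soon as
  \<open>n h D e\<close> exceeds about \<open>1 + \<pi>\<^sup>2 / (2 l\<^sup>2)\<close>.

  In the second moment, a cycle that leaves and re-enters a fixed cycle loses a factor \<open>n\<close> at each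
  re-entry and gains at most \<open>z\<close> to the power \<open>- B\<close>, about \<open>e\<^sup>l\<close>. With \<open>l\<close> slightly below \<open>ln n\<close>
  the loss wins, overlapping pairs are negligible, and cycles of length about \<open>l\<^sup>3\<close> exist with
  probability tending to 1.
\<close>


section \<open>Sine functions in a band\<close>

text \<open>The band answers an obstacle: a cycle of the right total weight may contain a path much
  too light for its length, and pairs of cycles sharing such a path inflate the second moment.
  Confined heights bound this gain, and the price is the constant \<pi>^2/2. With \<theta> =
  \<pi>/l, the growth rate n h z^(-D) sin(\<alpha>(D-1))/sin \<alpha> has logarithm ln(n h D) +
  \<theta> cot \<theta> + ln(sin \<theta>/\<theta>) + O(1/D), that is ln(n h D) + 1 - \<theta>^2/3 -
  \<theta>^2/6 up to smaller terms. Taking D = l^3 makes the discretisation error O(1/D) negligible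
  against 1/l^2. A sine vanishing at the band ends bounds the first moment from below but is too
  small near its zeros for upper bounds. These use the sine of a band widened by \<pi> D, which
  stays at least of order 1/l on the original band. Its log growth rate differs by O(1/l^3), so over
  a multiple of l^3 steps the two bounds stay well within a factor exp(e l), where \<open>e\<close>
  is the slack parameter. The two graphs differ only in whether an arc and its reversal share a
  weight; labelling arcs by a \<open>key\<close> treats both at once.\<close>

lemma sum_geometric_sine:
  fixes \<alpha> x z d :: real
  assumes "sin (\<alpha> * d) \<noteq> 0" "sin \<alpha> \<noteq> 0" "z = sin (\<alpha> * (d - 1)) / sin (\<alpha> * d)"
  shows "(\<Sum>i=1..I. z ^ i * sin (\<alpha> * (x + real i - d))) =
    sin (\<alpha> * (d - 1)) / sin \<alpha> * (sin (\<alpha> * x) - z ^ I * sin (\<alpha> * (x + real I)))"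
proof (induction I)
  case (Suc I)
  define u where "u = \<alpha> * (x + real I)"
  define v where "v = \<alpha> * (d - 1)"
  have e: "\<alpha> * (x + real (Suc I) - d) = u - v" "\<alpha> * d = v + \<alpha>" "\<alpha> * (x + real (Suc I)) = u + \<alpha>"
    by (auto simp: u_def v_def algebra_simps)
  \<comment> \<open>Divided by sin(v + \<alpha>), this identity turns each summand into a constant
    times a difference of consecutive values of z^i sin(\<alpha>(x + i)). It is what dictates the
    form of \<open>z\<close>.\<close>
  have "sin (v + \<alpha>) * sin u - sin v * sin (u + \<alpha>) = sin \<alpha> * sin (u - v)"
    by (simp add: sin_add sin_diff algebra_simps)
  moreover have z: "z = sin v / sin (v + \<alpha>)" "sin (v + \<alpha>) \<noteq> 0"
    using assms unfolding e v_def[symmetric] by auto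
  ultimately have "sin u - z * sin (u + \<alpha>) = sin \<alpha> * sin (u - v) / sin (v + \<alpha>)"
    by (simp add: field_simps)
  hence "sin v / sin \<alpha> * (sin u - z * sin (u + \<alpha>)) = z * sin (u - v)"
    using assms(2) by (simp add: z)
  hence "z ^ I * (sin v / sin \<alpha> * (sin u - z * sin (u + \<alpha>))) = z ^ Suc I * sin (u - v)"
    by simp
  moreover have "(\<Sum>i=1..Suc I. z ^ i * sin (\<alpha> * (x + real i - d))) =
    (\<Sum>i=1..I. z ^ i * sin (\<alpha> * (x + real i - d))) + z ^ Suc I * sin (u - v)"
    unfolding e(1)[symmetric] by simp
  ultimately show ?case using Suc e(3) unfolding u_def[symmetric] v_def[symmetric]
    by (simp only: right_diff_distrib) (simp add: mult_ac)
qed simp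

definition in_band :: "nat \<Rightarrow> int \<Rightarrow> bool" where
  "in_band B x \<longleftrightarrow> 1 \<le> x \<and> x < int B"

text \<open>The band ends are zeros of the sine, so the steps landing outside the band in the
  telescoped sum contribute nonpositive terms. Discarding them can only increase the sum.\<close>

lemma sine_subharmonic:
  fixes z :: real and x :: int
  and B D :: nat
  and \<alpha> :: real
  assumes \<alpha>_def: "\<alpha> = pi / real B" and D: "2 \<le> D" "D < B" and x: "in_band B x"
    and z: "z = sin (\<alpha> * (real D - 1)) / sin (\<alpha> * D)"
  shows "sin (\<alpha> * (real D - 1)) / sin \<alpha> * sin (\<alpha> * x)
    \<le> (\<Sum>i=1..B + D. if in_band B (x + int i - int D) then z ^ i * sin (\<alpha> * (x + int i - int D)) else 0)"
proof -
  have B: "real B > 0" and a: "\<alpha> > 0" using D by (auto simp: \<alpha>_def)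
  have pos: "sin (\<alpha> * t) > 0" if "0 < t" "t < real B" for t
    using that B by (intro sin_gt_zero) (auto simp: \<alpha>_def field_simps)
  have s: "sin (\<alpha> * (real D - 1)) > 0" "sin (\<alpha> * D) > 0" "sin \<alpha> > 0"
    using pos[of "real D - 1"] pos[of D] pos[of 1] D by auto
  have z0: "z > 0" using s z by simp
  \<comment> \<open>The sum is run until the landing height is exactly \<open>B\<close>. The
    telescoped remainder then involves sin(\<alpha>(B + D)) = - sin(\<alpha> D), which has the
    favourable sign.\<close>
  define I where "I = nat (int B + int D - x)"
  have I: "int I = int B + int D - x" "I \<le> B + D" using x by (auto simp: I_def in_band_def)
  have neg: "sin (\<alpha> * t) \<le> 0" if "- real B \<le> t" "t \<le> 0" for t
  proof -
    have "\<alpha> * (- t) \<le> \<alpha> * real B" "0 \<le> \<alpha> * (- t)"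
      using that a by (intro mult_left_mono mult_nonneg_nonneg; simp)+
    hence "0 \<le> sin (\<alpha> * (-t))" using B by (intro sin_ge_zero) (simp_all add: \<alpha>_def)
    thus ?thesis by simp
  qed
  have aB: "\<alpha> * real B = pi" using B by (simp add: \<alpha>_def)
  have xI: "real_of_int x + real I = real B + real D" using I(1) by linarith
  have "sin (\<alpha> * (real_of_int x + real I)) = - sin (\<alpha> * D)"
    unfolding xI distrib_left aB by (simp add: sin_add)
  hence "sin (\<alpha> * (real D - 1)) / sin \<alpha> * sin (\<alpha> * x) \<le>
    sin (\<alpha> * (real D - 1)) / sin \<alpha> * (sin (\<alpha> * x) - z ^ I * sin (\<alpha> * (real_of_int x + real I)))"
    using s z0 by (intro mult_left_mono) auto
  also have "\<dots> = (\<Sum>i=1..I. z ^ i * sin (\<alpha> * (real_of_int x + real i - real D)))"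
    using s z by (intro sum_geometric_sine[symmetric]) auto
  also have "\<dots> \<le> (\<Sum>i=1..I. if in_band B (x + int i - int D) then z ^ i * sin (\<alpha> * (x + int i - int D)) else 0)"
  proof (rule sum_mono)
    fix i assume i: "i \<in> {1..I}"
    show "z ^ i * sin (\<alpha> * (real_of_int x + real i - real D))
      \<le> (if in_band B (x + int i - int D) then z ^ i * sin (\<alpha> * (x + int i - int D)) else 0)"
    proof (cases "in_band B (x + int i - int D)")
      case False
      have "sin (\<alpha> * (real_of_int x + real i - real D)) \<le> 0"
      proof (cases "x + int i - int D = int B")
        case True
        hence "real_of_int x + real i - real D = real B" by linarith
        thus ?thesis by (simp add: aB)
      next
        case F2: False
        have "x + int i - int D \<le> 0" using False F2 i I by (auto simp: in_band_def)
        hence "real_of_int x + real i - real D \<le> 0" by linarith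
        moreover have "x \<ge> 1" using x by (auto simp: in_band_def)
        ultimately show ?thesis using D i by (intro neg) auto
      qed
      thus ?thesis using False z0 by (simp add: mult_nonneg_nonpos)
    qed simp
  qed
  also have "\<dots> \<le> (\<Sum>i=1..B + D. if in_band B (x + int i - int D) then z ^ i * sin (\<alpha> * (x + int i - int D)) else 0)"
  proof (rule sum_mono2)
    fix i assume "i \<in> {1..B + D} - {1..I}"
    show "0 \<le> (if in_band B (x + int i - int D) then z ^ i * sin (\<alpha> * (x + int i - int D)) else 0)"
    proof (cases "in_band B (x + int i - int D)")
      case True
      hence "sin (\<alpha> * (x + int i - int D)) > 0" unfolding in_band_def by (intro pos) linarith+
      thus ?thesis using z0 by simp
    qed simp
  qed (use I in auto)
  finally show ?thesis .
qed

text \<open>The sine is extended by \<open>a \<ge> D\<close> beyond both band ends, so it is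
  positive at all heights that occur in the sum and in the telescoped remainder. Adding the steps
  that leave the band below and dropping the remainder both increase the bound.\<close>

lemma sine_superharmonic:
  fixes z :: real and x :: int
  and B D :: nat and a :: real
  and \<alpha> :: real
  assumes \<alpha>_def: "\<alpha> = pi / (real B + 2 * a)" and D: "2 \<le> D" "real D \<le> a" and x: "in_band B x"
    and z: "z = sin (\<alpha> * (real D - 1)) / sin (\<alpha> * D)"
  shows "(\<Sum>i=1..B + D. if in_band B (x + int i - int D) then z ^ i * sin (\<alpha> * (real_of_int x + real i - real D + a)) else 0)
    \<le> sin (\<alpha> * (real D - 1)) / sin \<alpha> * sin (\<alpha> * (real_of_int x + a))"
proof -
  have pos: "sin (\<alpha> * t) > 0" if "0 < t" "t < real B + 2 * a" for t
    using that D by (intro sin_gt_zero) (auto simp: \<alpha>_def pos_divide_less_eq)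
  have s: "sin (\<alpha> * (real D - 1)) > 0" "sin (\<alpha> * D) > 0" "sin \<alpha> > 0"
    using pos[of "real D - 1"] pos[of D] pos[of 1] D by auto
  have z0: "z > 0" using s z by simp
  \<comment> \<open>The last step that stays in the band; it lands at \<open>B - 1\<close>.\<close>
  define I where "I = nat (int B - 1 + int D - x)"
  have I: "int I = int B - 1 + int D - x" "I \<le> B + D" using x by (auto simp: I_def in_band_def)
  have "(\<Sum>i=1..B + D. if in_band B (x + int i - int D) then z ^ i * sin (\<alpha> * (real_of_int x + real i - real D + a)) else 0)
      = (\<Sum>i=1..I. if in_band B (x + int i - int D) then z ^ i * sin (\<alpha> * (real_of_int x + real i - real D + a)) else 0)"
    using I by (intro sum.mono_neutral_right) (auto simp: in_band_def)
  also have "\<dots> \<le> (\<Sum>i=1..I. z ^ i * sin (\<alpha> * (real_of_int x + a + real i - real D)))"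
  proof (rule sum_mono)
    fix i assume i: "i \<in> {1..I}"
    have "0 < x + int i" "x + int i \<le> int B + int D - 1" using i I x by (auto simp: in_band_def)
    hence "sin (\<alpha> * (real_of_int x + real i - real D + a)) > 0" by (intro pos) (use D in linarith)+
    moreover have e: "real_of_int x + a + real i - real D = real_of_int x + real i - real D + a" by simp
    ultimately show "(if in_band B (x + int i - int D) then z ^ i * sin (\<alpha> * (real_of_int x + real i - real D + a)) else 0)
       \<le> z ^ i * sin (\<alpha> * (real_of_int x + a + real i - real D))" unfolding e using z0 by simp
  qed
  also have "\<dots> = sin (\<alpha> * (real D - 1)) / sin \<alpha> * (sin (\<alpha> * (real_of_int x + a)) -
      z ^ I * sin (\<alpha> * (real_of_int x + a + real I)))"
    using s z by (intro sum_geometric_sine) auto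
  also have "\<dots> \<le> sin (\<alpha> * (real D - 1)) / sin \<alpha> * sin (\<alpha> * (real_of_int x + a))"
  proof -
    have "real_of_int x + a + real I = real B + real D - 1 + a" using I(1) by linarith
    also have "sin (\<alpha> * \<dots>) > 0" using D by (intro pos) auto
    finally show ?thesis using s z0 by (intro mult_left_mono) auto
  qed
  finally show ?thesis .
qed

section \<open>Sums over weighted words\<close>

definition words :: "'a set \<Rightarrow> nat \<Rightarrow> 'a list set" where
  "words A m = {l. set l \<subseteq> A \<and> length l = m}"

lemma finite_words: "finite A \<Longrightarrow> finite (words A m)"
  unfolding words_def by (rule finite_lists_length_eq)

lemma words_0: "words A 0 = {[]}"
  by (auto simp: words_def)

lemma sum_words_Suc:
  assumes "finite A"
  shows "(\<Sum>l\<in>words A (Suc m). F l) = (\<Sum>a\<in>A. \<Sum>l\<in>words A m. F (a # l))"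
proof -
  have "(\<Sum>l\<in>words A (Suc m). F l) = (\<Sum>(a, l)\<in>A \<times> words A m. F (a # l))"
    by (rule sum.reindex_bij_witness[where i = "\<lambda>(a, l). a # l" and j = "\<lambda>l. (hd l, tl l)"])
      (auto simp: words_def length_Suc_conv)
  thus ?thesis by (simp add: sum.cartesian_product)
qed

text \<open>Summed over all words of length \<open>m\<close>, this is the \<open>m\<close>-th
  iterate of a transfer operator applied to the terminal value \<open>T\<close>. The state
  \<open>s\<close> will carry a height, and later also visited vertices or the last arc.\<close>

fun path_weight :: "('s \<Rightarrow> 'a \<Rightarrow> real) \<Rightarrow> ('s \<Rightarrow> 'a \<Rightarrow> 's) \<Rightarrow> ('s \<Rightarrow> real) \<Rightarrow> 's \<Rightarrow> 'a list \<Rightarrow> real" where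
  "path_weight w nx T s [] = T s"
| "path_weight w nx T s (a # l) = w s a * path_weight w nx T (nx s a) l"

text \<open>\<open>G m\<close> is a superharmonic majorant with \<open>m\<close> steps left. It is
  required only for \<open>m < M\<close>, because the majorants used later grow with
  \<open>m\<close> and satisfy the one-step inequality only up to the cycle length.\<close>

lemma path_sum_le:
  assumes "finite A" and "P s"
    and w: "\<And>s a. P s \<Longrightarrow> a \<in> A \<Longrightarrow> 0 \<le> w s a"
    and P: "\<And>s a. P s \<Longrightarrow> a \<in> A \<Longrightarrow> w s a \<noteq> 0 \<Longrightarrow> P (nx s a)"
    and T: "\<And>s. P s \<Longrightarrow> T s \<le> G 0 s"
    and G: "\<And>m s. P s \<Longrightarrow> m < M \<Longrightarrow> (\<Sum>a\<in>A. w s a * G m (nx s a)) \<le> G (Suc m) s"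
  shows "m \<le> M \<Longrightarrow> (\<Sum>l\<in>words A m. path_weight w nx T s l) \<le> G m s"
  using \<open>P s\<close>
proof (induction m arbitrary: s)
  case 0
  then show ?case using T by (simp add: words_0)
next
  case (Suc m)
  have "(\<Sum>l\<in>words A (Suc m). path_weight w nx T s l) =
      (\<Sum>a\<in>A. w s a * (\<Sum>l\<in>words A m. path_weight w nx T (nx s a) l))"
    using assms(1) by (simp add: sum_words_Suc sum_distrib_left)
  also have "\<dots> \<le> (\<Sum>a\<in>A. w s a * G m (nx s a))"
  proof (rule sum_mono)
    fix a assume a: "a \<in> A"
    show "w s a * (\<Sum>l\<in>words A m. path_weight w nx T (nx s a) l) \<le> w s a * G m (nx s a)"
      using Suc P[OF _ a] w[OF _ a] by (cases "w s a = 0") (auto intro!: mult_left_mono)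
  qed
  also have "\<dots> \<le> G (Suc m) s" using G Suc.prems by simp
  finally show ?case .
qed

text \<open>The invariant \<open>P\<close> depends on the number of steps left, so that it can limit
  the vertices already used plus those still to come.\<close>

lemma path_sum_ge:
  assumes "finite A" and "P m s"
    and w: "\<And>m s a. P (Suc m) s \<Longrightarrow> a \<in> A \<Longrightarrow> 0 \<le> w s a"
    and P: "\<And>m s a. P (Suc m) s \<Longrightarrow> a \<in> A \<Longrightarrow> w s a \<noteq> 0 \<Longrightarrow> P m (nx s a)"
    and T: "\<And>s. P 0 s \<Longrightarrow> G 0 s \<le> T s"
    and G: "\<And>m s. P (Suc m) s \<Longrightarrow> G (Suc m) s \<le> (\<Sum>a\<in>A. w s a * G m (nx s a))"
  shows "G m s \<le> (\<Sum>l\<in>words A m. path_weight w nx T s l)"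
  using \<open>P m s\<close>
proof (induction m arbitrary: s)
  case 0
  then show ?case using T by (simp add: words_0)
next
  case (Suc m)
  have "G (Suc m) s \<le> (\<Sum>a\<in>A. w s a * G m (nx s a))" using G Suc.prems by simp
  also have "\<dots> \<le> (\<Sum>a\<in>A. w s a * (\<Sum>l\<in>words A m. path_weight w nx T (nx s a) l))"
  proof (rule sum_mono)
    fix a assume a: "a \<in> A"
    show "w s a * G m (nx s a) \<le> w s a * (\<Sum>l\<in>words A m. path_weight w nx T (nx s a) l)"
      using Suc P[OF _ a] w[OF _ a] by (cases "w s a = 0") (auto intro!: mult_left_mono)
  qed
  also have "\<dots> = (\<Sum>l\<in>words A (Suc m). path_weight w nx T s l)"
    using assms(1) by (simp add: sum_words_Suc sum_distrib_left)
  finally show ?case .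
qed

section \<open>Height walks in a band\<close>

locale lattice =
  fixes n B D :: nat and h z :: real
  assumes z: "0 < z" "z < 1" and h: "0 < h"
begin

text \<open>A letter is the next vertex together with the rounded weight of the arc to it. From a
  height in the band a step above \<open>B + D\<close> always leaves the band, so cutting off there
  loses nothing.\<close>

definition letters :: "(nat \<times> nat) set" where
  "letters = {..<n} \<times> {1..B + D}"

definition tilt :: "nat \<Rightarrow> real" where
  "tilt i = z powr (real i - real D)"

definition move :: "int \<Rightarrow> nat \<Rightarrow> int" where
  "move x i = x + int i - int D"

definition step_weight :: "int \<Rightarrow> nat \<Rightarrow> real" where
  "step_weight x i = (if in_band B (move x i) then tilt i else 0)"

definition band_weight :: "int \<Rightarrow> (nat \<times> nat) list \<Rightarrow> real" where
  "band_weight = path_weight (\<lambda>x a. step_weight x (snd a)) (\<lambda>x a. move x (snd a)) (\<lambda>_. 1)"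

lemma band_weight_simps [simp]:
  "band_weight x [] = 1"
  "band_weight x (a # l) = step_weight x (snd a) * band_weight (move x (snd a)) l"
  by (simp_all add: band_weight_def)

lemma finite_letters [simp]: "finite letters"
  by (simp add: letters_def)

lemma tilt_pos: "0 < tilt i"
  using z by (simp add: tilt_def)

lemma step_weight_nonneg: "0 \<le> step_weight x i"
  using tilt_pos by (simp add: step_weight_def less_imp_le)

lemma band_weight_nonneg: "0 \<le> band_weight x l"
  by (induction l arbitrary: x) (auto simp: step_weight_nonneg)

lemma step_weight_shift:
  "step_weight x i * z powr (- real_of_int (move x i)) = (if in_band B (move x i) then z powr (- real_of_int x) else 0)"
  using z by (simp add: step_weight_def tilt_def move_def powr_add[symmetric])

lemma sum_letters: "(\<Sum>a\<in>letters. F (fst a) (snd a)) = (\<Sum>v<n. \<Sum>i=1..B + D. F v i)"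
  unfolding letters_def sum.cartesian_product by (simp add: case_prod_unfold)

lemma band_sum_ge:
  assumes f1: "\<And>x. in_band B x \<Longrightarrow> f x \<le> 1"
    and f: "\<And>x. in_band B x \<Longrightarrow> \<mu> * f x \<le> real n * h * (\<Sum>i=1..B + D. step_weight x i * f (move x i))"
    and x: "in_band B x"
    and \<mu>: "0 \<le> \<mu>"
  shows "\<mu> ^ m * f x \<le> h ^ m * (\<Sum>l\<in>words letters m. band_weight x l)"
proof -
  have "(\<mu> / h) ^ m * f x \<le> (\<Sum>l\<in>words letters m. path_weight (\<lambda>x a. step_weight x (snd a)) (\<lambda>x a. move x (snd a)) (\<lambda>_. 1) x l)"
  proof (rule path_sum_ge[where P = "\<lambda>m x. in_band B x" and G = "\<lambda>m x. (\<mu> / h) ^ m * f x"])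
    show "(\<mu> / h) ^ Suc m * f x \<le> (\<Sum>a\<in>letters. step_weight x (snd a) * ((\<mu> / h) ^ m * f (move x (snd a))))"
      if "in_band B x" for m x
    proof -
      have "(\<mu> / h) ^ Suc m * f x = (\<mu> / h) ^ m * ((\<mu> * f x) / h)" by simp
      also have "\<dots> \<le> (\<mu> / h) ^ m * (real n * (\<Sum>i=1..B + D. step_weight x i * f (move x i)))"
        using f[OF that] h \<mu> by (intro mult_left_mono) (auto simp: field_simps)
      also have "\<dots> = (\<Sum>a\<in>letters. step_weight x (snd a) * ((\<mu> / h) ^ m * f (move x (snd a))))"
        unfolding sum_letters[of "\<lambda>v i. step_weight x i * ((\<mu> / h) ^ m * f (move x i))"]
        by (simp add: sum_distrib_left mult_ac)
      finally show ?thesis .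
    qed
  qed (use f1 x step_weight_nonneg in \<open>auto simp: step_weight_def split: if_splits\<close>)
  hence "(\<mu> / h) ^ m * f x \<le> (\<Sum>l\<in>words letters m. band_weight x l)" by (simp add: band_weight_def)
  hence "h ^ m * ((\<mu> / h) ^ m * f x) \<le> h ^ m * (\<Sum>l\<in>words letters m. band_weight x l)"
    using h by (intro mult_left_mono) auto
  thus ?thesis using h by (simp add: power_divide)
qed

text \<open>Band weights ignore the vertices. With the visited set added to the state, at least
  \<open>n - k\<close> of the \<open>n\<close> vertices remain free at each step, so distinctness
  costs at most a factor \<open>1 - k / n\<close> per step.\<close>

lemma distinct_band_sum_ge:
  assumes "k \<le> n" "0 < n"
  shows "(1 - real k / real n) ^ k * (\<Sum>l\<in>words letters k. band_weight x l)
    \<le> (\<Sum>l\<in>{l \<in> words letters k. distinct (map fst l)}. band_weight x l)"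
proof -
  define S where "S m x = (\<Sum>l\<in>words letters m. band_weight x l)" for m x
  define q where "q = 1 - real k / real n"
  have q: "0 \<le> q" using assms by (simp add: q_def)
  define w where "w = (\<lambda>(x, U :: nat set) a. if fst a \<in> U then 0 else step_weight x (snd a))"
  define nx where "nx = (\<lambda>(x, U :: nat set) a. (move x (snd a), insert (fst a) U))"
  have S0: "0 \<le> S m x" for m x by (auto simp: S_def intro!: sum_nonneg band_weight_nonneg)
  have SS: "S (Suc m) x = real n * (\<Sum>i=1..B + D. step_weight x i * S m (move x i))" for m x
    unfolding S_def sum_words_Suc[OF finite_letters]
    using sum_letters[of "\<lambda>v i. step_weight x i * S m (move x i)"]
    by (simp add: sum_distrib_left S_def)
  have pw: "path_weight w nx (\<lambda>_. 1) (x, U) l =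
     (if distinct (map fst l) \<and> set (map fst l) \<inter> U = {} then band_weight x l else 0)" for x U l
    by (induction l arbitrary: x U) (auto simp: w_def nx_def)
  define G where "G = (\<lambda>m (s :: int \<times> nat set). q ^ m * S m (fst s))"
  have "G k (x, {}) \<le> (\<Sum>l\<in>words letters k. path_weight w nx (\<lambda>_. 1) (x, {}) l)"
  proof (rule path_sum_ge[where P = "\<lambda>m s. finite (snd s) \<and> card (snd s) + m \<le> k"])
    fix m and s :: "int \<times> nat set" assume s: "finite (snd s) \<and> card (snd s) + Suc m \<le> k"
    obtain x U where sx: "s = (x, U)" by (cases s)
    have "n - k \<le> card ({..<n} - U)"
      using s sx diff_card_le_card_Diff[of U "{..<n}"] diff_le_mono2[of "card U" k n] by simp
    moreover have "real n * q = real n - real k" using assms by (simp add: q_def field_simps)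
    ultimately have le: "real n * q \<le> real (card ({..<n} - U))" using assms by linarith
    define T where "T = (\<Sum>i=1..B + D. step_weight x i * S m (move x i))"
    have T0: "0 \<le> T" by (auto simp: T_def intro!: sum_nonneg mult_nonneg_nonneg S0 step_weight_nonneg)
    have "q ^ Suc m * S (Suc m) (fst s) = q ^ m * ((real n * q) * T)"
      by (simp add: sx SS T_def)
    also have "\<dots> \<le> q ^ m * (real (card ({..<n} - U)) * T)"
      using q le T0 by (intro mult_left_mono mult_right_mono) auto
    also have "\<dots> = (\<Sum>v\<in>{..<n} - U. \<Sum>i=1..B + D. step_weight x i * (q ^ m * S m (move x i)))"
      by (simp add: T_def sum_distrib_left mult_ac)
    also have "\<dots> = (\<Sum>v<n. \<Sum>i=1..B + D. (if v \<in> U then 0 else step_weight x i) * (q ^ m * S m (move x i)))"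
      by (intro sum.mono_neutral_cong_left) auto
    also have "\<dots> = (\<Sum>a\<in>letters. w s a * (q ^ m * S m (fst (nx s a))))"
      unfolding sum_letters[of "\<lambda>v i. (if v \<in> U then 0 else step_weight x i) * (q ^ m * S m (move x i))", symmetric]
      by (simp add: w_def nx_def sx case_prod_unfold cong: if_cong)
    finally show "G (Suc m) s \<le> (\<Sum>a\<in>letters. w s a * G m (nx s a))" by (simp add: G_def)
  next
    fix m and s :: "int \<times> nat set" and a :: "nat \<times> nat"
    assume "finite (snd s) \<and> card (snd s) + Suc m \<le> k"
    thus "finite (snd (nx s a)) \<and> card (snd (nx s a)) + m \<le> k"
      by (cases s) (auto simp: nx_def card_insert_if)
  qed (auto simp: G_def w_def S_def words_0 case_prod_unfold intro: step_weight_nonneg)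
  also have "\<dots> = (\<Sum>l\<in>{l \<in> words letters k. distinct (map fst l)}. band_weight x l)"
    unfolding pw by (rule sum.mono_neutral_cong_right) (auto simp: finite_words)
  finally show ?thesis by (simp add: S_def q_def G_def)
qed

end

section \<open>Closed walks overlapping a fixed cycle\<close>

text \<open>
  \<open>\<kappa>\<close> records the steps of a fixed cycle on the arcs whose weight another closed walk shares with it:
  there the step is forced and costs nothing, elsewhere it has probability about \<open>h\<close>. Each maximal run
  of shared arcs is charged an extra factor \<open>y\<close>. Walks with at least one run are then controlled by
  dividing the sum over all walks by \<open>y\<close>, without a separate count of runs.
\<close>

locale overlap = lattice +
  fixes \<kappa> :: "nat \<times> nat \<Rightarrow> nat option" and k :: nat and y \<mu> \<gamma> :: real and g :: "int \<Rightarrow> real" and VC :: "nat set"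
  assumes finite_nbrs: "\<And>v. finite {w. \<kappa> (v, w) \<noteq> None}"
    and card_nbrs: "\<And>v. card {w. \<kappa> (v, w) \<noteq> None} \<le> 2"
    and card_other_nbrs: "\<And>u v. \<kappa> (u, v) \<noteq> None \<Longrightarrow> card {w. \<kappa> (v, w) \<noteq> None \<and> w \<noteq> u} \<le> 1"
    and VC: "finite VC" "card VC \<le> k" "\<And>u v. \<kappa> (u, v) \<noteq> None \<Longrightarrow> u \<in> VC \<and> v \<in> VC"
    and irrefl: "\<And>v. \<kappa> (v, v) = None"
    and y: "1 \<le> y" and \<gamma>: "0 < \<gamma>" and \<mu>: "1 \<le> \<mu>"
    and g: "\<And>x. in_band B x \<Longrightarrow> \<gamma> \<le> g x" "\<And>x. in_band B x \<Longrightarrow> g x \<le> 1"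
    and g_super: "\<And>x. in_band B x \<Longrightarrow>
      real n * h * (\<Sum>i=1..B + D. step_weight x i * g (move x i)) \<le> \<mu> * g x"
begin

definition arc_weight :: "nat \<times> nat \<Rightarrow> nat \<Rightarrow> real" where
  "arc_weight a i = (case \<kappa> a of None \<Rightarrow> h | Some j \<Rightarrow> if i = j then 1 else 0)"

text \<open>\<open>(u, v)\<close> is the arc just traversed. The factor \<open>y\<close> is charged
  where a run opens. Inside a run an immediate reversal is excluded; this matters when both
  orientations of an edge are shared.\<close>

definition run_weight :: "nat \<Rightarrow> nat \<Rightarrow> nat \<Rightarrow> real" where
  "run_weight u v w = (if \<kappa> (v, w) = None then 1 else if \<kappa> (u, v) = None then y else if w = u then 0 else 1)"

definition walk_weight :: "nat \<times> nat \<times> int \<Rightarrow> nat \<times> nat \<Rightarrow> real" where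
  "walk_weight = (\<lambda>(u, v, x) (w, i). step_weight x i * arc_weight (v, w) i * run_weight u v w)"

definition walk_next :: "nat \<times> nat \<times> int \<Rightarrow> nat \<times> nat \<Rightarrow> nat \<times> nat \<times> int" where
  "walk_next = (\<lambda>(u, v, x) (w, i). (v, w, move x i))"

text \<open>Bounds the total \<open>run_weight\<close> of the shared arcs leaving \<open>v\<close>:
  two arcs that would each open a run, or a single one that continues it.\<close>

definition entry :: "nat \<Rightarrow> nat \<Rightarrow> real" where
  "entry u v = (if v \<notin> VC then 0 else if \<kappa> (u, v) = None then 2 * y else 1)"

text \<open>
  The term \<open>z\<close> to the power \<open>- x\<close> is exactly invariant along shared arcs, because the weights of
  the steps of a run telescope to \<open>z\<close> to the power of its height difference.
\<close>

definition potential :: "real \<Rightarrow> real \<Rightarrow> nat \<times> nat \<times> int \<Rightarrow> real" where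
  "potential E A = (\<lambda>(u, v, x). E * g x + A * entry u v * z powr (- real_of_int x))"

text \<open>The price of returning to the cycle by a fresh arc: at most \<open>k\<close> targets,
  weight \<open>h\<close>, at most \<open>B\<close> steps within the band, height term at most
  z^(-B), and \<open>2 y\<close> for the run that may open. Dividing by \<gamma> expresses it in
  multiples of \<open>g\<close>.\<close>

definition \<beta>0 :: real where
  "\<beta>0 = 2 * y * real k * h * real B * z powr (- real B) / \<gamma>"

lemma \<beta>0_nonneg: "0 \<le> \<beta>0"
  using y h \<gamma> by (simp add: \<beta>0_def)

lemma entry_nonneg: "0 \<le> entry u v"
  using y by (simp add: entry_def)

lemma g_pos: "in_band B x \<Longrightarrow> 0 < g x"
  using g(1)[of x] \<gamma> by linarith

lemma potential_mono:
  "E \<le> E' \<Longrightarrow> A \<le> A' \<Longrightarrow> in_band B x \<Longrightarrow> potential E A (u, v, x) \<le> potential E' A' (u, v, x)"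
  unfolding potential_def using g_pos[of x] entry_nonneg[of u v]
  by (auto intro!: add_mono mult_right_mono)

lemma walk_weight_nonneg: "0 \<le> walk_weight s a"
  using y h step_weight_nonneg
  by (cases s; cases a) (auto simp: walk_weight_def arc_weight_def run_weight_def split: option.splits)

lemma card_band_steps: "card {i \<in> {1..B + D}. in_band B (move x i)} \<le> B"
proof -
  have "{i \<in> {1..B + D}. in_band B (move x i)} \<subseteq> (\<lambda>b. nat (int b + int D - x)) ` {1..<B}"
  proof
    fix i assume i: "i \<in> {i \<in> {1..B + D}. in_band B (move x i)}"
    hence "i = nat (int (nat (move x i)) + int D - x)" "nat (move x i) \<in> {1..<B}"
      by (auto simp: in_band_def move_def)
    thus "i \<in> (\<lambda>b. nat (int b + int D - x)) ` {1..<B}" by blast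
  qed
  from surj_card_le[OF _ this] show ?thesis by simp
qed

lemma band_sum_shift_le:
  assumes "in_band B x"
  shows "(\<Sum>i=1..B + D. step_weight x i * z powr (- real_of_int (move x i))) \<le> real B * z powr (- real B)"
proof -
  note c = card_band_steps[of x]
  have "(\<Sum>i=1..B + D. step_weight x i * z powr (- real_of_int (move x i))) =
      (\<Sum>i\<in>{i \<in> {1..B + D}. in_band B (move x i)}. z powr (- real_of_int x))"
    unfolding step_weight_shift by (intro sum.mono_neutral_cong_right) auto
  also have "\<dots> = real (card {i \<in> {1..B + D}. in_band B (move x i)}) * z powr (- real_of_int x)" by simp
  also have "\<dots> \<le> real B * z powr (- real B)"
    using c z assms by (intro mult_mono) (auto simp: in_band_def powr_mono')
  finally show ?thesis .
qed

lemma run_weight_sum_le: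
  "(\<Sum>w\<in>{w. \<kappa> (v, w) \<noteq> None}. run_weight u v w) \<le> entry u v"
proof (cases "v \<in> VC")
  case False
  hence "{w. \<kappa> (v, w) \<noteq> None} = {}" using VC(3) by blast
  thus ?thesis using False by (simp add: entry_def)
next
  case True
  show ?thesis
  proof (cases "\<kappa> (u, v) = None")
    case F: True
    have "(\<Sum>w\<in>{w. \<kappa> (v, w) \<noteq> None}. run_weight u v w) = (\<Sum>w\<in>{w. \<kappa> (v, w) \<noteq> None}. y)"
      using F by (intro sum.cong) (auto simp: run_weight_def)
    also have "\<dots> \<le> 2 * y" using card_nbrs[of v] y by (simp add: mult_right_mono)
    finally show ?thesis using F True by (simp add: entry_def)
  next
    case F: False
    have "(\<Sum>w\<in>{w. \<kappa> (v, w) \<noteq> None}. run_weight u v w) = (\<Sum>w\<in>{w. \<kappa> (v, w) \<noteq> None \<and> w \<noteq> u}. 1)"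
      using F finite_nbrs by (intro sum.mono_neutral_cong_right) (auto simp: run_weight_def)
    also have "\<dots> \<le> 1" using card_other_nbrs[OF F] by simp
    finally show ?thesis using F True by (auto simp: entry_def)
  qed
qed

text \<open>The pair \<open>(E, A)\<close> evolves linearly. Fresh arcs multiply \<open>E\<close> by
  \<mu> and, on reaching the cycle, turn \<open>A\<close> into at most \<open>\<beta>0 * A\<close>
  units of \<open>g\<close>. Shared arcs preserve \<open>A\<close> and convert \<open>E\<close> into
  \<open>A\<close>, because g \<le> 1 \<le> z^(-x) in the band.\<close>

lemma potential_step:
  assumes x: "in_band B x" and E: "0 \<le> E" and A: "0 \<le> A"
  shows "(\<Sum>a\<in>letters. walk_weight (u, v, x) a * potential E A (walk_next (u, v, x) a))
    \<le> potential (\<mu> * E + \<beta>0 * A) (A + E) (u, v, x)"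
proof -
  \<comment> \<open>This part is summed over all letters, those on shared arcs included. The
    harmless overcount makes the full sum of \<open>g_super\<close> available.\<close>
  define fresh where "fresh w i = h * (E * (step_weight x i * g (move x i)) +
      (if w \<in> VC then A * (2 * y) * (step_weight x i * z powr (- real_of_int (move x i))) else 0))" for w i
  define Z where "Z = (A + E) * z powr (- real_of_int x)"
  have fresh0: "0 \<le> fresh w i" for w i
    using h E A y step_weight_nonneg g_pos[of "move x i"]
    by (cases "in_band B (move x i)") (auto simp: fresh_def step_weight_def intro!: mult_nonneg_nonneg add_nonneg_nonneg less_imp_le[OF tilt_pos])
  have Z0: "0 \<le> Z" using E A by (simp add: Z_def)
  have rw0: "0 \<le> run_weight u v w" for w using y by (simp add: run_weight_def)
  have term_le: "walk_weight (u, v, x) (w, i) * potential E A (walk_next (u, v, x) (w, i))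
     \<le> fresh w i + (if \<kappa> (v, w) = Some i then run_weight u v w * Z else 0)" for w i
  proof (cases "\<kappa> (v, w)")
    case None
    thus ?thesis
      by (simp add: walk_weight_def walk_next_def potential_def arc_weight_def run_weight_def entry_def fresh_def algebra_simps)
  next
    case (Some j)
    show ?thesis
    proof (cases "i = j \<and> in_band B (move x i)")
      case True
      hence mb: "in_band B (move x i)" by blast
      have co: "entry v w = 1" using Some VC(3)[of v w] by (simp add: entry_def)
      have "step_weight x i * g (move x i) \<le> step_weight x i * z powr (- real_of_int (move x i))"
      proof (rule mult_left_mono)
        have "z powr 0 \<le> z powr (- real_of_int (move x i))"
          using z mb by (intro powr_mono') (auto simp: in_band_def)
        thus "g (move x i) \<le> z powr (- real_of_int (move x i))" using g(2)[OF mb] z by simp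
      qed (rule step_weight_nonneg)
      also have e: "\<dots> = z powr (- real_of_int x)" using mb by (simp add: step_weight_shift)
      finally have "E * (step_weight x i * g (move x i)) + A * (step_weight x i * z powr (- real_of_int (move x i))) \<le> Z"
        unfolding e Z_def using E by (simp add: distrib_right mult_left_mono)
      hence "run_weight u v w * (E * (step_weight x i * g (move x i)) + A * (step_weight x i * z powr (- real_of_int (move x i))))
         \<le> run_weight u v w * Z" by (intro mult_left_mono rw0)
      thus ?thesis using True Some co fresh0[of w i]
        by (simp add: walk_weight_def walk_next_def potential_def arc_weight_def algebra_simps)
    next
      case False
      hence "walk_weight (u, v, x) (w, i) = 0" using Some by (auto simp: walk_weight_def arc_weight_def step_weight_def)
      thus ?thesis using fresh0[of w i] rw0[of w] Z0 by simp
    qed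
  qed
  have "(\<Sum>a\<in>letters. walk_weight (u, v, x) a * potential E A (walk_next (u, v, x) a))
      \<le> (\<Sum>a\<in>letters. fresh (fst a) (snd a) + (if \<kappa> (v, fst a) = Some (snd a) then run_weight u v (fst a) * Z else 0))"
    by (rule sum_mono) (use term_le in \<open>simp only: prod.collapse[symmetric] split_paired_all fst_conv snd_conv\<close>)
  also have "\<dots> = (\<Sum>w<n. \<Sum>i=1..B + D. fresh w i) +
      (\<Sum>w<n. \<Sum>i=1..B + D. if \<kappa> (v, w) = Some i then run_weight u v w * Z else 0)"
    unfolding sum_letters[of "\<lambda>w i. fresh w i + (if \<kappa> (v, w) = Some i then run_weight u v w * Z else 0)"]
    by (simp add: sum.distrib)
  also have "(\<Sum>w<n. \<Sum>i=1..B + D. fresh w i) \<le> E * (\<mu> * g x) + \<beta>0 * A * g x"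
  proof -
    have "(\<Sum>w<n. \<Sum>i=1..B + D. fresh w i) =
        E * (real n * h * (\<Sum>i=1..B + D. step_weight x i * g (move x i))) +
        (\<Sum>w<n. if w \<in> VC then h * A * (2 * y) * (\<Sum>i=1..B + D. step_weight x i * z powr (- real_of_int (move x i))) else 0)"
    proof -
      have "(\<Sum>i=1..B + D. fresh w i) = E * (h * (\<Sum>i=1..B + D. step_weight x i * g (move x i))) +
        (if w \<in> VC then h * A * (2 * y) * (\<Sum>i=1..B + D. step_weight x i * z powr (- real_of_int (move x i))) else 0)" for w
        by (cases "w \<in> VC") (simp_all add: fresh_def sum.distrib distrib_left sum_distrib_left mult_ac)
      thus ?thesis by (simp add: sum.distrib mult_ac)
    qed
    also have "(\<Sum>w<n. if w \<in> VC then h * A * (2 * y) * (\<Sum>i=1..B + D. step_weight x i * z powr (- real_of_int (move x i))) else 0)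
      \<le> (\<Sum>w<n. if w \<in> VC then h * A * (2 * y) * (real B * z powr (- real B)) else 0)"
      using band_sum_shift_le[OF x] h A y by (intro sum_mono) (auto intro!: mult_left_mono)
    also have "\<dots> = real (card ({..<n} \<inter> VC)) * (h * A * (2 * y) * (real B * z powr (- real B)))"
      by (simp add: sum.inter_restrict[symmetric])
    also have "\<dots> \<le> real k * (h * A * (2 * y) * (real B * z powr (- real B)))"
    proof (rule mult_right_mono)
      have "card ({..<n} \<inter> VC) \<le> card VC" using VC(1) by (intro card_mono) auto
      thus "real (card ({..<n} \<inter> VC)) \<le> real k" using VC(2) by simp
    qed (use h A y in auto)
    also have "\<dots> = \<beta>0 * A * \<gamma>" using \<gamma> by (simp add: \<beta>0_def)
    also have "\<dots> \<le> \<beta>0 * A * g x" using g(1)[OF x] \<beta>0_nonneg A by (intro mult_left_mono) auto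
    also have "E * (real n * h * (\<Sum>i=1..B + D. step_weight x i * g (move x i))) \<le> E * (\<mu> * g x)"
      using g_super[OF x] E by (rule mult_left_mono)
    finally show ?thesis by simp
  qed
  also have "(\<Sum>w<n. \<Sum>i=1..B + D. if \<kappa> (v, w) = Some i then run_weight u v w * Z else 0) \<le> entry u v * Z"
  proof -
    have "(\<Sum>w<n. \<Sum>i=1..B + D. if \<kappa> (v, w) = Some i then run_weight u v w * Z else 0)
        \<le> (\<Sum>w<n. if \<kappa> (v, w) \<noteq> None then run_weight u v w * Z else 0)"
    proof (rule sum_mono)
      fix w
      show "(\<Sum>i=1..B + D. if \<kappa> (v, w) = Some i then run_weight u v w * Z else 0)
         \<le> (if \<kappa> (v, w) \<noteq> None then run_weight u v w * Z else 0)"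
        using rw0[of w] Z0 by (cases "\<kappa> (v, w)") (auto simp: sum.delta' if_distrib)
    qed
    also have "\<dots> = (\<Sum>w\<in>{..<n} \<inter> {w. \<kappa> (v, w) \<noteq> None}. run_weight u v w * Z)"
      by (simp add: sum.inter_restrict)
    also have "\<dots> \<le> (\<Sum>w\<in>{w. \<kappa> (v, w) \<noteq> None}. run_weight u v w * Z)"
      using finite_nbrs rw0 Z0 by (intro sum_mono2) auto
    also have "\<dots> = (\<Sum>w\<in>{w. \<kappa> (v, w) \<noteq> None}. run_weight u v w) * Z" by (simp add: sum_distrib_right)
    also have "\<dots> \<le> entry u v * Z" using run_weight_sum_le Z0 by (rule mult_right_mono)
    finally show ?thesis .
  qed
  finally show ?thesis by (simp add: potential_def Z_def algebra_simps)
qed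

text \<open>The loop \<open>(t, t)\<close> stands in for the missing previous arc. It is never
  shared, so a run may open at the very first step.\<close>

definition start :: "nat \<Rightarrow> int \<Rightarrow> nat \<times> nat \<times> int" where "start t x = (t, t, x)"

definition ends :: "nat \<Rightarrow> nat \<times> nat \<times> int \<Rightarrow> real" where
  "ends t = (\<lambda>(u, v, x). if v = t then 1 else 0)"

text \<open>The \<open>A\<close> term alone already covers the terminal value. The seed \<delta> is
  added to \<open>E\<close> so that the inflow \<open>\<beta>0 * A\<close> is at most \<beta> times
  \<open>E\<close>; then \<open>E\<close> grows by \<mu> + \<beta> per step while \<open>A\<close>
  accumulates it.\<close>

lemma closed_sum_on:
  assumes x: "in_band B x" and t: "t \<in> VC"
    and \<delta>: "0 \<le> \<delta>" and \<beta>: "0 \<le> \<beta>" "\<beta>0 * (1 + \<delta> * real k) \<le> \<beta> * \<delta>"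
  shows "(\<Sum>l\<in>words letters k. path_weight walk_weight walk_next (ends t) (start t x) l)
    \<le> \<delta> * (\<mu> + \<beta>) ^ k + (1 + \<delta> * real k * (\<mu> + \<beta>) ^ k) * (2 * y) * z powr (- real_of_int x)"
proof -
  define \<nu> where "\<nu> = \<mu> + \<beta>"
  have \<nu>: "1 \<le> \<nu>" using \<mu> \<beta> by (simp add: \<nu>_def)
  define G where "G m = potential (\<delta> * \<nu> ^ m) (1 + \<delta> * real m * \<nu> ^ m)" for m
  have "(\<Sum>l\<in>words letters k. path_weight walk_weight walk_next (ends t) (start t x) l) \<le> G k (start t x)"
  proof (rule path_sum_le[where P = "\<lambda>(u, v, x). in_band B x" and M = k])
    fix m and s :: "nat \<times> nat \<times> int"
    assume s: "case s of (u, v, x) \<Rightarrow> in_band B x" and m: "m < k"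
    obtain u v x' where [simp]: "s = (u, v, x')" by (cases s) auto
    have x': "in_band B x'" using s by simp
    have nm: "1 \<le> \<nu> ^ m" using \<nu> by (rule one_le_power)
    have "(\<Sum>a\<in>letters. walk_weight s a * G m (walk_next s a)) \<le>
      potential (\<mu> * (\<delta> * \<nu> ^ m) + \<beta>0 * (1 + \<delta> * real m * \<nu> ^ m)) (1 + \<delta> * real m * \<nu> ^ m + \<delta> * \<nu> ^ m) s"
      using potential_step[OF x', of "\<delta> * \<nu> ^ m" "1 + \<delta> * real m * \<nu> ^ m" u v] \<delta> \<nu> by (simp add: G_def)
    also have "\<dots> \<le> G (Suc m) s"
    proof -
      have "\<beta>0 * (1 + \<delta> * real m * \<nu> ^ m) \<le> \<beta>0 * ((1 + \<delta> * real k) * \<nu> ^ m)"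
      proof (intro mult_left_mono \<beta>0_nonneg)
        have "\<delta> * real m * \<nu> ^ m \<le> \<delta> * real k * \<nu> ^ m" using m \<delta> nm by (intro mult_right_mono mult_left_mono) auto
        thus "1 + \<delta> * real m * \<nu> ^ m \<le> (1 + \<delta> * real k) * \<nu> ^ m" using nm by (simp add: distrib_right)
      qed
      also have "\<dots> \<le> \<beta> * \<delta> * \<nu> ^ m" using \<beta>(2) nm
        unfolding mult.assoc[symmetric, of \<beta>0] by (intro mult_right_mono) auto
      finally have 1: "\<mu> * (\<delta> * \<nu> ^ m) + \<beta>0 * (1 + \<delta> * real m * \<nu> ^ m) \<le> \<delta> * \<nu> ^ Suc m"
        by (simp add: \<nu>_def algebra_simps)
      have "\<delta> * real (Suc m) * \<nu> ^ m \<le> \<delta> * real (Suc m) * \<nu> ^ Suc m"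
        using \<nu> \<delta> by (intro mult_left_mono power_increasing) auto
      hence 2: "1 + \<delta> * real m * \<nu> ^ m + \<delta> * \<nu> ^ m \<le> 1 + \<delta> * real (Suc m) * \<nu> ^ Suc m"
        by (simp add: algebra_simps)
      show ?thesis using potential_mono[OF 1 2 x'] by (simp only: G_def \<open>s = _\<close>)
    qed
    finally show "(\<Sum>a\<in>letters. walk_weight s a * G m (walk_next s a)) \<le> G (Suc m) s" .
  next
    fix s :: "nat \<times> nat \<times> int"
    assume s: "case s of (u, v, x) \<Rightarrow> in_band B x"
    obtain u v x' where [simp]: "s = (u, v, x')" by (cases s) auto
    have x': "in_band B x'" using s by simp
    have "1 \<le> entry u v * z powr (- real_of_int x')" if "v = t"
    proof -
      have "z powr 0 \<le> z powr (- real_of_int x')" using z x' by (intro powr_mono') (auto simp: in_band_def)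
      moreover have "1 \<le> entry u v" using that t y by (simp add: entry_def)
      ultimately show ?thesis using z mult_mono[of 1 "entry u v" 1 "z powr (- real_of_int x')"] by simp
    qed
    moreover have "0 \<le> entry u v * z powr (- real_of_int x')" "0 \<le> \<delta> * g x'"
      using entry_nonneg \<delta> g_pos[OF x'] by auto
    ultimately show "ends t s \<le> G 0 s" by (auto simp: ends_def G_def potential_def)
  next
    fix s a assume "walk_weight s a \<noteq> 0"
    thus "case walk_next s a of (u, v, x) \<Rightarrow> in_band B x"
      by (auto simp: walk_weight_def walk_next_def step_weight_def split: prod.splits if_splits)
  qed (use x walk_weight_nonneg in \<open>auto simp: start_def\<close>)
  also have "\<dots> = \<delta> * \<nu> ^ k * g x + (1 + \<delta> * real k * \<nu> ^ k) * (2 * y) * z powr (- real_of_int x)"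
    using t by (simp add: G_def potential_def start_def entry_def irrefl)
  also have "\<delta> * \<nu> ^ k * g x \<le> \<delta> * \<nu> ^ k * 1"
    using g(2)[OF x] \<delta> \<nu> by (intro mult_left_mono) auto
  finally show ?thesis by (simp add: \<nu>_def)
qed

text \<open>Such a walk must end with a fresh arc into \<open>t\<close>, whose factor
  \<open>h\<close> pays for the up to \<open>n\<close> choices of \<open>t\<close>. The indicator
  \<open>ends t\<close> is therefore kept at \<open>m = 0\<close>: it has one target, whereas a
  multiple of \<open>g\<close> would be summed over all \<open>n\<close> vertices. Since
  \<open>entry t t = 0\<close>, only the \<open>E\<close> term survives at the start.\<close>

lemma closed_sum_off:
  assumes x: "in_band B x" and t: "t \<notin> VC" and k: "0 < k"
    and \<beta>: "0 \<le> \<beta>" "\<beta>0 * real k \<le> \<beta>"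
  shows "(\<Sum>l\<in>words letters k. path_weight walk_weight walk_next (ends t) (start t x) l)
    \<le> h * real B * z powr (- real D) / \<gamma> * (\<mu> + \<beta>) ^ k"
proof -
  define \<nu> where "\<nu> = \<mu> + \<beta>"
  have \<nu>: "1 \<le> \<nu>" using \<mu> \<beta> by (simp add: \<nu>_def)
  define E where "E = h * real B * z powr (- real D) / \<gamma>"
  have E: "0 \<le> E" using h \<gamma> by (simp add: E_def)
  define G where "G m = (if m = 0 then ends t else potential (E * \<nu> ^ m) (E * real m * \<nu> ^ m))" for m
  have "(\<Sum>l\<in>words letters k. path_weight walk_weight walk_next (ends t) (start t x) l) \<le> G k (start t x)"
  proof (rule path_sum_le[where P = "\<lambda>(u, v, x). in_band B x" and M = k])
    fix m and s :: "nat \<times> nat \<times> int"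
    assume s: "case s of (u, v, x) \<Rightarrow> in_band B x" and m: "m < k"
    obtain u v x' where [simp]: "s = (u, v, x')" by (cases s) auto
    have x': "in_band B x'" using s by simp
    show "(\<Sum>a\<in>letters. walk_weight s a * G m (walk_next s a)) \<le> G (Suc m) s"
    proof (cases "m = 0")
      case False
      have nm: "1 \<le> \<nu> ^ m" using \<nu> by (rule one_le_power)
      have "(\<Sum>a\<in>letters. walk_weight s a * G m (walk_next s a)) \<le>
        potential (\<mu> * (E * \<nu> ^ m) + \<beta>0 * (E * real m * \<nu> ^ m)) (E * real m * \<nu> ^ m + E * \<nu> ^ m) s"
        using potential_step[OF x', of "E * \<nu> ^ m" "E * real m * \<nu> ^ m" u v] E \<nu> False by (simp add: G_def)
      also have "\<dots> \<le> G (Suc m) s"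
      proof -
        have "\<beta>0 * real m \<le> \<beta>0 * real k" using m \<beta>0_nonneg by (intro mult_left_mono) auto
        hence "\<beta>0 * real m \<le> \<beta>" using \<beta>(2) by linarith
        hence "\<beta>0 * real m * (E * \<nu> ^ m) \<le> \<beta> * (E * \<nu> ^ m)" using E \<nu> by (intro mult_right_mono) auto
        hence 1: "\<mu> * (E * \<nu> ^ m) + \<beta>0 * (E * real m * \<nu> ^ m) \<le> E * \<nu> ^ Suc m"
          by (simp add: \<nu>_def algebra_simps)
        have "E * real (Suc m) * \<nu> ^ m \<le> E * real (Suc m) * \<nu> ^ Suc m"
          using \<nu> E by (intro mult_left_mono power_increasing) auto
        hence 2: "E * real m * \<nu> ^ m + E * \<nu> ^ m \<le> E * real (Suc m) * \<nu> ^ Suc m"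
          by (simp add: algebra_simps)
        show ?thesis using potential_mono[OF 1 2 x'] by (simp only: G_def \<open>s = _\<close> nat.distinct if_False)
      qed
      finally show ?thesis .
    next
      case True
      have nb: "\<kappa> (v, t) = None" using t VC(3)[of v t] by (cases "\<kappa> (v, t)") auto
      have "(\<Sum>a\<in>letters. walk_weight s a * G m (walk_next s a)) =
          (\<Sum>w<n. \<Sum>i=1..B + D. step_weight x' i * arc_weight (v, w) i * run_weight u v w * (if w = t then 1 else 0))"
        using sum_letters[of "\<lambda>w i. step_weight x' i * arc_weight (v, w) i * run_weight u v w * (if w = t then 1 else 0)"] True
        by (simp add: G_def walk_weight_def walk_next_def ends_def case_prod_unfold)
      also have "\<dots> = (\<Sum>w<n. if w = t then \<Sum>i=1..B + D. step_weight x' i * h else 0)"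
        using nb by (intro sum.cong) (auto simp: arc_weight_def run_weight_def)
      also have "\<dots> \<le> (\<Sum>i=1..B + D. step_weight x' i * h)"
        using h step_weight_nonneg by (auto simp: sum.delta intro!: sum_nonneg)
      also have "\<dots> = (\<Sum>i=1..B + D. step_weight x' i) * h" by (simp add: sum_distrib_right)
      also have "(\<Sum>i=1..B + D. step_weight x' i) \<le> real B * z powr (- real D)"
      proof -
        note c = card_band_steps[of x']
        have "(\<Sum>i=1..B + D. step_weight x' i) = (\<Sum>i\<in>{i \<in> {1..B + D}. in_band B (move x' i)}. tilt i)"
          unfolding step_weight_def by (intro sum.mono_neutral_cong_right) auto
        also have "\<dots> \<le> (\<Sum>i\<in>{i \<in> {1..B + D}. in_band B (move x' i)}. z powr (- real D))"
          using z by (intro sum_mono) (auto simp: tilt_def powr_mono')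
        also have "\<dots> \<le> real B * z powr (- real D)" using c by (simp add: mult_right_mono)
        finally show ?thesis .
      qed
      also have "real B * z powr (- real D) * h = E * \<gamma>" using \<gamma> by (simp add: E_def)
      also have "\<dots> \<le> E * \<nu> * g x'" using E \<nu> g(1)[OF x'] \<gamma> by (intro mult_mono) (auto simp: mult_le_cancel_left1)
      also have "\<dots> \<le> G (Suc m) s"
        using True E \<nu> entry_nonneg by (simp add: G_def potential_def)
      finally show ?thesis using h by (simp add: mult_right_mono)
    qed
  next
    fix s a assume "walk_weight s a \<noteq> 0"
    thus "case walk_next s a of (u, v, x) \<Rightarrow> in_band B x"
      by (auto simp: walk_weight_def walk_next_def step_weight_def split: prod.splits if_splits)
  qed (use x walk_weight_nonneg in \<open>auto simp: start_def G_def\<close>)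
  also have "\<dots> = E * \<nu> ^ k * g x" using t k by (simp add: G_def potential_def start_def entry_def)
  also have "\<dots> \<le> E * \<nu> ^ k * 1" using g(2)[OF x] E \<nu> by (intro mult_left_mono) auto
  finally show ?thesis by (simp add: \<nu>_def E_def)
qed

end

section \<open>Arcs of cycles\<close>

fun darcs :: "nat \<Rightarrow> (nat \<times> nat) list \<Rightarrow> ((nat \<times> nat) \<times> nat) list" where
  "darcs v [] = []"
| "darcs v (a # l) = ((v, fst a), snd a) # darcs (fst a) l"

lemma darcs_sources: "map (fst \<circ> fst) (darcs v l) = butlast (v # map fst l)"
  by (induction v l rule: darcs.induct) auto

lemma darcs_targets: "map (snd \<circ> fst) (darcs v l) = map fst l"
  by (induction v l rule: darcs.induct) auto

lemma length_darcs [simp]: "length (darcs v l) = length l"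
  by (induction v l rule: darcs.induct) auto

lemma darcs_steps: "map snd (darcs v l) = map snd l"
  by (induction v l rule: darcs.induct) auto

lemma in_darcsD: "((u, w), i) \<in> set (darcs v l) \<Longrightarrow> u \<in> insert v (fst ` set l) \<and> w \<in> fst ` set l \<and> i \<in> snd ` set l"
  by (induction v l rule: darcs.induct) auto

lemma darcs_first: "v \<notin> fst ` set l \<Longrightarrow> ((v, w), i) \<in> set (darcs v l) \<Longrightarrow> l \<noteq> [] \<and> fst (hd l) = w"
  by (cases l) (auto dest: in_darcsD)

text \<open>A word lists the vertices entered, so starting from its last vertex closes it to a
  cycle.\<close>

definition closed_darcs :: "(nat \<times> nat) list \<Rightarrow> ((nat \<times> nat) \<times> nat) list" where
  "closed_darcs c = darcs (fst (last c)) c"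

lemma closed_darcs_sources:
  assumes "c \<noteq> []" "distinct (map fst c)"
  shows "distinct (map (fst \<circ> fst) (closed_darcs c))"
proof -
  have "map fst c = butlast (map fst c) @ [fst (last c)]"
    using assms(1) append_butlast_last_id[of "map fst c"] by (simp add: last_map)
  hence "distinct (butlast (map fst c) @ [fst (last c)])" using assms(2) by simp
  thus ?thesis using assms(1) by (simp add: closed_darcs_def darcs_sources)
qed

lemma closed_darcs_targets: "distinct (map fst c) \<Longrightarrow> distinct (map (snd \<circ> fst) (closed_darcs c))"
  by (simp add: closed_darcs_def darcs_targets)

lemma length_closed_darcs [simp]: "length (closed_darcs c) = length c"
  by (simp add: closed_darcs_def)

lemma closed_darcs_vertices:
  assumes "c \<noteq> []" "((u, w), i) \<in> set (closed_darcs c)"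
  shows "u \<in> fst ` set c" "w \<in> fst ` set c" "i \<in> snd ` set c"
  using in_darcsD[OF assms(2)[unfolded closed_darcs_def]] assms(1) by auto

lemma closed_darcs_target_unique:
  assumes "c \<noteq> []" "distinct (map fst c)"
    and "((u, w), i) \<in> set (closed_darcs c)" "((u, w'), i') \<in> set (closed_darcs c)"
  shows "w = w'"
  using closed_darcs_sources[OF assms(1,2)] assms(3,4)
  by (auto simp: distinct_map dest: inj_onD[where x = "((u, w), i)" and y = "((u, w'), i')"])

lemma closed_darcs_source_unique:
  assumes "distinct (map fst c)"
    and "((u, w), i) \<in> set (closed_darcs c)" "((u', w), i') \<in> set (closed_darcs c)"
  shows "u = u'"
  using closed_darcs_targets[OF assms(1)] assms(2,3)
  by (auto simp: distinct_map dest: inj_onD[where x = "((u, w), i)" and y = "((u', w), i')"])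

lemma darcs_irrefl:
  "distinct (v # map fst l) \<Longrightarrow> ((u, w), i) \<in> set (darcs v l) \<Longrightarrow> u \<noteq> w"
  by (induction v l rule: darcs.induct) auto

lemma closed_darcs_irrefl:
  assumes "2 \<le> length c" "distinct (map fst c)" "((u, w), i) \<in> set (closed_darcs c)"
  shows "u \<noteq> w"
proof -
  obtain a b l where c: "c = a # b # l" using assms(1) by (cases c; cases "tl c") auto
  have "last (b # l) \<in> set (b # l)" by (rule last_in_set) simp
  hence "fst (last (b # l)) \<in> fst ` set (b # l)" by (rule imageI)
  moreover have "fst a \<notin> fst ` set (b # l)" using assms(2) c by simp
  ultimately have "fst (last c) \<noteq> fst a" using c by auto
  thus ?thesis using assms(2,3) c darcs_irrefl[of "fst a" "b # l" u w i]
    by (auto simp: closed_darcs_def)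
qed

text \<open>The two intended instances are the identity, for directed arcs, and the unordered pair
  of endpoints, for undirected edges.\<close>

locale arc_key =
  fixes key :: "nat \<times> nat \<Rightarrow> 'e"
  assumes key_eqD: "key a = key b \<Longrightarrow> a = b \<or> a = prod.swap b"
begin

lemma distinct_keys_path:
  "distinct (v # map fst l) \<Longrightarrow> distinct (map (key \<circ> fst) (darcs v l))"
proof (induction v l rule: darcs.induct)
  case (2 v a l)
  have "key (v, fst a) \<noteq> key b" if b: "(b, i) \<in> set (darcs (fst a) l)" for b i
  proof
    assume "key (v, fst a) = key b"
    from key_eqD[OF this] have "b = (v, fst a) \<or> b = (fst a, v)" by (cases b) auto
    thus False using in_darcsD[of _ _ i "fst a" l] b 2 by auto
  qed
  hence "key (v, fst a) \<notin> set (map (key \<circ> fst) (darcs (fst a) l))"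
    by (metis (no_types, lifting) comp_apply image_iff list.set_map prod.collapse)
  moreover have "distinct (map (key \<circ> fst) (darcs (fst a) l))" using 2 by (simp add: o_def)
  ultimately show ?case by (simp add: o_def)
qed simp

text \<open>The closing arc could only collide with its own reversal, and then the second vertex of
  the word would equal its last one. Length at least 3 rules this out.\<close>

lemma distinct_keys_closed:
  assumes "3 \<le> length c" "distinct (map fst c)"
  shows "distinct (map (key \<circ> fst) (closed_darcs c))"
proof -
  obtain a b d l where c: "c = a # b # d # l"
    using assms(1) by (cases c; cases "tl c"; cases "tl (tl c)") auto
  define t where "t = fst (last c)"
  have t: "t \<in> fst ` set (d # l)" using c last_in_set[of "d # l"] by (auto simp: t_def)
  have "key (t, fst a) \<noteq> key e" if e: "(e, i) \<in> set (darcs (fst a) (b # d # l))" for e i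
  proof
    assume "key (t, fst a) = key e"
    from key_eqD[OF this] have "e = (t, fst a) \<or> e = (fst a, t)" by (cases e) auto
    thus False
    proof
      assume "e = (t, fst a)"
      thus False using in_darcsD[of t "fst a" i "fst a" "b # d # l"] e assms(2) c by auto
    next
      assume "e = (fst a, t)"
      hence "fst b = t" using darcs_first[of "fst a" "b # d # l" t i] e assms(2) c by auto
      thus False using t assms(2) c by auto
    qed
  qed
  hence "key (t, fst a) \<notin> set (map (key \<circ> fst) (darcs (fst a) (b # d # l)))"
    by (metis (no_types, lifting) comp_apply image_iff list.set_map prod.collapse)
  moreover have "distinct (map (key \<circ> fst) (darcs (fst a) (b # d # l)))"
    using assms(2) c by (intro distinct_keys_path) auto
  moreover have "closed_darcs c = ((t, fst a), snd a) # darcs (fst a) (b # d # l)"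
    by (simp add: closed_darcs_def t_def c)
  ultimately show ?thesis by (simp only: list.map distinct.simps o_apply fst_conv simp_thms)
qed

definition key_steps :: "(nat \<times> nat) list \<Rightarrow> ('e \<times> nat) list" where
  "key_steps c = map (\<lambda>(a, i). (key a, i)) (closed_darcs c)"

lemma distinct_key_steps:
  "3 \<le> length c \<Longrightarrow> distinct (map fst c) \<Longrightarrow> distinct (map fst (key_steps c))"
  using distinct_keys_closed[of c] by (simp add: key_steps_def o_def case_prod_unfold)

lemma length_key_steps [simp]: "length (key_steps c) = length c"
  by (simp add: key_steps_def)

text \<open>The lookup is by key: if keys forget orientation, the reversal of an arc of
  \<open>c\<close> is shared too, with the same forced step.\<close>

definition shared :: "(nat \<times> nat) list \<Rightarrow> nat \<times> nat \<Rightarrow> nat option" where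
  "shared c a = map_of (key_steps c) (key a)"

lemma sharedD:
  assumes "shared c (u, w) \<noteq> None"
  shows "(\<exists>i. ((u, w), i) \<in> set (closed_darcs c)) \<or> (\<exists>i. ((w, u), i) \<in> set (closed_darcs c))"
proof -
  obtain j where "map_of (key_steps c) (key (u, w)) = Some j" using assms by (auto simp: shared_def)
  from map_of_SomeD[OF this] obtain a where a: "(a, j) \<in> set (closed_darcs c)" "key (u, w) = key a"
    by (auto simp: key_steps_def)
  from key_eqD[OF a(2)] have "a = (u, w) \<or> a = (w, u)" by (cases a) auto
  thus ?thesis using a by auto
qed

context
  fixes c :: "(nat \<times> nat) list"
  assumes c: "3 \<le> length c" "distinct (map fst c)"
begin

lemma shared_irrefl: "shared c (v, v) = None"
proof (rule ccontr)
  assume "shared c (v, v) \<noteq> None"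
  from sharedD[OF this] obtain i where "((v, v), i) \<in> set (closed_darcs c)" by blast
  from closed_darcs_irrefl[OF _ c(2) this] show False using c(1) by simp
qed

lemma shared_vertices:
  assumes "shared c (u, v) \<noteq> None"
  shows "u \<in> fst ` set c \<and> v \<in> fst ` set c"
proof -
  have c0: "c \<noteq> []" using c(1) by auto
  from sharedD[OF assms] show ?thesis
    using closed_darcs_vertices(1,2)[OF c0] by blast
qed

lemma card_vertices: "card (fst ` set c) = length c"
  using distinct_card[OF c(2)] by simp

text \<open>Around \<open>v\<close> the cycle has one predecessor and one successor, which bounds all shared arcs at \<open>v\<close>.\<close>

lemma ex_nbrs: "\<exists>N. finite N \<and> card N \<le> 2 \<and> (\<forall>w. shared c (v, w) \<noteq> None \<or> shared c (w, v) \<noteq> None \<longrightarrow> w \<in> N)"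
proof -
  have c0: "c \<noteq> []" using c by auto
  define S where "S = {w. \<exists>i. ((v, w), i) \<in> set (closed_darcs c)}"
  define P where "P = {w. \<exists>i. ((w, v), i) \<in> set (closed_darcs c)}"
  have one: "finite A \<and> card A \<le> 1" if "\<And>w w'. w \<in> A \<Longrightarrow> w' \<in> A \<Longrightarrow> w = w'" for A :: "nat set"
  proof (cases "A = {}")
    case False
    then obtain w where "w \<in> A" by blast
    hence "A = {w}" using that by blast
    thus ?thesis by simp
  qed simp
  have "finite S \<and> card S \<le> 1"
    unfolding S_def by (rule one) (use closed_darcs_target_unique[OF c0 c(2)] in blast)
  moreover have "finite P \<and> card P \<le> 1"
    unfolding P_def by (rule one) (use closed_darcs_source_unique[OF c(2)] in blast)
  ultimately have "finite (S \<union> P)" "card (S \<union> P) \<le> 2" using card_Un_le[of S P] by auto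
  moreover have "w \<in> S \<union> P" if "shared c (v, w) \<noteq> None \<or> shared c (w, v) \<noteq> None" for w
    using that sharedD[of c v w] sharedD[of c w v] by (auto simp: S_def P_def)
  ultimately show ?thesis by blast
qed

lemma finite_shared_nbrs: "finite {w. shared c (v, w) \<noteq> None}"
  and card_shared_nbrs: "card {w. shared c (v, w) \<noteq> None} \<le> 2"
proof -
  obtain N where N: "finite N" "card N \<le> 2" "{w. shared c (v, w) \<noteq> None} \<subseteq> N"
    using ex_nbrs[of v] by blast
  show "finite {w. shared c (v, w) \<noteq> None}" using N finite_subset by blast
  show "card {w. shared c (v, w) \<noteq> None} \<le> 2" using card_mono[OF N(1,3)] N(2) by simp
qed

lemma card_shared_other_nbrs:
  assumes "shared c (u, v) \<noteq> None"
  shows "card {w. shared c (v, w) \<noteq> None \<and> w \<noteq> u} \<le> 1"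
proof -
  obtain N where N: "finite N" "card N \<le> 2"
    "\<And>w. shared c (v, w) \<noteq> None \<or> shared c (w, v) \<noteq> None \<Longrightarrow> w \<in> N"
    using ex_nbrs[of v] by blast
  have "u \<in> N" using N(3) assms by blast
  hence "card (N - {u}) \<le> 1" using N by simp
  moreover have "card {w. shared c (v, w) \<noteq> None \<and> w \<noteq> u} \<le> card (N - {u})"
    using N by (intro card_mono) auto
  ultimately show ?thesis by simp
qed

end

end

section \<open>Cycles as closed walks that never reverse along a shared arc\<close>

context overlap
begin

text \<open>Exactly the walks on which no factor \<open>run_weight\<close> vanishes.\<close>

fun nonback :: "nat \<Rightarrow> nat \<Rightarrow> (nat \<times> nat) list \<Rightarrow> bool" where
  "nonback u v [] = True"
| "nonback u v (a # l) = ((\<kappa> (u, v) = None \<or> fst a \<noteq> u) \<and> nonback v (fst a) l)"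

lemma nonback_distinct: "distinct (u # v # map fst l) \<Longrightarrow> nonback u v l"
  by (induction l arbitrary: u v) auto

lemma nonback_closed:
  assumes "3 \<le> length c" "distinct (map fst c)"
  shows "nonback (fst (last c)) (fst (last c)) c"
proof -
  obtain a b d l where c: "c = a # b # d # l"
    using assms(1) by (cases c; cases "tl c"; cases "tl (tl c)") auto
  have "fst (last c) \<in> fst ` set (d # l)" using c last_in_set[of "d # l"] by auto
  hence "fst b \<noteq> fst (last c)" using assms(2) c by auto
  moreover have "nonback (fst a) (fst b) (d # l)" using assms(2) c by (intro nonback_distinct) auto
  ultimately show ?thesis by (simp add: c irrefl)
qed

definition arcs_weight :: "((nat \<times> nat) \<times> nat) list \<Rightarrow> real" where
  "arcs_weight L = (\<Prod>(a, i)\<leftarrow>L. arc_weight a i)"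

lemma arcs_weight_nonneg: "0 \<le> arcs_weight L"
  using h by (induction L) (auto simp: arcs_weight_def arc_weight_def split: option.splits)

text \<open>If the previous arc is not shared, the first shared arc met later opens a run and
  supplies one factor \<open>y\<close>. Further runs supply factors at least 1, which are
  discarded.\<close>

lemma path_weight_ge:
  assumes "nonback u v l" "last (v # map fst l) = t"
  shows "(if \<kappa> (u, v) = None \<and> (\<exists>a\<in>fst ` set (darcs v l). \<kappa> a \<noteq> None) then y else 1) *
      (band_weight x l * arcs_weight (darcs v l)) \<le> path_weight walk_weight walk_next (ends t) (u, v, x) l"
  using assms
proof (induction l arbitrary: u v x)
  case Nil
  thus ?case by (simp add: ends_def arcs_weight_def)
next
  case (Cons a l)
  obtain w i where a: "a = (w, i)" by (cases a)
  define c1 where "c1 = (if \<kappa> (u, v) = None \<and> (\<exists>a\<in>fst ` set (darcs v (a # l)). \<kappa> a \<noteq> None) then y else 1)"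
  define c2 where "c2 = (if \<kappa> (v, w) = None \<and> (\<exists>a\<in>fst ` set (darcs w l). \<kappa> a \<noteq> None) then y else 1)"
  have IH: "c2 * (band_weight (move x i) l * arcs_weight (darcs w l)) \<le> path_weight walk_weight walk_next (ends t) (v, w, move x i) l"
    unfolding c2_def using Cons.prems a by (intro Cons.IH) auto
  have "c1 \<le> run_weight u v w * c2"
    using y Cons.prems(1) by (auto simp: c1_def c2_def run_weight_def a)
  moreover define R where "R = step_weight x i * arc_weight (v, w) i"
  have R: "0 \<le> R" using step_weight_nonneg h by (auto simp: R_def arc_weight_def split: option.splits)
  ultimately have "c1 * (R * (band_weight (move x i) l * arcs_weight (darcs w l)))
      \<le> (run_weight u v w * c2) * (R * (band_weight (move x i) l * arcs_weight (darcs w l)))"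
    using band_weight_nonneg arcs_weight_nonneg by (intro mult_right_mono mult_nonneg_nonneg) auto
  also have "\<dots> = (R * run_weight u v w) * (c2 * (band_weight (move x i) l * arcs_weight (darcs w l)))"
    by (simp add: mult_ac)
  also have "\<dots> \<le> (R * run_weight u v w) * path_weight walk_weight walk_next (ends t) (v, w, move x i) l"
    using IH R y by (intro mult_left_mono) (auto simp: run_weight_def)
  finally show ?case unfolding c1_def[symmetric]
    by (simp add: a walk_weight_def walk_next_def R_def arcs_weight_def mult_ac)
qed

text \<open>The walk starts from an unshared loop, so every cycle counted on the left opens a run
  and its walk weight carries a factor \<open>y\<close>. The remaining sum is split by the closing
  vertex, on or off the fixed cycle.\<close>

lemma overlap_sum_le:
  assumes x: "in_band B x" and k: "3 \<le> k" and VCn: "VC \<subseteq> {..<n}"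
    and on: "\<And>t. t \<in> VC \<Longrightarrow> (\<Sum>l\<in>words letters k. path_weight walk_weight walk_next (ends t) (start t x) l) \<le> R1"
    and off: "\<And>t. t \<notin> VC \<Longrightarrow> (\<Sum>l\<in>words letters k. path_weight walk_weight walk_next (ends t) (start t x) l) \<le> R2"
    and R: "0 \<le> R1" "0 \<le> R2"
  shows "(\<Sum>l\<in>{l \<in> words letters k. distinct (map fst l) \<and> (\<exists>a\<in>fst ` set (closed_darcs l). \<kappa> a \<noteq> None)}.
      band_weight x l * arcs_weight (closed_darcs l)) \<le> (real k * R1 + real n * R2) / y"
proof -
  define S where "S = {l \<in> words letters k. distinct (map fst l) \<and> (\<exists>a\<in>fst ` set (closed_darcs l). \<kappa> a \<noteq> None)}"
  define p where "p t l = path_weight walk_weight walk_next (ends t) (start t x) l" for t l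
  have p0: "0 \<le> p t l" for t l
  proof -
    have "0 \<le> path_weight walk_weight walk_next (ends t) s l" for s
      by (induction l arbitrary: s) (auto simp: ends_def walk_weight_nonneg)
    thus ?thesis by (simp add: p_def)
  qed
  have fS: "finite S" by (simp add: S_def finite_words)
  have "y * (\<Sum>l\<in>S. band_weight x l * arcs_weight (closed_darcs l)) \<le> (\<Sum>l\<in>S. p (fst (last l)) l)"
    unfolding sum_distrib_left
  proof (rule sum_mono)
    fix l assume l: "l \<in> S"
    hence l': "length l = k" "distinct (map fst l)" "\<exists>a\<in>fst ` set (closed_darcs l). \<kappa> a \<noteq> None"
      by (auto simp: S_def words_def)
    have l0: "l \<noteq> []" using l' k by auto
    show "y * (band_weight x l * arcs_weight (closed_darcs l)) \<le> p (fst (last l)) l"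
      using path_weight_ge[OF nonback_closed[of l], of "fst (last l)" x] l' l0 k irrefl
      by (simp add: p_def start_def closed_darcs_def last_map)
  qed
  also have "\<dots> = (\<Sum>l\<in>S. \<Sum>t<n. if fst (last l) = t then p t l else 0)"
  proof (rule sum.cong)
    fix l assume l: "l \<in> S"
    hence "length l = k" "set l \<subseteq> letters" by (auto simp: S_def words_def)
    moreover from this have "last l \<in> set l" using k by (intro last_in_set) auto
    ultimately have "fst (last l) < n" by (auto simp: letters_def)
    thus "p (fst (last l)) l = (\<Sum>t<n. if fst (last l) = t then p t l else 0)" by simp
  qed simp
  also have "\<dots> \<le> (\<Sum>l\<in>S. \<Sum>t<n. p t l)" using p0 by (intro sum_mono) auto
  also have "\<dots> \<le> (\<Sum>l\<in>words letters k. \<Sum>t<n. p t l)"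
    using p0 by (intro sum_mono2) (auto simp: finite_words S_def intro!: sum_nonneg)
  also have "\<dots> = (\<Sum>t<n. \<Sum>l\<in>words letters k. p t l)" by (rule sum.swap)
  also have "\<dots> \<le> (\<Sum>t<n. (if t \<in> VC then R1 else 0) + R2)"
  proof (rule sum_mono)
    fix t
    show "(\<Sum>l\<in>words letters k. p t l) \<le> (if t \<in> VC then R1 else 0) + R2"
      using on[of t] off[of t] R by (auto simp: p_def)
  qed
  also have "\<dots> = real (card VC) * R1 + real n * R2"
    using VCn by (simp add: sum.distrib sum.inter_restrict[symmetric] Int_absorb1)
  also have "\<dots> \<le> real k * R1 + real n * R2" using VC(2) R by (auto intro: mult_right_mono)
  finally show ?thesis using y by (simp add: S_def field_simps)
qed

end

section \<open>Exponential weights in bins\<close>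

lemma exp_bin_bounds:
  fixes h :: real
  assumes "0 < h" "1 \<le> i"
  shows "exp (- (h * (real i - 1))) - exp (- (h * real i)) \<le> h"
    and "h * (1 - h * real i) \<le> exp (- (h * (real i - 1))) - exp (- (h * real i))"
proof -
  have e: "exp (- (h * (real i - 1))) = exp (- (h * real i)) * exp h"
    by (simp add: exp_add[symmetric] algebra_simps)
  have "1 - exp (- h) \<le> h" using exp_ge_add_one_self[of "- h"] by simp
  moreover have "exp (- (h * (real i - 1))) \<le> 1" using assms by simp
  ultimately have "exp (- (h * (real i - 1))) * (1 - exp (- h)) \<le> 1 * h"
    using assms by (intro mult_mono) auto
  moreover have "exp (- (h * (real i - 1))) * (1 - exp (- h)) = exp (- (h * (real i - 1))) - exp (- (h * real i))"
    by (simp add: exp_add[symmetric] algebra_simps)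
  ultimately show "exp (- (h * (real i - 1))) - exp (- (h * real i)) \<le> h" by simp
  have "h * (1 - h * real i) \<le> h * exp (- (h * real i))"
    using exp_ge_add_one_self[of "- (h * real i)"] assms by (intro mult_left_mono) auto
  also have "\<dots> \<le> (exp h - 1) * exp (- (h * real i))"
    by (rule mult_right_mono) (use exp_ge_add_one_self[of h] in linarith, simp)
  also have "\<dots> = exp (- (h * (real i - 1))) - exp (- (h * real i))" unfolding e by (simp add: algebra_simps)
  finally show "h * (1 - h * real i) \<le> exp (- (h * (real i - 1))) - exp (- (h * real i))" .
qed

locale exp_weights = prob_space M for M :: "'a measure" +
  fixes E :: "'e set" and W :: "'e \<Rightarrow> 'a \<Rightarrow> real" and h :: real
  assumes iid: "iid_exponential M E W" and h_pos: "0 < h"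
begin

definition bin_prob :: "nat \<Rightarrow> real" where
  "bin_prob i = exp (- (h * (real i - 1))) - exp (- (h * real i))"

definition bins :: "('e \<times> nat) list \<Rightarrow> 'a set" where
  "bins L = {\<omega> \<in> space M. \<forall>(e, i)\<in>set L. h * (real i - 1) < W e \<omega> \<and> W e \<omega> \<le> h * real i}"

lemma rv: "e \<in> E \<Longrightarrow> W e \<in> borel_measurable M"
  using iid by (auto simp: iid_exponential_def indep_vars_def)

lemma bins_single:
  assumes e: "e \<in> E" and i: "1 \<le> i"
  shows "prob (W e -` {h * (real i - 1)<..h * real i} \<inter> space M) = bin_prob i"
proof -
  have D: "distributed M lborel (W e) (exponential_density 1)" using iid e by (simp add: iid_exponential_def)
  note [measurable] = rv[OF e]
  have le: "h * (real i - 1) \<le> h * real i" "0 \<le> h * (real i - 1)" using h_pos i by auto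
  have "W e -` {h * (real i - 1)<..h * real i} \<inter> space M =
    {x \<in> space M. W e x \<le> h * real i} - {x \<in> space M. W e x \<le> h * (real i - 1)}" by auto
  also have "prob \<dots> = prob {x \<in> space M. W e x \<le> h * real i} - prob {x \<in> space M. W e x \<le> h * (real i - 1)}"
    using le by (intro finite_measure_Diff) auto
  also have "\<dots> = (1 - exp (- (h * real i) * 1)) - (1 - exp (- (h * (real i - 1)) * 1))"
    using le h_pos by (intro arg_cong2[where f = "(-)"] exponential_distributedD_le[OF D]) auto
  finally show ?thesis by (simp add: bin_prob_def)
qed

lemma bins_sets: "fst ` set L \<subseteq> E \<Longrightarrow> bins L \<in> events"
proof (induction L)
  case (Cons a L)
  obtain e i where a: "a = (e, i)" by (cases a)
  have [measurable]: "W e \<in> borel_measurable M" using Cons.prems a by (intro rv) auto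
  have "bins (a # L) = {\<omega> \<in> space M. h * (real i - 1) < W e \<omega> \<and> W e \<omega> \<le> h * real i} \<inter> bins L"
    by (auto simp: bins_def a)
  moreover have "bins L \<in> events" using Cons by auto
  ultimately show ?case by simp
qed (simp add: bins_def)

lemma prob_bins:
  assumes d: "distinct (map fst L)" and E: "fst ` set L \<subseteq> E" and pos: "\<forall>i\<in>snd ` set L. 1 \<le> i"
  shows "prob (bins L) = (\<Prod>i\<leftarrow>map snd L. bin_prob i)"
proof (cases "L = []")
  case True
  thus ?thesis by (simp add: bins_def prob_space)
next
  case False
  have ind: "indep_vars (\<lambda>_. borel) W E" using iid by (simp add: iid_exponential_def)
  define A where "A e = {h * (real (the (map_of L e)) - 1)<..h * real (the (map_of L e))}" for e
  have A: "A (fst p) = {h * (real (snd p) - 1)<..h * real (snd p)}" if "p \<in> set L" for p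
    using map_of_is_SomeI[OF d, of "fst p" "snd p"] that by (simp add: A_def)
  have "bins L = (\<Inter>e\<in>fst ` set L. W e -` A e \<inter> space M)"
    using False A by (fastforce simp: bins_def)
  also have "prob \<dots> = (\<Prod>e\<in>fst ` set L. prob (W e -` A e \<inter> space M))"
    using False E by (intro indep_varsD[OF ind]) (auto simp: A_def)
  also have "\<dots> = (\<Prod>p\<in>set L. prob (W (fst p) -` A (fst p) \<inter> space M))"
    using d by (subst prod.reindex) (auto simp: distinct_map)
  also have "\<dots> = (\<Prod>p\<in>set L. bin_prob (snd p))"
  proof (rule prod.cong)
    fix p assume p: "p \<in> set L"
    have "fst p \<in> E" "1 \<le> snd p" using p E pos by auto
    thus "prob (W (fst p) -` A (fst p) \<inter> space M) = bin_prob (snd p)"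
      using A[OF p] bins_single by simp
  qed simp
  also have "\<dots> = (\<Prod>p\<leftarrow>L. bin_prob (snd p))"
    using d by (subst prod.distinct_set_conv_list) (auto simp: distinct_map)
  finally show ?thesis by (simp add: o_def)
qed

lemma bin_prob_nonneg: "0 \<le> bin_prob i"
  using h_pos by (simp add: bin_prob_def)

lemma prod_bin_prob_le: "\<forall>i\<in>set is. 1 \<le> i \<Longrightarrow> (\<Prod>i\<leftarrow>is. bin_prob i) \<le> h ^ length is"
  using h_pos bin_prob_nonneg exp_bin_bounds(1)[OF h_pos]
  by (induction "is") (auto intro!: mult_mono prod_list_nonneg simp: bin_prob_def[symmetric])

lemma prod_bin_prob_ge:
  assumes "\<forall>i\<in>set is. 1 \<le> i \<and> i \<le> b" "h * real b \<le> 1"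
  shows "(h * (1 - h * real b)) ^ length is \<le> (\<Prod>i\<leftarrow>is. bin_prob i)"
  using assms(1)
proof (induction "is")
  case (Cons i "is")
  have "h * (1 - h * real b) \<le> h * (1 - h * real i)" using Cons.prems h_pos by (intro mult_left_mono) auto
  also have "\<dots> \<le> bin_prob i" unfolding bin_prob_def using Cons.prems h_pos by (intro exp_bin_bounds(2)) auto
  finally show ?case using Cons assms(2) h_pos bin_prob_nonneg by (auto intro!: mult_mono)
qed simp

lemma bins_append: "bins (L @ L') = bins L \<inter> bins L'"
  by (auto simp: bins_def)

definition cond_weight :: "('e \<times> nat) list \<Rightarrow> 'e \<times> nat \<Rightarrow> real" where
  "cond_weight L = (\<lambda>(e, i). case map_of L e of None \<Rightarrow> h | Some j \<Rightarrow> if i = j then 1 else 0)"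

lemma prob_bins_Int_disjoint:
  assumes "distinct (map fst L)" "distinct (map fst L')" "fst ` set L \<subseteq> E" "fst ` set L' \<subseteq> E"
    "\<forall>i\<in>snd ` set L. 1 \<le> i" "\<forall>i\<in>snd ` set L'. 1 \<le> i" "fst ` set L \<inter> fst ` set L' = {}"
  shows "prob (bins L \<inter> bins L') = prob (bins L) * prob (bins L')"
proof -
  have "prob (bins (L @ L')) = (\<Prod>i\<leftarrow>map snd (L @ L'). bin_prob i)"
    using assms by (intro prob_bins) auto
  thus ?thesis using assms prob_bins[of L] prob_bins[of L'] by (simp add: bins_append)
qed

text \<open>Either some common key is asked to lie in two disjoint bins and the intersection is
  empty, or the requirements of \<open>L'\<close> on common keys are implied by \<open>L\<close> and
  only its new keys cost a factor \<open>h\<close>.\<close>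

lemma prob_bins_Int_le:
  assumes L: "distinct (map fst L)" "fst ` set L \<subseteq> E" "\<forall>i\<in>snd ` set L. 1 \<le> i"
    and L': "distinct (map fst L')" "fst ` set L' \<subseteq> E" "\<forall>i\<in>snd ` set L'. 1 \<le> i"
  shows "prob (bins L \<inter> bins L') \<le> h ^ length L * (\<Prod>p\<leftarrow>L'. cond_weight L p)"
proof (cases "\<exists>p\<in>set L'. cond_weight L p = 0")
  case True
  then obtain e i j where p: "(e, i) \<in> set L'" "map_of L e = Some j" "i \<noteq> j"
    using h_pos by (auto simp: cond_weight_def split: option.splits if_splits)
  from map_of_SomeD[OF p(2)] have "(e, j) \<in> set L" .
  have "bins L \<inter> bins L' = {}"
  proof (rule ccontr)
    assume "bins L \<inter> bins L' \<noteq> {}"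
    then obtain \<omega> where \<omega>: "\<omega> \<in> bins L" "\<omega> \<in> bins L'" by blast
    have "h * (real i - 1) < h * real j" "h * (real j - 1) < h * real i"
      using \<omega> p(1) \<open>(e, j) \<in> set L\<close> by (fastforce simp: bins_def)+
    hence "real i - 1 < real j" "real j - 1 < real i" using h_pos by simp_all
    thus False using p(3) by linarith
  qed
  moreover have "0 \<le> (\<Prod>p\<leftarrow>L'. cond_weight L p)"
    using h_pos by (intro prod_list_nonneg) (auto simp: cond_weight_def split: option.splits)
  ultimately show ?thesis using h_pos by simp
next
  case False
  define F where "F = filter (\<lambda>p. map_of L (fst p) = None) L'"
  have sub: "set F \<subseteq> set L'" by (auto simp: F_def)
  hence FE: "fst ` set F \<subseteq> E" using L'(2) by blast
  have "(\<Prod>p\<leftarrow>L'. cond_weight L p) = h ^ length F"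
    using False unfolding F_def
  proof (induction L')
    case (Cons p L')
    thus ?case by (cases p) (auto simp: cond_weight_def split: option.splits if_splits)
  qed simp
  moreover have "prob (bins L \<inter> bins L') \<le> prob (bins (L @ F))"
    using L(2) FE sub by (intro finite_measure_mono bins_sets) (auto simp: bins_def image_Un)
  moreover have "prob (bins (L @ F)) = (\<Prod>i\<leftarrow>map snd (L @ F). bin_prob i)"
  proof (rule prob_bins)
    have "distinct (map fst F)" using L'(1) by (simp add: F_def distinct_map_filter)
    moreover have "e \<notin> fst ` set L" if "e \<in> fst ` set F" for e
    proof -
      have "map_of L e = None" using that by (auto simp: F_def)
      thus ?thesis by (simp add: map_of_eq_None_iff)
    qed
    ultimately show "distinct (map fst (L @ F))" using L(1) by (simp add: disjoint_iff) blast
  qed (use L L' sub FE in \<open>auto simp: image_Un\<close>)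
  moreover have "\<dots> \<le> h ^ length (map snd (L @ F))"
    using L L' sub by (intro prod_bin_prob_le) auto
  ultimately show ?thesis by (simp add: power_add)
qed

end

text \<open>The Chebyshev argument for the weighted count \<open>X\<close>: it vanishes off the
  union of the events of positive weight, so S1^2 times the probability of the complement is at most
  the variance of \<open>X\<close>.\<close>

lemma (in prob_space) weighted_second_moment:
  assumes fin: "finite S" and ev: "\<And>c. c \<in> S \<Longrightarrow> A c \<in> events" and wt: "\<And>c. c \<in> S \<Longrightarrow> 0 \<le> w c"
    and S1: "S1 = (\<Sum>c\<in>S. w c * prob (A c))" and pos: "0 < S1"
  shows "2 - (\<Sum>c\<in>S. \<Sum>c'\<in>S. w c * w c' * prob (A c \<inter> A c')) / S1\<^sup>2
    \<le> prob (\<Union>c\<in>{c \<in> S. 0 < w c}. A c)"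
proof -
  define X where "X \<omega> = (\<Sum>c\<in>S. w c * indicator (A c) \<omega>)" for \<omega>
  define S2 where "S2 = (\<Sum>c\<in>S. \<Sum>c'\<in>S. w c * w c' * prob (A c \<inter> A c'))"
  define U where "U = (\<Union>c\<in>{c \<in> S. 0 < w c}. A c)"
  have U: "U \<in> events" using fin ev by (auto simp: U_def)
  have i1: "integrable M (\<lambda>\<omega>. w c * indicator (A c) \<omega>)" if "c \<in> S" for c
    using ev[OF that] by (intro integrable_mult_right integrable_real_indicator) (auto simp: emeasure_eq_measure)
  have iX: "integrable M X" unfolding X_def using i1 by (intro Bochner_Integration.integrable_sum)
  have EX: "expectation X = S1"
    unfolding X_def S1 using ev by (subst Bochner_Integration.integral_sum[OF i1]) (auto intro!: sum.cong simp: sets.Int_space_eq2)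
  have XX: "(X \<omega>)\<^sup>2 = (\<Sum>c\<in>S. \<Sum>c'\<in>S. w c * w c' * indicator (A c \<inter> A c') \<omega>)" for \<omega>
    by (simp add: X_def power2_eq_square sum_product indicator_inter_arith mult_ac)
  have i2: "integrable M (\<lambda>\<omega>. w c * w c' * indicator (A c \<inter> A c') \<omega>)" if "c \<in> S" "c' \<in> S" for c c'
    using ev that by (intro integrable_mult_right integrable_real_indicator) (auto simp: emeasure_eq_measure)
  have iX2: "integrable M (\<lambda>\<omega>. (X \<omega>)\<^sup>2)" unfolding XX using i2 by (intro Bochner_Integration.integrable_sum)
  have EX2: "expectation (\<lambda>\<omega>. (X \<omega>)\<^sup>2) = S2"
  proof -
    have "expectation (\<lambda>\<omega>. (X \<omega>)\<^sup>2) = (\<Sum>c\<in>S. \<Sum>c'\<in>S. expectation (\<lambda>\<omega>. w c * w c' * indicator (A c \<inter> A c') \<omega>))"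
      unfolding XX using i2 by (subst Bochner_Integration.integral_sum) (auto intro!: Bochner_Integration.integrable_sum sum.cong Bochner_Integration.integral_sum)
    thus ?thesis using ev by (auto simp: S2_def sets.Int_space_eq2 intro!: sum.cong)
  qed
  have "S1\<^sup>2 * prob (space M - U) = expectation (\<lambda>\<omega>. S1\<^sup>2 * indicator (space M - U) \<omega>)"
    using U by (simp add: sets.Int_space_eq2)
  also have "\<dots> \<le> expectation (\<lambda>\<omega>. (X \<omega> - S1)\<^sup>2)"
  proof (rule integral_mono)
    show "integrable M (\<lambda>\<omega>. S1\<^sup>2 * indicator (space M - U) \<omega>)"
      using U by (intro integrable_mult_right integrable_real_indicator) (auto simp: emeasure_eq_measure)
    show "integrable M (\<lambda>\<omega>. (X \<omega> - S1)\<^sup>2)" using iX iX2 by (simp add: power2_diff)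
    fix \<omega> assume "\<omega> \<in> space M"
    show "S1\<^sup>2 * indicator (space M - U) \<omega> \<le> (X \<omega> - S1)\<^sup>2"
    proof (cases "\<omega> \<in> U")
      case False
      have "X \<omega> = 0" unfolding X_def
      proof (intro sum.neutral ballI)
        fix c assume "c \<in> S"
        thus "w c * indicator (A c) \<omega> = 0" using False wt[of c] by (cases "w c = 0") (auto simp: U_def indicator_def)
      qed
      thus ?thesis using \<open>\<omega> \<in> space M\<close> by (auto simp: indicator_def)
    qed simp
  qed
  also have "\<dots> = S2 - S1\<^sup>2"
  proof -
    have "expectation (\<lambda>\<omega>. (X \<omega> - S1)\<^sup>2) = expectation (\<lambda>\<omega>. (X \<omega>)\<^sup>2 + S1\<^sup>2 - (2 * S1) * X \<omega>)"
      by (simp add: power2_diff mult_ac)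
    also have "\<dots> = S2 + S1\<^sup>2 - (2 * S1) * S1" using iX iX2 by (simp add: EX EX2 prob_space)
    finally show ?thesis by (simp add: power2_eq_square)
  qed
  finally have "S1\<^sup>2 * (1 - prob U) \<le> S2 - S1\<^sup>2" using U by (simp add: prob_compl)
  hence "1 - prob U \<le> S2 / S1\<^sup>2 - 1" using pos by (simp add: field_simps)
  thus ?thesis by (simp add: S2_def U_def)
qed

section \<open>The second moment\<close>

locale cycle_model = lattice n B D h z + arc_key key + exp_weights M E W h
  for n B D :: nat and h z :: real and key :: "nat \<times> nat \<Rightarrow> 'e"
    and M :: "'a measure" and E :: "'e set" and W +
  assumes E: "E = key ` {(u, v). u < n \<and> v < n \<and> u \<noteq> v}"
begin

definition cycles :: "nat \<Rightarrow> (nat \<times> nat) list set" where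
  "cycles k = {c \<in> words letters k. distinct (map fst c)}"

lemma finite_cycles: "finite (cycles k)"
  by (simp add: cycles_def finite_words)

definition cond_prod :: "(nat \<times> nat) list \<Rightarrow> (nat \<times> nat) list \<Rightarrow> real" where
  "cond_prod c c' = (\<Prod>p\<leftarrow>key_steps c'. cond_weight (key_steps c) p)"

definition meets :: "(nat \<times> nat) list \<Rightarrow> (nat \<times> nat) list \<Rightarrow> bool" where
  "meets c c' \<longleftrightarrow> (\<exists>a\<in>fst ` set (closed_darcs c'). shared c a \<noteq> None)"

context
  fixes k :: nat
  assumes k: "3 \<le> k"
begin

lemma cyclesD:
  assumes "c \<in> cycles k"
  shows "length c = k" "distinct (map fst c)" "c \<noteq> []" "fst ` set c \<subseteq> {..<n}" "snd ` set c \<subseteq> {1..B + D}"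
  using assms k by (auto simp: cycles_def words_def letters_def)

lemma key_steps_props:
  assumes c: "c \<in> cycles k"
  shows "distinct (map fst (key_steps c))" "fst ` set (key_steps c) \<subseteq> E" "snd ` set (key_steps c) \<subseteq> {1..B + D}"
proof -
  note D = cyclesD[OF c]
  show "distinct (map fst (key_steps c))" using distinct_key_steps D k by simp
  have *: "u < n \<and> w < n \<and> u \<noteq> w \<and> i \<in> {1..B + D}" if "((u, w), i) \<in> set (closed_darcs c)" for u w i
    using closed_darcs_vertices[OF D(3) that] closed_darcs_irrefl[OF _ D(2) that] D(1,4,5) k by auto
  show "fst ` set (key_steps c) \<subseteq> E" using * by (fastforce simp: key_steps_def E)
  show "snd ` set (key_steps c) \<subseteq> {1..B + D}" using * by (fastforce simp: key_steps_def)
qed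

lemma prob_cycle_le: "c \<in> cycles k \<Longrightarrow> prob (bins (key_steps c)) \<le> h ^ k"
proof -
  assume c: "c \<in> cycles k"
  note D = cyclesD[OF c] and K = key_steps_props[OF c]
  have pos: "\<forall>i\<in>snd ` set (key_steps c). 1 \<le> i" using K(3) by auto
  show ?thesis using prob_bins[OF K(1,2) pos] prod_bin_prob_le[of "map snd (key_steps c)"] pos D(1) by simp
qed

lemma prob_cycle_ge:
  assumes c: "c \<in> cycles k" and hb: "h * real (B + D) \<le> 1"
  shows "(h * (1 - h * real (B + D))) ^ k \<le> prob (bins (key_steps c))"
proof -
  note D = cyclesD[OF c] and K = key_steps_props[OF c]
  have pos: "\<forall>i\<in>snd ` set (key_steps c). 1 \<le> i" using K(3) by auto
  have "\<forall>i\<in>set (map snd (key_steps c)). 1 \<le> i \<and> i \<le> B + D" using K(3) by fastforce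
  from prod_bin_prob_ge[OF this hb] show ?thesis using prob_bins[OF K(1,2) pos] D(1) by simp
qed

lemma prob_two_cycles_le:
  assumes c: "c \<in> cycles k" and c': "c' \<in> cycles k"
  shows "prob (bins (key_steps c) \<inter> bins (key_steps c')) \<le> h ^ k * (h ^ k + (if meets c c' then cond_prod c c' else 0))"
proof -
  note D = cyclesD[OF c] and K = key_steps_props[OF c]
  note D' = cyclesD[OF c'] and K' = key_steps_props[OF c']
  have pos: "\<forall>i\<in>snd ` set (key_steps c). 1 \<le> i" "\<forall>i\<in>snd ` set (key_steps c'). 1 \<le> i" using K(3) K'(3) by auto
  show ?thesis
  proof (cases "meets c c'")
    case True
    have "prob (bins (key_steps c) \<inter> bins (key_steps c')) \<le> h ^ k * cond_prod c c'"
      using prob_bins_Int_le[OF K(1,2) pos(1) K'(1,2) pos(2)] D(1) by (simp add: cond_prod_def)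
    also have "\<dots> \<le> h ^ k * (h ^ k + cond_prod c c')" using h by (intro mult_left_mono) auto
    finally show ?thesis using True by simp
  next
    case False
    have "fst ` set (key_steps c) \<inter> fst ` set (key_steps c') = {}"
    proof -
      have "e \<notin> fst ` set (key_steps c)" if "e \<in> fst ` set (key_steps c')" for e
      proof -
        have "fst ` set (key_steps c') = key ` fst ` set (closed_darcs c')"
          by (simp add: key_steps_def image_image case_prod_unfold)
        with that obtain a where a: "a \<in> fst ` set (closed_darcs c')" "e = key a" by blast
        from a(1) have "shared c a = None" using False by (auto simp: meets_def)
        thus ?thesis using a(2) by (simp add: shared_def map_of_eq_None_iff)
      qed
      thus ?thesis by blast
    qed
    from prob_bins_Int_disjoint[OF K(1) K'(1) K(2) K'(2) pos this]
    have "prob (bins (key_steps c) \<inter> bins (key_steps c')) \<le> h ^ k * h ^ k"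
      using prob_cycle_le[OF c] prob_cycle_le[OF c'] h by (simp add: mult_mono)
    thus ?thesis using False by simp
  qed
qed

text \<open>\<open>Y\<close> is an idealised first moment: repeated vertices are allowed and every
  bin has probability \<open>h\<close>. It bounds the true one from above and, up to the factor
  \<open>q\<close>, from below. Disjoint pairs thus contribute at most \<open>Y\<^sup>2\<close> to
  the second moment, and overlapping ones \<open>Y * Mx\<close>.\<close>

lemma prob_cycle_exists_ge:
  assumes kn: "k < n" and hb: "h * real (B + D) < 1"
    and Y: "Y = h ^ k * (\<Sum>l\<in>words letters k. band_weight x l)" "0 < Y"
    and Mx: "\<And>c. c \<in> cycles k \<Longrightarrow> (\<Sum>c'\<in>{c' \<in> cycles k. meets c c'}. band_weight x c' * cond_prod c c') \<le> Mx"
    and q: "q = (1 - h * real (B + D)) ^ k * (1 - real k / real n) ^ k"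
  shows "2 - (1 + Mx / Y) / q\<^sup>2 \<le> prob (\<Union>c\<in>{c \<in> cycles k. 0 < band_weight x c}. bins (key_steps c))"
proof -
  define w where "w = band_weight x"
  have w0: "0 \<le> w c" for c by (simp add: w_def band_weight_nonneg)
  define S1 where "S1 = (\<Sum>c\<in>cycles k. w c * prob (bins (key_steps c)))"
  define S2 where "S2 = (\<Sum>c\<in>cycles k. \<Sum>c'\<in>cycles k. w c * w c' * prob (bins (key_steps c) \<inter> bins (key_steps c')))"
  have q0: "0 < q" using kn hb unfolding q by (intro mult_pos_pos zero_less_power) auto
  have sum_le: "h ^ k * (\<Sum>c\<in>cycles k. w c) \<le> Y"
    unfolding Y w_def using h band_weight_nonneg
    by (intro mult_left_mono sum_mono2) (auto simp: cycles_def finite_words)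
  have "q * Y = (h * (1 - h * real (B + D))) ^ k * ((1 - real k / real n) ^ k * (\<Sum>l\<in>words letters k. band_weight x l))"
    by (simp add: q Y power_mult_distrib mult_ac)
  also have "\<dots> \<le> (h * (1 - h * real (B + D))) ^ k * (\<Sum>c\<in>cycles k. w c)"
    using distinct_band_sum_ge[of k x] kn hb h unfolding cycles_def w_def by (intro mult_left_mono) auto
  also have "\<dots> = (\<Sum>c\<in>cycles k. w c * (h * (1 - h * real (B + D))) ^ k)"
    by (subst sum_distrib_right[symmetric]) (rule mult.commute)
  also have "\<dots> \<le> S1" unfolding S1_def
    using prob_cycle_ge hb w0 by (intro sum_mono mult_left_mono) auto
  finally have S1: "q * Y \<le> S1" .
  have "S2 \<le> (\<Sum>c\<in>cycles k. w c * h ^ k * (Y + Mx))" unfolding S2_def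
  proof (rule sum_mono)
    fix c assume c: "c \<in> cycles k"
    have "(\<Sum>c'\<in>cycles k. w c * w c' * prob (bins (key_steps c) \<inter> bins (key_steps c')))
      \<le> (\<Sum>c'\<in>cycles k. w c * w c' * (h ^ k * (h ^ k + (if meets c c' then cond_prod c c' else 0))))"
      using prob_two_cycles_le[OF c] w0 by (intro sum_mono mult_left_mono) auto
    also have "\<dots> = w c * h ^ k * (h ^ k * (\<Sum>c'\<in>cycles k. w c') + (\<Sum>c'\<in>cycles k. if meets c c' then w c' * cond_prod c c' else 0))"
    proof -
      have "w c * w c' * (h ^ k * (h ^ k + (if meets c c' then cond_prod c c' else 0))) =
          w c * h ^ k * (h ^ k * w c' + (if meets c c' then w c' * cond_prod c c' else 0))" for c'
        by (simp add: algebra_simps)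
      thus ?thesis by (simp only: sum_distrib_left[symmetric] sum.distrib)
    qed
    also have "(\<Sum>c'\<in>cycles k. if meets c c' then w c' * cond_prod c c' else 0) = (\<Sum>c'\<in>{c' \<in> cycles k. meets c c'}. w c' * cond_prod c c')"
      using finite_cycles by (intro sum.mono_neutral_cong_right) auto
    also have "w c * h ^ k * (h ^ k * (\<Sum>c'\<in>cycles k. w c') + \<dots>) \<le> w c * h ^ k * (Y + Mx)"
      using sum_le Mx[OF c] w0 h by (intro mult_left_mono add_mono) (auto simp: w_def)
    finally show "(\<Sum>c'\<in>cycles k. w c * w c' * prob (bins (key_steps c) \<inter> bins (key_steps c'))) \<le> w c * h ^ k * (Y + Mx)" .
  qed
  also have "\<dots> = h ^ k * (\<Sum>c\<in>cycles k. w c) * (Y + Mx)" by (simp add: sum_distrib_left sum_distrib_right mult_ac)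
  finally have S2: "S2 \<le> h ^ k * (\<Sum>c\<in>cycles k. w c) * (Y + Mx)" .
  have S1pos: "0 < S1" using S1 q0 Y(2) mult_pos_pos[of q Y] by linarith
  have "cycles k \<noteq> {}" using S1pos by (auto simp: S1_def)
  then obtain c where c: "c \<in> cycles k" by blast
  have Mx0: "0 \<le> Mx"
  proof -
    have "0 \<le> cond_prod c c'" for c' using h
      by (auto simp: cond_prod_def cond_weight_def intro!: prod_list_nonneg split: option.splits)
    hence "0 \<le> (\<Sum>c'\<in>{c' \<in> cycles k. meets c c'}. band_weight x c' * cond_prod c c')"
      using w0 by (intro sum_nonneg mult_nonneg_nonneg) (auto simp: w_def)
    thus ?thesis using Mx[OF c] by linarith
  qed
  have "S2 \<le> Y * (Y + Mx)" using S2 sum_le Y(2) Mx0 mult_right_mono[OF sum_le, of "Y + Mx"] by linarith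
  moreover have "(q * Y)\<^sup>2 \<le> S1\<^sup>2" using S1 q0 Y(2) by (intro power_mono) auto
  ultimately have "S2 / S1\<^sup>2 \<le> Y * (Y + Mx) / (q * Y)\<^sup>2"
    using q0 Y(2) Mx0 by (intro frac_le) auto
  also have "\<dots> = (1 + Mx / Y) / q\<^sup>2" using Y(2) q0 by (simp add: field_simps power2_eq_square)
  finally have "2 - (1 + Mx / Y) / q\<^sup>2 \<le> 2 - S2 / S1\<^sup>2" by simp
  also have "\<dots> \<le> prob (\<Union>c\<in>{c \<in> cycles k. 0 < w c}. bins (key_steps c))"
    unfolding S2_def using key_steps_props S1pos w0
    by (intro weighted_second_moment finite_cycles bins_sets) (auto simp: S1_def)
  finally show ?thesis by (simp add: w_def)
qed

text \<open>The conditional cost of \<open>c'\<close> given \<open>c\<close> is exactly the arc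
  weight for the map \<open>shared c\<close>, so the \<open>overlap\<close> estimates apply with the
  vertices of \<open>c\<close> as \<open>VC\<close>.\<close>

lemma meets_sum_le:
  assumes c: "c \<in> cycles k" and x: "in_band B x"
    and par: "1 \<le> y" "0 < \<gamma>" "1 \<le> \<mu>" "0 \<le> \<delta>" "0 \<le> \<beta>"
    and g: "\<And>x. in_band B x \<Longrightarrow> \<gamma> \<le> g x" "\<And>x. in_band B x \<Longrightarrow> g x \<le> 1"
    and g_super: "\<And>x. in_band B x \<Longrightarrow>
      real n * h * (\<Sum>i=1..B + D. step_weight x i * g (move x i)) \<le> \<mu> * g x"
    and b0: "b0 = 2 * y * real k * h * real B * z powr (- real B) / \<gamma>"
    and \<beta>: "b0 * (1 + \<delta> * real k) \<le> \<beta> * \<delta>" "b0 * real k \<le> \<beta>"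
  shows "(\<Sum>c'\<in>{c' \<in> cycles k. meets c c'}. band_weight x c' * cond_prod c c')
    \<le> (real k * (\<delta> * (\<mu> + \<beta>) ^ k + (1 + \<delta> * real k * (\<mu> + \<beta>) ^ k) * (2 * y) * z powr (- real_of_int x))
       + real n * (h * real B * z powr (- real D) / \<gamma> * (\<mu> + \<beta>) ^ k)) / y"
proof -
  note C = cyclesD[OF c]
  have c3: "3 \<le> length c" using C(1) k by simp
  interpret O: overlap n B D h z "shared c" k y \<mu> \<gamma> g "fst ` set c"
  proof
    show "card (fst ` set c) \<le> k" using card_vertices[OF c3 C(2)] C(1) by simp
    show "\<And>u v. shared c (u, v) \<noteq> None \<Longrightarrow> u \<in> fst ` set c \<and> v \<in> fst ` set c"
      using shared_vertices[OF c3 C(2)] .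
    show "\<And>v. finite {w. shared c (v, w) \<noteq> None}" using finite_shared_nbrs[OF c3 C(2)] .
    show "\<And>v. card {w. shared c (v, w) \<noteq> None} \<le> 2" using card_shared_nbrs[OF c3 C(2)] .
    show "\<And>u v. shared c (u, v) \<noteq> None \<Longrightarrow> card {w. shared c (v, w) \<noteq> None \<and> w \<noteq> u} \<le> 1"
      using card_shared_other_nbrs[OF c3 C(2)] .
    show "\<And>v. shared c (v, v) = None" using shared_irrefl[OF c3 C(2)] .
  qed (use par g g_super in auto)
  have b0': "O.\<beta>0 = b0" by (simp add: O.\<beta>0_def b0)
  have aw: "cond_prod c c' = O.arcs_weight (closed_darcs c')" for c'
    by (simp add: cond_prod_def O.arcs_weight_def key_steps_def cond_weight_def O.arc_weight_def
        shared_def o_def case_prod_unfold cong: option.case_cong if_cong)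
  have S: "{c' \<in> cycles k. meets c c'} =
    {l \<in> words letters k. distinct (map fst l) \<and> (\<exists>a\<in>fst ` set (closed_darcs l). shared c a \<noteq> None)}"
    by (auto simp: cycles_def meets_def)
  show ?thesis unfolding aw S
  proof (rule O.overlap_sum_le[OF x k C(4)])
    show "(\<Sum>l\<in>words letters k. path_weight O.walk_weight O.walk_next (O.ends t) (O.start t x) l)
      \<le> \<delta> * (\<mu> + \<beta>) ^ k + (1 + \<delta> * real k * (\<mu> + \<beta>) ^ k) * (2 * y) * z powr (- real_of_int x)"
      if "t \<in> fst ` set c" for t
      using that par \<beta> b0' x by (intro O.closed_sum_on) auto
    show "(\<Sum>l\<in>words letters k. path_weight O.walk_weight O.walk_next (O.ends t) (O.start t x) l)
      \<le> h * real B * z powr (- real D) / \<gamma> * (\<mu> + \<beta>) ^ k"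
      if "t \<notin> fst ` set c" for t
      using that par \<beta> b0' x k by (intro O.closed_sum_off) auto
  qed (use par h in auto)
qed

end

end

section \<open>Growth rates\<close>

context lattice
begin

lemma step_weight_mult:
  "step_weight x i * F = z powr (- real D) * (if in_band B (x + int i - int D) then z ^ i * F else 0)"
  using z by (simp add: step_weight_def move_def tilt_def powr_diff powr_minus powr_realpow field_simps)

lemma sine_lower:
  fixes x :: int
  assumes \<alpha>: "\<alpha> = pi / real B" and D: "2 \<le> D" "D < B" and x: "in_band B x"
    and zeq: "z = sin (\<alpha> * (real D - 1)) / sin (\<alpha> * D)"
  shows "(real n * h * z powr (- real D) * (sin (\<alpha> * (real D - 1)) / sin \<alpha>)) * sin (\<alpha> * x)
    \<le> real n * h * (\<Sum>i=1..B + D. step_weight x i * sin (\<alpha> * move x i))"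
proof -
  have "sin (\<alpha> * (real D - 1)) / sin \<alpha> * sin (\<alpha> * x)
    \<le> (\<Sum>i=1..B + D. if in_band B (x + int i - int D) then z ^ i * sin (\<alpha> * (x + int i - int D)) else 0)"
    using sine_subharmonic[OF \<alpha> D x zeq] .
  hence "real n * h * z powr (- real D) * (sin (\<alpha> * (real D - 1)) / sin \<alpha> * sin (\<alpha> * x))
    \<le> real n * h * z powr (- real D) * (\<Sum>i=1..B + D. if in_band B (x + int i - int D) then z ^ i * sin (\<alpha> * (x + int i - int D)) else 0)"
    using h by (intro mult_left_mono) auto
  also have "\<dots> = real n * h * (\<Sum>i=1..B + D. step_weight x i * sin (\<alpha> * move x i))"
    unfolding step_weight_mult by (simp add: sum_distrib_left move_def mult_ac cong: if_cong)
  finally show ?thesis by (simp only: mult.assoc)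
qed

text \<open>The sine of the wider band is superharmonic for its own tilt \<open>z'\<close>, not for
  \<open>z\<close>. The factor (z'/z)^x is the change of tilt that carries the inequality
  over.\<close>

lemma sine_upper:
  fixes x :: int
  assumes \<alpha>: "\<alpha> = pi / (real B + 2 * a)" and D: "2 \<le> D" "real D \<le> a" and x: "in_band B x"
    and zeq: "z' = sin (\<alpha> * (real D - 1)) / sin (\<alpha> * D)" and z': "0 < z'"
    and g: "\<And>x :: int. g x = (z' / z) powr real_of_int x * sin (\<alpha> * (real_of_int x + a)) / 2"
  shows "real n * h * (\<Sum>i=1..B + D. step_weight x i * g (move x i))
    \<le> (real n * h * z' powr (- real D) * (sin (\<alpha> * (real D - 1)) / sin \<alpha>)) * g x"
proof -
  define T where "T i = (if in_band B (x + int i - int D) then z' ^ i * sin (\<alpha> * (real_of_int x + real i - real D + a)) else 0)" for i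
  have eq: "step_weight x i * g (move x i) = z' powr (- real D) * (z' / z) powr real_of_int x / 2 * T i" for i
  proof -
    have "(z' / z) powr (real_of_int x + real i - real D) = (z' / z) powr real_of_int x * (z' ^ i / z ^ i) * (z powr real D / z' powr real D)"
      using z z' by (simp add: powr_add powr_diff powr_realpow powr_divide power_divide)
    thus ?thesis using z z'
      by (simp add: step_weight_mult T_def g move_def powr_minus field_simps)
  qed
  have "(\<Sum>i=1..B + D. T i) \<le> sin (\<alpha> * (real D - 1)) / sin \<alpha> * sin (\<alpha> * (real_of_int x + a))"
    unfolding T_def using sine_superharmonic[OF \<alpha> D x zeq] .
  hence "(real n * h * (z' powr (- real D) * (z' / z) powr real_of_int x / 2)) * (\<Sum>i=1..B + D. T i)
    \<le> (real n * h * (z' powr (- real D) * (z' / z) powr real_of_int x / 2)) * (sin (\<alpha> * (real D - 1)) / sin \<alpha> * sin (\<alpha> * (real_of_int x + a)))"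
    using h by (intro mult_left_mono) auto
  thus ?thesis unfolding eq sum_distrib_left[symmetric] by (simp add: g mult_ac)
qed

end

text \<open>For t = l/\<pi> one has \<pi>^3 t^3 = D and 1/t = \<alpha> D, so \<open>b = 0\<close>
  gives the tilt of the band and \<open>b = 1\<close> that of the widened band.\<close>

definition rate :: "real \<Rightarrow> real \<Rightarrow> real" where
  "rate b t = sin (1 / (t + b) - 1 / ((t + b) * (pi ^ 3 * t ^ 3))) / sin (1 / (t + b))"

text \<open>The logarithm of the growth rate in the normalisation n h D = 1.\<close>

definition log_growth :: "real \<Rightarrow> real \<Rightarrow> real" where
  "log_growth b t = - (pi ^ 3 * t ^ 3) * ln (rate b t) +
    ln (sin (1 / (t + b) - 1 / ((t + b) * (pi ^ 3 * t ^ 3))) / (pi ^ 3 * t ^ 3 * sin (1 / ((t + b) * (pi ^ 3 * t ^ 3)))))"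

lemma log_growth_0_asymp: "((\<lambda>t. t\<^sup>2 * (log_growth 0 t - 1)) \<longlongrightarrow> - (1 / 2)) at_top"
proof -
  \<comment> \<open>The constant \<pi>^3 is generalised to a positive \<open>C\<close>, so that the
    expansion involves no \<pi>.\<close>
  have "((\<lambda>t::real. t^2*(-(C*t^3) * ln (sin (1/t - 1/(t*(C*t^3))) / sin (1/t)) +
    ln (sin (1/t - 1/(t*(C*t^3))) / (C*t^3 * sin (1/(t*(C*t^3))))) - 1)) \<longlongrightarrow> -(1/2)) at_top" if "C > 0" for C :: real
    using that by real_asymp
  from this[of "pi ^ 3"] show ?thesis by (simp add: log_growth_def rate_def)
qed

lemma log_growth_1_asymp: "((\<lambda>t. t\<^sup>2 * (log_growth 1 t - 1)) \<longlongrightarrow> - (1 / 2)) at_top"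
proof -
  have "((\<lambda>t::real. t^2*(-(C*t^3) * ln (sin (1/(t+1) - 1/((t+1)*(C*t^3))) / sin (1/(t+1))) +
    ln (sin (1/(t+1) - 1/((t+1)*(C*t^3))) / (C*t^3 * sin (1/((t+1)*(C*t^3))))) - 1)) \<longlongrightarrow> -(1/2)) at_top"
    if "C > 0" for C :: real
    using that by real_asymp (simp add: field_simps)
  from this[of "pi ^ 3"] show ?thesis by (simp add: log_growth_def rate_def)
qed

text \<open>The prefactor is \<open>B\<close>, so the change of tilt (z'/z)^x tends to 1 uniformly
  over the band.\<close>

lemma rate_diff_asymp: "((\<lambda>t. pi * t * (pi ^ 3 * t ^ 3) * (ln (rate 1 t) - ln (rate 0 t))) \<longlongrightarrow> 0) at_top"
proof -
  have "((\<lambda>t::real. t*(C*t^3)*(ln (sin (1/(t+1) - 1/((t+1)*(C*t^3))) / sin (1/(t+1))) - ln (sin (1/t - 1/(t*(C*t^3))) / sin (1/t)))) \<longlongrightarrow> 0) at_top"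
    if "C > 0" for C :: real
    using that by real_asymp
  from tendsto_mult_right[OF this[of "pi ^ 3"], of pi] show ?thesis by (simp add: rate_def mult_ac)
qed

text \<open>Here -D ln z = 1 - \<theta>^2/3 + O(1/D) with \<theta> = 1/t approaches 1 from below.
  The exact bound 1 is needed because it is raised to the power \<open>l\<close>, giving z^(-B)
  \<le> exp l.\<close>

lemma rate_power_asymp: "eventually (\<lambda>t. - (pi ^ 3 * t ^ 3) * ln (rate 0 t) \<le> 1) at_top"
proof -
  have "eventually (\<lambda>t::real. -(C*t^3)*(ln (sin (1/t - 1/(t*(C*t^3))) / sin (1/t))) \<le> 1) at_top"
    if "C > 0" for C :: real
    using that by real_asymp
  from this[of "pi ^ 3"] show ?thesis by (simp add: rate_def)
qed

section \<open>Scaling of the parameters\<close>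

lemma sin_ge_sin_edge:
  fixes \<theta> \<theta>0 :: real
  assumes "0 \<le> \<theta>0" "\<theta>0 \<le> \<theta>" "\<theta> \<le> pi - \<theta>0"
  shows "sin \<theta>0 \<le> sin \<theta>"
proof (cases "\<theta> \<le> pi / 2")
  case True
  thus ?thesis using assms by (intro sin_monotone_2pi_le) auto
next
  case False
  have "sin \<theta>0 \<le> sin (pi - \<theta>)" using assms False by (intro sin_monotone_2pi_le) auto
  thus ?thesis by simp
qed

text \<open>What bounds the overlap sum relative to the first moment when y = exp(e l) and \<delta>
  = exp(-e l). The outer denominator is the sine at the starting height, the inner one the lower
  bound of the wider sine on the band.\<close>

definition overlap_bound :: "nat \<Rightarrow> real \<Rightarrow> nat \<Rightarrow> real" where
  "overlap_bound K e l = (let k = real K * real l ^ 3 in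
     (3 * k * exp (- (3 / 2 * e * real l)) + 6 * k * (exp (- (e * real l)) + 3 * k * exp (- (e * real l / 2)))
       + 36 * real l * exp (- (e * real l / 2)) / sin (1 / (real l / pi + 1))) / sin (pi / real l))"

text \<open>A lower bound, by Bernoulli's inequality, for the losses from binning and from
  distinctness of vertices.\<close>

definition loss_factor :: "nat \<Rightarrow> nat \<Rightarrow> real" where
  "loss_factor K l = (let k = real K * real l ^ 3 in (1 - k * ((real l + 1) * exp (- real l))) * (1 - k\<^sup>2 * exp (- real l)))"

text \<open>Here c = n h D, so c/n is the target mean weight, and \<open>p\<close> is the guaranteed
  logarithm of the first-moment growth over \<open>k\<close> steps. By \<open>growth1\<close> the
  superharmonic growth exceeds it by at most exp(e l/2), half the exponent of \<open>y\<close>. The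
  assumption on \<open>n\<close> leaves exp(-4 e l), up to a factor \<open>l\<close>, after a
  re-entry gain of at most exp l.\<close>

locale scaled_cycle_model = cycle_model n B D h z key M E W
  for n B D :: nat and h z :: real and key :: "nat \<times> nat \<Rightarrow> 'e"
    and M :: "'a measure" and E :: "'e set" and W +
  fixes l K k :: nat and c t e p :: real
  assumes l: "3 \<le> l" and K: "1 \<le> K" and D: "D = l ^ 3" and B: "B = l ^ 4" and k: "k = K * l ^ 3"
    and t: "t = real l / pi"
    and hc: "h = c / (real n * real l ^ 3)" and c: "0 < c" "c \<le> 1" and zr: "z = rate 0 t"
    and e: "0 < e" "e \<le> 1 / 4"
    and n: "exp ((1 + 4 * e) * real l) \<le> real n"
    and z_power: "- (real l ^ 3) * ln (rate 0 t) \<le> 1"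
    and z_diff: "\<bar>real l ^ 4 * (ln (rate 1 t) - ln (rate 0 t))\<bar> \<le> ln 2"
    and growth0: "p \<le> real k * (ln c + log_growth 0 t)"
    and growth1: "0 \<le> ln c + log_growth 1 t" "real k * (ln c + log_growth 1 t) \<le> p + e * real l / 2"
    and p: "e * real l \<le> p"
    and delta_small: "exp (- (e * real l)) * real k \<le> 1"
    and beta_small: "16 * real k ^ 2 * real l * exp (- (2 * e * real l)) / sin (1 / (t + 1)) \<le> 1"
    and loss: "real k * ((real l + 1) * exp (- real l)) < 1" "real k ^ 2 * exp (- real l) < 1"
begin

lemma t_pos: "0 < t"
  using l t by simp

lemma l_pos: "0 < real l"
  using l by simp

lemma n_ge: "exp (real l) \<le> real n" "0 < real n"
proof -
  have "exp (real l) \<le> exp ((1 + 4 * e) * real l)" using e l_pos by (simp add: algebra_simps)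
  thus "exp (real l) \<le> real n" using n by linarith
  thus "0 < real n" using exp_gt_zero[of "real l"] by linarith
qed

lemma pit: "pi ^ 3 * t ^ 3 = real l ^ 3"
  by (simp add: t power_divide)

text \<open>
  The wider band of the superharmonic function is longer by \<open>\<pi> D\<close>, which replaces \<open>t\<close> by \<open>t + 1\<close>
  and so keeps \<open>\<pi>\<close> out of the asymptotic expansions.
\<close>

definition \<alpha> :: real where "\<alpha> = pi / real B"
definition a :: real where "a = pi * real D / 2"
definition \<alpha>' :: real where "\<alpha>' = pi / (real B + 2 * a)"
definition z' :: real where "z' = rate 1 t"

lemma angles:
  "\<alpha> * real D = 1 / t" "\<alpha> * (real D - 1) = 1 / t - 1 / (t * real l ^ 3)" "\<alpha> = 1 / (t * real l ^ 3)"
proof -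
  have 1: "\<alpha> = 1 / (t * real l ^ 3)" unfolding \<alpha>_def unfolding B t by (simp add: eval_nat_numeral)
  show "\<alpha> = 1 / (t * real l ^ 3)" by fact
  show "\<alpha> * real D = 1 / t" unfolding 1 unfolding D using l_pos by simp
  thus "\<alpha> * (real D - 1) = 1 / t - 1 / (t * real l ^ 3)"
    unfolding right_diff_distrib mult_1_right using 1 by linarith
qed

lemma angles':
  "\<alpha>' * real D = 1 / (t + 1)" "\<alpha>' * (real D - 1) = 1 / (t + 1) - 1 / ((t + 1) * real l ^ 3)"
  "\<alpha>' = 1 / ((t + 1) * real l ^ 3)"
proof -
  have "real B + 2 * a = pi * ((t + 1) * real l ^ 3)"
    unfolding a_def unfolding B D t by (simp add: eval_nat_numeral algebra_simps)
  hence 1: "\<alpha>' = 1 / ((t + 1) * real l ^ 3)" by (simp add: \<alpha>'_def)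
  show "\<alpha>' = 1 / ((t + 1) * real l ^ 3)" by fact
  show "\<alpha>' * real D = 1 / (t + 1)" unfolding 1 unfolding D using l_pos t_pos by simp
  thus "\<alpha>' * (real D - 1) = 1 / (t + 1) - 1 / ((t + 1) * real l ^ 3)"
    unfolding right_diff_distrib mult_1_right using 1 by linarith
qed

lemma D_ge: "2 \<le> D" "D < B" "real D \<le> a"
proof -
  have "2 ^ 1 \<le> l ^ 3" using l by (intro order_trans[OF power_mono[of 2 l 1] power_increasing]) auto
  thus "2 \<le> D" by (simp add: D)
  show "D < B" using l by (simp add: D B)
  show "real D \<le> a" using mult_right_mono[OF pi_ge_two, of "real D"] by (simp add: a_def mult.commute)
qed

lemma zeq: "z = sin (\<alpha> * (real D - 1)) / sin (\<alpha> * D)"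
  by (simp add: zr rate_def pit angles(1,2))

lemma zeq': "z' = sin (\<alpha>' * (real D - 1)) / sin (\<alpha>' * D)"
  by (simp add: z'_def rate_def pit angles'(1,2))

lemma sines_pos: "0 < sin \<alpha>" "0 < sin (\<alpha> * real D)" "0 < sin (\<alpha> * (real D - 1))"
  "0 < sin \<alpha>'" "0 < sin (\<alpha>' * real D)" "0 < sin (\<alpha>' * (real D - 1))"
proof -
  have *: "0 < sin (\<alpha> * u)" if "0 < u" "u < real B" for u
    using that by (intro sin_gt_zero) (auto simp: \<alpha>_def pos_divide_less_eq)
  have **: "0 < sin (\<alpha>' * u)" if "0 < u" "u < real B" for u
    using that D_ge by (intro sin_gt_zero) (auto simp: \<alpha>'_def pos_divide_less_eq)
  have D: "1 < real D" "real D < real B" using D_ge by auto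
  show "0 < sin \<alpha>" "0 < sin (\<alpha> * real D)" "0 < sin (\<alpha> * (real D - 1))"
    using *[of 1] *[of D] *[of "D - 1"] D by auto
  show "0 < sin \<alpha>'" "0 < sin (\<alpha>' * real D)" "0 < sin (\<alpha>' * (real D - 1))"
    using **[of 1] **[of D] **[of "D - 1"] D by auto
qed

lemma z'_pos: "0 < z'"
  using zeq' sines_pos by simp

definition \<mu>0 :: real where
  "\<mu>0 = real n * h * z powr (- real D) * (sin (\<alpha> * (real D - 1)) / sin \<alpha>)"
definition \<mu> :: real where
  "\<mu> = real n * h * z' powr (- real D) * (sin (\<alpha>' * (real D - 1)) / sin \<alpha>')"

lemma nh: "real n * h = c / real l ^ 3"
  using n_ge by (simp add: hc)

lemma \<mu>0_eq: "\<mu>0 = exp (ln c + log_growth 0 t)"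
proof -
  have "log_growth 0 t = - real D * ln z + ln (sin (\<alpha> * (real D - 1)) / (real l ^ 3 * sin \<alpha>))"
    unfolding log_growth_def zr[symmetric] pit unfolding angles(2) unfolding angles(3) unfolding D by simp
  hence "exp (log_growth 0 t) = z powr (- real D) * (sin (\<alpha> * (real D - 1)) / (real l ^ 3 * sin \<alpha>))"
  proof -
    have "0 < sin (\<alpha> * (real D - 1)) / (real l ^ 3 * sin \<alpha>)" using sines_pos l_pos by simp
    thus ?thesis unfolding \<open>log_growth 0 t = _\<close> exp_add using z by (simp only: exp_ln powr_def) simp
  qed
  thus ?thesis using c by (simp add: \<mu>0_def nh exp_add)
qed

lemma \<mu>_eq: "\<mu> = exp (ln c + log_growth 1 t)"
proof -
  have "log_growth 1 t = - real D * ln z' + ln (sin (\<alpha>' * (real D - 1)) / (real l ^ 3 * sin \<alpha>'))"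
    unfolding log_growth_def z'_def[symmetric] pit unfolding angles'(2) unfolding angles'(3) unfolding D by simp
  hence "exp (log_growth 1 t) = z' powr (- real D) * (sin (\<alpha>' * (real D - 1)) / (real l ^ 3 * sin \<alpha>'))"
  proof -
    have "0 < sin (\<alpha>' * (real D - 1)) / (real l ^ 3 * sin \<alpha>')" using sines_pos l_pos by simp
    thus ?thesis unfolding \<open>log_growth 1 t = _\<close> exp_add using z'_pos by (simp only: exp_ln powr_def) simp
  qed
  thus ?thesis using c by (simp add: \<mu>_def nh exp_add)
qed

lemma \<mu>0_power: "exp p \<le> \<mu>0 ^ k"
  using growth0 unfolding \<mu>0_eq exp_of_nat_mult[symmetric] by simp

lemma \<mu>_power: "\<mu> ^ k \<le> exp p * exp (e * real l / 2)"
  using growth1(2) unfolding \<mu>_eq exp_of_nat_mult[symmetric] exp_add[symmetric] by simp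

lemma \<mu>_ge_1: "1 \<le> \<mu>"
  using growth1(1) by (simp add: \<mu>_eq)

definition s :: real where "s = sin (1 / (t + 1))"

lemma s_pos: "0 < s"
  using sines_pos(5) by (simp add: s_def angles'(1))

definition g :: "int \<Rightarrow> real" where
  "g x = (z' / z) powr real_of_int x * sin (\<alpha>' * (real_of_int x + a)) / 2"

text \<open>The change of tilt lies between 1/2 and 2. Since \<open>a \<ge> D\<close>, band heights
  lie at least \<open>D\<close> inside the widened interval, where the sine is at least
  \<open>s\<close>. The final division by 2 in \<open>g\<close> keeps it below 1.\<close>

lemma g_bounds:
  assumes "in_band B x"
  shows "s / 4 \<le> g x" "g x \<le> 1"
proof -
  have x: "0 \<le> real_of_int x" "real_of_int x \<le> real B" using assms by (auto simp: in_band_def)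
  have "real_of_int x * \<bar>ln z' - ln z\<bar> \<le> real B * \<bar>ln z' - ln z\<bar>" using x by (intro mult_right_mono) auto
  also have "\<dots> \<le> ln 2" using z_diff by (simp add: B zr z'_def abs_mult)
  finally have A: "\<bar>real_of_int x * (ln z' - ln z)\<bar> \<le> ln 2" using x by (simp add: abs_mult)
  have ratio: "(z' / z) powr real_of_int x = exp (real_of_int x * (ln z' - ln z))"
    using z z'_pos by (simp add: powr_def ln_div)
  have "exp (- ln 2) \<le> exp q \<and> exp q \<le> exp (ln 2)" if "\<bar>q\<bar> \<le> ln 2" for q :: real
    unfolding exp_le_cancel_iff using that by (simp add: abs_le_iff)
  note r = this[OF A, folded ratio]
  have r': "1 / 2 \<le> (z' / z) powr real_of_int x" "(z' / z) powr real_of_int x \<le> 2"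
    using r by (simp_all add: exp_minus inverse_eq_divide)
  have ap: "0 < \<alpha>'" using t_pos l_pos by (simp add: angles'(3))
  have tot: "\<alpha>' * (real B + 2 * a) = pi"
  proof -
    have "0 < real B + 2 * a" using D_ge by linarith
    thus ?thesis by (simp add: \<alpha>'_def)
  qed
  have "sin (\<alpha>' * real D) \<le> sin (\<alpha>' * (real_of_int x + a))"
  proof (rule sin_ge_sin_edge)
    show "0 \<le> \<alpha>' * real D" using ap by simp
    show "\<alpha>' * real D \<le> \<alpha>' * (real_of_int x + a)" using ap x D_ge by (intro mult_left_mono) auto
    have "\<alpha>' * (real_of_int x + a) \<le> \<alpha>' * (real B + 2 * a - real D)" using ap x D_ge by (intro mult_left_mono) auto
    thus "\<alpha>' * (real_of_int x + a) \<le> pi - \<alpha>' * real D" using tot by (simp add: right_diff_distrib)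
  qed
  hence sn: "s \<le> sin (\<alpha>' * (real_of_int x + a))" by (simp add: s_def angles'(1))
  have "1 / 2 * s \<le> (z' / z) powr real_of_int x * sin (\<alpha>' * (real_of_int x + a))"
    using r' sn s_pos by (intro mult_mono) auto
  thus "s / 4 \<le> g x" by (simp add: g_def)
  have "(z' / z) powr real_of_int x * sin (\<alpha>' * (real_of_int x + a)) \<le> 2 * 1"
    using r' sn s_pos by (intro mult_mono) auto
  thus "g x \<le> 1" by (simp add: g_def)
qed

text \<open>At this height the subharmonic sine is sin(\<pi>/l), only polynomially small, and the
  starting cost z^(-D) is at most 3.\<close>

definition x0 :: int where "x0 = int D"

lemma x0_band: "in_band B x0"
  using D_ge by (simp add: in_band_def x0_def)

lemma z_powr_D: "z powr (- real D) \<le> 3"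
proof -
  have "z powr (- real D) = exp (- (real l ^ 3) * ln z)" using z by (simp add: powr_def D)
  also have "\<dots> \<le> exp 1" using z_power by (simp add: zr)
  finally show ?thesis using exp_le by linarith
qed

lemma z_powr_B: "z powr (- real B) \<le> exp (real l)"
proof -
  have "real l * (- (real l ^ 3) * ln z) \<le> real l * 1" using z_power l_pos by (intro mult_left_mono) (auto simp: zr)
  hence "- real B * ln z \<le> real l" by (simp add: B eval_nat_numeral)
  moreover have "z powr (- real B) = exp (- real B * ln z)" using z by (simp add: powr_def)
  ultimately show ?thesis by simp
qed

lemma hB: "h * real B = c * real l / real n"
  using l_pos by (simp add: hc B eval_nat_numeral)

lemma hBD: "h * real (B + D) = c * ((real l + 1) / real n)"
proof -
  have "real (B + D) = real l ^ 3 * (real l + 1)" by (simp add: B D eval_nat_numeral algebra_simps)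
  thus ?thesis using l_pos by (simp add: hc)
qed

text \<open>Large enough to outweigh the gap exp(e l/2) between the two growth bounds, small enough
  that its square is absorbed by the exp(-4 e l) left by a re-entry.\<close>

definition y :: real where "y = exp (e * real l)"
definition \<delta> :: real where "\<delta> = exp (- (e * real l))"
definition b0 :: real where "b0 = 2 * y * real k * h * real B * z powr (- real B) / (s / 4)"
text \<open>Solves \<open>b0 * (1 + \<delta> * k) \<le> \<beta> * \<delta>\<close>: the factor 2
  bounds 1 + \<delta> k, and \<open>y\<close> is the inverse of \<delta>.\<close>

definition \<beta> :: real where "\<beta> = 2 * b0 * y"

lemma b0_nonneg: "0 \<le> b0"
  using h s_pos by (simp add: b0_def y_def)

text \<open>A re-entry gains at most exp l and costs h B \<le> l exp(-(1 + 4 e) l). With y^2 = exp(2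
  e l) there remains exp(-2 e l) times powers of \<open>k\<close> and \<open>l\<close> and 1/s, so
  re-entries inflate the \<open>k\<close>-step growth by at most exp 1.\<close>

lemma k_beta: "real k * \<beta> \<le> 1"
proof -
  have hB_le: "h * real B \<le> real l * exp (- ((1 + 4 * e) * real l))"
  proof -
    have "c * real l / real n \<le> 1 * real l / exp ((1 + 4 * e) * real l)"
      using c n l_pos n_ge by (intro frac_le mult_right_mono) auto
    thus ?thesis by (simp only: hB exp_minus divide_inverse mult_1)
  qed
  have "h * real B * z powr (- real B) \<le> real l * exp (- ((1 + 4 * e) * real l)) * exp (real l)"
    by (rule mult_mono[OF hB_le z_powr_B]) simp_all
  also have "\<dots> = real l * exp (- (4 * e * real l))" by (simp add: mult.assoc exp_add[symmetric] algebra_simps)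
  finally have c1: "(16 * real k ^ 2 * y\<^sup>2 / s) * (h * real B * z powr (- real B)) \<le> (16 * real k ^ 2 * y\<^sup>2 / s) * (real l * exp (- (4 * e * real l)))"
    using s_pos by (intro mult_left_mono) auto
  have yy: "y\<^sup>2 * exp (- (4 * e * real l)) = exp (- (2 * e * real l))"
    unfolding y_def power2_eq_square exp_add[symmetric] by (simp add: algebra_simps)
  have "(16 * real k ^ 2 * y\<^sup>2 / s) * (real l * exp (- (4 * e * real l))) =
      16 * real k ^ 2 * real l * (y\<^sup>2 * exp (- (4 * e * real l))) / s"
    by (simp only: times_divide_eq_left times_divide_eq_right ac_simps)
  hence c2: "(16 * real k ^ 2 * y\<^sup>2 / s) * (real l * exp (- (4 * e * real l))) = 16 * real k ^ 2 * real l * exp (- (2 * e * real l)) / s"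
    unfolding yy .
  have c3: "real k * \<beta> = (16 * real k ^ 2 * y\<^sup>2 / s) * (h * real B * z powr (- real B))"
    by (simp add: \<beta>_def b0_def power2_eq_square)
  show ?thesis unfolding c3 using c1[unfolded c2] beta_small[folded s_def] by linarith
qed

lemma \<nu>_power: "(\<mu> + \<beta>) ^ k \<le> 3 * (exp p * exp (e * real l / 2))"
proof -
  have \<beta>0: "0 \<le> \<beta>" using b0_nonneg by (simp add: \<beta>_def y_def)
  have "(\<mu> + \<beta>) ^ k \<le> (\<mu> * (1 + \<beta>)) ^ k"
    using \<mu>_ge_1 \<beta>0 by (intro power_mono) (auto simp: distrib_left mult_le_cancel_right1)
  also have "\<dots> = (1 + \<beta>) ^ k * \<mu> ^ k" by (simp add: power_mult_distrib)
  also have "\<dots> \<le> exp \<beta> ^ k * \<mu> ^ k"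
    using \<beta>0 \<mu>_ge_1 by (intro mult_right_mono power_mono) auto
  also have "exp \<beta> ^ k = exp (real k * \<beta>)" by (simp add: exp_of_nat_mult)
  also have "\<dots> * \<mu> ^ k \<le> 3 * (exp p * exp (e * real l / 2))"
  proof (rule mult_mono)
    have "exp (real k * \<beta>) \<le> exp 1" using k_beta by simp
    thus "exp (real k * \<beta>) \<le> 3" using exp_le by linarith
  qed (use \<mu>_power \<mu>_ge_1 in auto)
  finally show ?thesis .
qed

lemma k_ge_3: "3 \<le> k"
proof -
  have "3 \<le> l ^ 1" using l by simp
  also have "\<dots> \<le> l ^ 3" using l by (intro power_increasing) auto
  also have "\<dots> \<le> K * l ^ 3" using K by simp
  finally show ?thesis by (simp add: k)
qed

lemma k_less_n: "k < n"
proof -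
  have "real k ^ 2 * exp (- real l) < 1" by (rule loss(2))
  hence "real k ^ 2 < exp (real l)" by (simp add: exp_minus field_simps)
  moreover have "real k * 1 \<le> real k ^ 2" using k_ge_3 unfolding power2_eq_square by (intro mult_left_mono) auto
  ultimately have "real k < real n" using n_ge by linarith
  thus ?thesis by simp
qed

lemma prob_good_cycle:
  "2 - (1 + overlap_bound K e l) / (loss_factor K l)\<^sup>2
    \<le> prob (\<Union>c\<in>{c \<in> cycles k. 0 < band_weight x0 c}. bins (key_steps c))"
proof -
  define Y where "Y = h ^ k * (\<Sum>l\<in>words letters k. band_weight x0 l)"
  define f0 where "f0 = sin (pi / real l)"
  define Q where "Q = (\<mu> + \<beta>) ^ k"
  define Mx where "Mx = (real k * (\<delta> * Q + (1 + \<delta> * real k * Q) * (2 * y) * z powr (- real_of_int x0))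
       + real n * (h * real B * z powr (- real D) / (s / 4) * Q)) / y"
  have f0_eq: "f0 = sin (\<alpha> * x0)" by (simp add: x0_def angles(1) f0_def t)
  have f0: "0 < f0" using sines_pos(2) by (simp add: f0_eq x0_def)
  have "\<mu>0 ^ k * sin (\<alpha> * x0) \<le> Y" unfolding Y_def
  proof (rule band_sum_ge)
    show "\<mu>0 * sin (\<alpha> * x) \<le> real n * h * (\<Sum>i=1..B + D. step_weight x i * sin (\<alpha> * move x i))" if "in_band B x" for x
      unfolding \<mu>0_def using sine_lower[OF \<alpha>_def D_ge(1,2) that zeq] .
  qed (use x0_band in \<open>auto simp: \<mu>0_eq\<close>)
  moreover have "exp p * f0 \<le> \<mu>0 ^ k * f0" using \<mu>0_power f0 by (intro mult_right_mono) auto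
  ultimately have Y: "exp p * f0 \<le> Y" by (simp add: f0_eq)
  hence Y0: "0 < Y" using f0 mult_pos_pos[of "exp p" f0] by (meson exp_gt_zero less_le_trans)
  have \<delta>y: "\<delta> * y = 1" by (simp add: \<delta>_def y_def exp_add[symmetric])
  have \<delta>k: "\<delta> * real k \<le> 1" using delta_small by (simp add: \<delta>_def)
  have Q0: "0 \<le> Q" using \<mu>_ge_1 b0_nonneg by (auto simp: Q_def \<beta>_def y_def)
  have "2 - (1 + Mx / Y) / ((1 - h * real (B + D)) ^ k * (1 - real k / real n) ^ k)\<^sup>2
      \<le> prob (\<Union>c\<in>{c \<in> cycles k. 0 < band_weight x0 c}. bins (key_steps c))"
  proof (rule prob_cycle_exists_ge[OF k_ge_3 k_less_n _ Y_def Y0 _ refl])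
    have "h * real (B + D) = c * ((real l + 1) / real n)"
      by (rule hBD)
    also have "\<dots> \<le> 1 * ((real l + 1) / exp (real l))"
      using c n_ge l_pos by (intro mult_mono frac_le) auto
    also have "\<dots> = 1 * ((real l + 1) * exp (- real l))" by (simp add: exp_minus field_simps)
    also have "\<dots> \<le> real k * ((real l + 1) * exp (- real l))" using k_ge_3 by (intro mult_right_mono) auto
    finally show "h * real (B + D) < 1" using loss(1) by linarith
    show "(\<Sum>c'\<in>{c' \<in> cycles k. meets c c'}. band_weight x0 c' * cond_prod c c') \<le> Mx" if "c \<in> cycles k" for c
      unfolding Mx_def Q_def
    proof (rule meets_sum_le[OF k_ge_3 that x0_band _ _ \<mu>_ge_1 _ _ g_bounds _ b0_def])
      show "real n * h * (\<Sum>i=1..B + D. step_weight x i * g (move x i)) \<le> \<mu> * g x" if "in_band B x" for x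
        unfolding \<mu>_def using sine_upper[OF \<alpha>'_def D_ge(1,3) that zeq' z'_pos g_def] .
      have "b0 * (1 + \<delta> * real k) \<le> b0 * 2" using \<delta>k b0_nonneg by (intro mult_left_mono) auto
      also have "\<dots> = \<beta> * \<delta>" using \<delta>y by (simp add: \<beta>_def mult_ac)
      finally show "b0 * (1 + \<delta> * real k) \<le> \<beta> * \<delta>" .
      have "real k = (\<delta> * real k) * y" using \<delta>y by (simp add: mult_ac)
      also have "\<dots> \<le> 1 * y" using \<delta>k by (intro mult_right_mono) (auto simp: y_def)
      finally have "b0 * real k \<le> b0 * (2 * y)" using b0_nonneg by (intro mult_left_mono) (auto simp: y_def)
      thus "b0 * real k \<le> \<beta>" by (simp add: \<beta>_def mult_ac)
    qed (use e l_pos s_pos b0_nonneg in \<open>auto simp: y_def \<delta>_def \<beta>_def\<close>)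
  qed
  moreover have "2 - (1 + overlap_bound K e l) / (loss_factor K l)\<^sup>2 \<le>
      2 - (1 + Mx / Y) / ((1 - h * real (B + D)) ^ k * (1 - real k / real n) ^ k)\<^sup>2"
  proof -
    define P where "P = exp p"
    define r where "r = exp (e * real l / 2)"
    have P: "0 < P" and r: "0 < r" by (simp_all add: P_def r_def)
    have QP: "Q \<le> 3 * P * r" using \<nu>_power by (simp add: Q_def P_def r_def)
    \<comment> \<open>Meant for the summand 1 of the \<open>A\<close> term, which does not grow with
      \<open>Q\<close>. It is negligible only because the first-moment growth \<open>exp p\<close>
      is large.\<close>
    have PP: "1 / P \<le> \<delta>" using p by (simp add: P_def \<delta>_def exp_minus inverse_eq_divide frac_le)
    have zx: "z powr (- real_of_int x0) \<le> 3" using z_powr_D by (simp add: x0_def)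
    have nhB: "real n * (h * real B * z powr (- real D) / (s / 4) * Q) \<le> 36 * real l / s * P * r"
    proof -
      have "real n * (h * real B * z powr (- real D) / (s / 4) * Q) = (real n * (h * real B)) * (z powr (- real D) * (4 / s * Q))"
        by simp
      also have "\<dots> = (c * real l) * (z powr (- real D) * (4 / s * Q))" using n_ge by (simp add: hB)
      also have "\<dots> \<le> (1 * real l) * (3 * (4 / s * (3 * P * r)))"
        using c z_powr_D QP Q0 s_pos l_pos by (intro mult_mono mult_nonneg_nonneg) auto
      finally show ?thesis by (simp add: mult_ac)
    qed
    have y0: "0 < y" "0 < \<delta>" by (simp_all add: y_def \<delta>_def)
    have "real k * (\<delta> * Q + (1 + \<delta> * real k * Q) * (2 * y) * z powr (- real_of_int x0))
      \<le> real k * (\<delta> * (3 * P * r) + (1 + \<delta> * real k * (3 * P * r)) * (2 * y) * 3)"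
      using QP Q0 y0 zx by (intro mult_left_mono add_mono mult_mono) auto
    hence "Mx \<le> (real k * (\<delta> * (3 * P * r) + (1 + \<delta> * real k * (3 * P * r)) * (2 * y) * 3) + 36 * real l / s * P * r) / y"
      unfolding Mx_def using nhB y0 by (intro divide_right_mono add_mono) auto
    also have "\<dots> = P * (3 * real k * (\<delta> * r / y) + 6 * real k * (1 / P + 3 * real k * (\<delta> * r)) + 36 * real l * (r / y) / s)"
      using P y0 s_pos by (simp add: field_simps)
    also have "\<dots> \<le> P * (3 * real k * (\<delta> * r / y) + 6 * real k * (\<delta> + 3 * real k * (\<delta> * r)) + 36 * real l * (r / y) / s)"
      using PP P by (intro mult_left_mono add_mono order_refl) auto
    also have "\<delta> * r / y = exp (- (3 / 2 * e * real l))"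
      unfolding \<delta>_def r_def y_def exp_add[symmetric] exp_diff[symmetric] by (simp add: algebra_simps)
    also have "\<delta> * r = exp (- (e * real l / 2))"
      unfolding \<delta>_def r_def exp_add[symmetric] by (simp add: algebra_simps)
    also have "r / y = exp (- (e * real l / 2))"
      unfolding y_def r_def exp_diff[symmetric] by (simp add: algebra_simps)
    finally have "Mx \<le> P * (overlap_bound K e l * f0)"
      using f0 unfolding overlap_bound_def Let_def f0_def[symmetric] t[symmetric] s_def[symmetric]
      by (simp add: k \<delta>_def)
    also have "\<dots> = overlap_bound K e l * (exp p * f0)" by (simp add: P_def)
    finally have Mx1: "Mx \<le> overlap_bound K e l * (exp p * f0)" .
    have ob0: "0 \<le> overlap_bound K e l"
      unfolding overlap_bound_def Let_def f0_def[symmetric] t[symmetric] s_def[symmetric]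
      using f0 s_pos by (intro divide_nonneg_pos add_nonneg_nonneg mult_nonneg_nonneg) auto
    have "Mx \<le> overlap_bound K e l * Y" using Mx1 mult_left_mono[OF Y ob0] by linarith
    hence MY: "Mx / Y \<le> overlap_bound K e l" using Y0 by (simp add: divide_le_eq)
    have lf: "0 < loss_factor K l" "loss_factor K l \<le> (1 - h * real (B + D)) ^ k * (1 - real k / real n) ^ k"
    proof -
      have kk: "real K * real l ^ 3 = real k" by (simp add: k)
      have hb: "h * real (B + D) \<le> (real l + 1) * exp (- real l)"
      proof -
        have "h * real (B + D) = c * ((real l + 1) / real n)"
          by (rule hBD)
        also have "\<dots> \<le> 1 * ((real l + 1) / exp (real l))"
          using c n_ge l_pos by (intro mult_mono frac_le) auto
        finally show ?thesis by (simp add: exp_minus field_simps)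
      qed
      have kn: "real k / real n \<le> real k * exp (- real l)"
      proof -
        have "real k / real n \<le> real k / exp (real l)" using n_ge by (intro divide_left_mono) auto
        thus ?thesis by (simp add: exp_minus field_simps)
      qed
      have hb1: "h * real (B + D) \<le> 1"
      proof -
        have "1 * ((real l + 1) * exp (- real l)) \<le> real k * ((real l + 1) * exp (- real l))"
          using k_ge_3 by (intro mult_right_mono) auto
        thus ?thesis using hb loss(1) by linarith
      qed
      have kn1: "real k / real n \<le> 1" using k_less_n by simp
      have b1: "1 - real k * ((real l + 1) * exp (- real l)) \<le> (1 - h * real (B + D)) ^ k"
      proof -
        have "1 - real k * ((real l + 1) * exp (- real l)) \<le> 1 + real k * (- (h * real (B + D)))"
          using mult_left_mono[OF hb, of "real k"] by simp
        also have "\<dots> \<le> (1 + - (h * real (B + D))) ^ k" using hb1 by (intro Bernoulli_inequality) auto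
        finally show ?thesis by simp
      qed
      have b2: "1 - (real k)\<^sup>2 * exp (- real l) \<le> (1 - real k / real n) ^ k"
      proof -
        have "1 - (real k)\<^sup>2 * exp (- real l) \<le> 1 + real k * (- (real k / real n))"
          using mult_left_mono[OF kn, of "real k"] by (simp add: power2_eq_square)
        also have "\<dots> \<le> (1 + - (real k / real n)) ^ k" using kn1 by (intro Bernoulli_inequality) auto
        finally show ?thesis by simp
      qed
      show "0 < loss_factor K l" unfolding loss_factor_def Let_def kk using loss by (intro mult_pos_pos) auto
      show "loss_factor K l \<le> (1 - h * real (B + D)) ^ k * (1 - real k / real n) ^ k"
        unfolding loss_factor_def Let_def kk using loss b1 b2 hb1 by (intro mult_mono) auto
    qed
    have "(1 + Mx / Y) / ((1 - h * real (B + D)) ^ k * (1 - real k / real n) ^ k)\<^sup>2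
      \<le> (1 + overlap_bound K e l) / (loss_factor K l)\<^sup>2"
      using MY lf ob0 by (intro frac_le power_mono zero_less_power) auto
    thus ?thesis by simp
  qed
  ultimately show ?thesis by linarith
qed

end

section \<open>Asymptotics\<close>

lemma overlap_bound_tendsto:
  assumes "0 < e" "0 < K"
  shows "overlap_bound K e \<longlonglongrightarrow> 0"
proof -
  have "((\<lambda>l::real. (3 * (c * l ^ 3) * exp (- (3 / 2 * e * l)) + 6 * (c * l ^ 3) * (exp (- (e * l)) + 3 * (c * l ^ 3) * exp (- (e * l / 2)))
       + 36 * l * exp (- (e * l / 2)) / sin (1 / (l / pi + 1))) / sin (pi / l)) \<longlongrightarrow> 0) at_top" if "0 < c" for c
    using assms(1) that by real_asymp
  from filterlim_compose[OF this[of "real K"] filterlim_real_sequentially] assms(2)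
  show ?thesis by (simp add: overlap_bound_def[abs_def] Let_def)
qed

lemma loss_factor_tendsto:
  assumes "0 < K"
  shows "loss_factor K \<longlonglongrightarrow> 1"
proof -
  have "((\<lambda>l::real. c * l ^ 3 * ((l + 1) * exp (- l))) \<longlongrightarrow> 0) at_top" for c by real_asymp
  hence 1: "((\<lambda>l::real. 1 - c * l ^ 3 * ((l + 1) * exp (- l))) \<longlongrightarrow> 1 - 0) at_top" for c by (intro tendsto_intros)
  have "((\<lambda>l::real. (c * l ^ 3)\<^sup>2 * exp (- l)) \<longlongrightarrow> 0) at_top" if "0 < c" for c
    using that by real_asymp
  hence 2: "((\<lambda>l::real. 1 - (c * l ^ 3)\<^sup>2 * exp (- l)) \<longlongrightarrow> 1 - 0) at_top" if "0 < c" for c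
    using that by (intro tendsto_intros)
  from filterlim_compose[OF tendsto_mult[OF 1[of "real K"] 2[of "real K"]] filterlim_real_sequentially] assms
  show ?thesis by (simp add: loss_factor_def[abs_def] Let_def)
qed

lemma scaled_at_top: "filterlim (\<lambda>l. real l / pi) at_top sequentially"
  by (rule filterlim_compose[OF _ filterlim_real_sequentially]) real_asymp

text \<open>After the substitution t = l/\<pi> the limit -1/2 becomes -\<pi>^2/2 and cancels the
  correction to the mean weight, leaving only the excess \<open>e\<close> in units of 1/l^2.\<close>

lemma growth_tendsto:
  assumes "((\<lambda>t. t\<^sup>2 * (G t - 1)) \<longlongrightarrow> - (1 / 2)) at_top"
  shows "(\<lambda>l. (real l)\<^sup>2 * (- 1 + (pi\<^sup>2 / 2 + e) / (real l)\<^sup>2 + G (real l / pi))) \<longlonglongrightarrow> e"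
proof -
  have "(\<lambda>l. pi\<^sup>2 / 2 + e + pi\<^sup>2 * ((real l / pi)\<^sup>2 * (G (real l / pi) - 1))) \<longlonglongrightarrow> pi\<^sup>2 / 2 + e + pi\<^sup>2 * (- (1 / 2))"
    by (intro tendsto_intros filterlim_compose[OF assms scaled_at_top])
  hence "(\<lambda>l. pi\<^sup>2 / 2 + e + (real l)\<^sup>2 * (G (real l / pi) - 1)) \<longlonglongrightarrow> e"
    by (simp add: power_divide)
  thus ?thesis
  proof (rule Lim_transform_eventually)
    show "\<forall>\<^sub>F l in sequentially. pi\<^sup>2 / 2 + e + (real l)\<^sup>2 * (G (real l / pi) - 1) =
        (real l)\<^sup>2 * (- 1 + (pi\<^sup>2 / 2 + e) / (real l)\<^sup>2 + G (real l / pi))"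
      using eventually_gt_at_top[of 0] by eventually_elim (simp add: field_simps)
  qed
qed

text \<open>The value taken by \<open>c\<close>. Its excess \<open>4 * e\<close> over the critical
  \<pi>^2/2 yields a growth exponent of about 4 e K l over K l^3 steps.\<close>

definition mean_scale :: "real \<Rightarrow> nat \<Rightarrow> real" where
  "mean_scale e l = exp (- 1 + (pi\<^sup>2 / 2 + 4 * e) / (real l)\<^sup>2)"

lemma eventually_params:
  fixes e :: real and K :: nat
  assumes e: "0 < e" "e \<le> 1 / 4" and K: "1 \<le> 4 * e * real K"
  defines "p \<equiv> \<lambda>l. real K * real l * (4 * e - e / (4 * real K))"
  shows "\<forall>\<^sub>F l in sequentially. 3 \<le> l \<and> mean_scale e l \<le> 1
    \<and> - (real l ^ 3) * ln (rate 0 (real l / pi)) \<le> 1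
    \<and> \<bar>real l ^ 4 * (ln (rate 1 (real l / pi)) - ln (rate 0 (real l / pi)))\<bar> \<le> ln 2
    \<and> p l \<le> real (K * l ^ 3) * (ln (mean_scale e l) + log_growth 0 (real l / pi))
    \<and> 0 \<le> ln (mean_scale e l) + log_growth 1 (real l / pi)
    \<and> real (K * l ^ 3) * (ln (mean_scale e l) + log_growth 1 (real l / pi)) \<le> p l + e * real l / 2
    \<and> e * real l \<le> p l
    \<and> exp (- (e * real l)) * real (K * l ^ 3) \<le> 1
    \<and> 16 * real (K * l ^ 3) ^ 2 * real l * exp (- (2 * e * real l)) / sin (1 / (real l / pi + 1)) \<le> 1
    \<and> real (K * l ^ 3) * ((real l + 1) * exp (- real l)) < 1 \<and> real (K * l ^ 3) ^ 2 * exp (- real l) < 1"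
proof -
  have K0: "0 < real K" using K e by (cases K) auto
  \<comment> \<open>Growth exponents are allowed to deviate by this much on either side of 4 e. Over
    K l^3 steps the two bounds then differ by exactly e l/2 in the exponent.\<close>
  define \<epsilon> where "\<epsilon> = e / (4 * real K)"
  have \<epsilon>: "0 < \<epsilon>" "\<epsilon> < 4 * e" using e K0 K
    by (auto simp: \<epsilon>_def field_simps intro: less_le_trans[of _ "4 * e * real K"])
  have pit: "pi ^ 3 * (real l / pi) ^ 3 = real l ^ 3" for l by (simp add: power_divide)
  have lc: "ln (mean_scale e l) = - 1 + (pi\<^sup>2 / 2 + 4 * e) / (real l)\<^sup>2" for l
    by (simp add: mean_scale_def)
  have 1: "\<forall>\<^sub>F l in sequentially. 3 \<le> l" by (rule eventually_ge_at_top)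
  have 2: "\<forall>\<^sub>F l in sequentially. mean_scale e l \<le> 1"
  proof -
    have "((\<lambda>x::real. - 1 + (pi\<^sup>2 / 2 + 4 * e) / x\<^sup>2) \<longlongrightarrow> - 1) at_top" by real_asymp
    from filterlim_compose[OF this filterlim_real_sequentially]
    have "(\<lambda>l. - 1 + (pi\<^sup>2 / 2 + 4 * e) / (real l)\<^sup>2) \<longlonglongrightarrow> - 1" .
    from order_tendstoD(2)[OF this, of 0] show ?thesis by (auto simp: mean_scale_def elim!: eventually_mono)
  qed
  have 3: "\<forall>\<^sub>F l in sequentially. - (real l ^ 3) * ln (rate 0 (real l / pi)) \<le> 1"
    using filterlim_iff[THEN iffD1, OF scaled_at_top, rule_format, OF rate_power_asymp] by (simp add: pit)
  have 4: "\<forall>\<^sub>F l in sequentially. \<bar>real l ^ 4 * (ln (rate 1 (real l / pi)) - ln (rate 0 (real l / pi)))\<bar> \<le> ln 2"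
  proof -
    have "(\<lambda>l. real l ^ 4 * (ln (rate 1 (real l / pi)) - ln (rate 0 (real l / pi)))) \<longlonglongrightarrow> 0"
      using filterlim_compose[OF rate_diff_asymp scaled_at_top] by (simp add: pit power_divide eval_nat_numeral mult_ac)
    from tendstoD[OF this, of "ln 2"] show ?thesis by (auto simp: dist_real_def elim!: eventually_mono)
  qed
  note g0 = growth_tendsto[OF log_growth_0_asymp, of "4 * e"]
  note g1 = growth_tendsto[OF log_growth_1_asymp, of "4 * e"]
  have cube: "real (K * l ^ 3) * u = real K * real l * ((real l)\<^sup>2 * u)" for l u
    by (simp add: eval_nat_numeral mult_ac)
  have 5: "\<forall>\<^sub>F l in sequentially. p l \<le> real (K * l ^ 3) * (ln (mean_scale e l) + log_growth 0 (real l / pi))"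
  proof -
    have "\<forall>\<^sub>F l in sequentially. 4 * e - \<epsilon> < (real l)\<^sup>2 * (- 1 + (pi\<^sup>2 / 2 + 4 * e) / (real l)\<^sup>2 + log_growth 0 (real l / pi))"
      using order_tendstoD(1)[OF g0, of "4 * e - \<epsilon>"] \<epsilon> by simp
    thus ?thesis unfolding cube lc p_def \<epsilon>_def by (rule eventually_mono) (auto intro!: mult_left_mono)
  qed
  have 6: "\<forall>\<^sub>F l in sequentially. 0 \<le> ln (mean_scale e l) + log_growth 1 (real l / pi)"
  proof -
    have "\<forall>\<^sub>F l in sequentially. 0 < (real l)\<^sup>2 * (- 1 + (pi\<^sup>2 / 2 + 4 * e) / (real l)\<^sup>2 + log_growth 1 (real l / pi))"
      using order_tendstoD(1)[OF g1, of 0] e by simp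
    thus ?thesis unfolding lc by (rule eventually_mono) (simp add: zero_less_mult_iff)
  qed
  have 7: "\<forall>\<^sub>F l in sequentially. real (K * l ^ 3) * (ln (mean_scale e l) + log_growth 1 (real l / pi)) \<le> p l + e * real l / 2"
  proof -
    have "\<forall>\<^sub>F l in sequentially. (real l)\<^sup>2 * (- 1 + (pi\<^sup>2 / 2 + 4 * e) / (real l)\<^sup>2 + log_growth 1 (real l / pi)) < 4 * e + \<epsilon>"
      using order_tendstoD(2)[OF g1, of "4 * e + \<epsilon>"] \<epsilon> by simp
    thus ?thesis
    proof (rule eventually_mono)
      fix l assume "(real l)\<^sup>2 * (- 1 + (pi\<^sup>2 / 2 + 4 * e) / (real l)\<^sup>2 + log_growth 1 (real l / pi)) < 4 * e + \<epsilon>"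
      hence "real (K * l ^ 3) * (ln (mean_scale e l) + log_growth 1 (real l / pi)) \<le> real K * real l * (4 * e + \<epsilon>)"
        unfolding cube lc by (intro mult_left_mono) auto
      also have "\<dots> = p l + e * real l / 2" using K0 by (simp add: p_def \<epsilon>_def field_simps)
      finally show "real (K * l ^ 3) * (ln (mean_scale e l) + log_growth 1 (real l / pi)) \<le> p l + e * real l / 2" .
    qed
  qed
  have 8: "e * real l \<le> p l" for l
  proof -
    have "p l = real l * (4 * e * real K - e / 4)" using K0 by (simp add: p_def field_simps)
    moreover have "e * real l \<le> real l * (4 * e * real K - e / 4)"
      unfolding mult.commute[of e] using K e by (intro mult_left_mono) auto
    ultimately show ?thesis by simp
  qed
  have ev: "\<forall>\<^sub>F l in sequentially. f (real l) < 1" if "(f \<longlongrightarrow> 0) at_top" for f :: "real \<Rightarrow> real"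
    using order_tendstoD(2)[OF filterlim_compose[OF that filterlim_real_sequentially], of 1] by simp
  have 9: "\<forall>\<^sub>F l in sequentially. exp (- (e * real l)) * real (K * l ^ 3) < 1"
  proof -
    have "((\<lambda>x::real. exp (- (e * x)) * (c * x ^ 3)) \<longlongrightarrow> 0) at_top" for c using e(1) by real_asymp
    from ev[OF this[of "real K"]] show ?thesis by simp
  qed
  have 10: "\<forall>\<^sub>F l in sequentially. 16 * real (K * l ^ 3) ^ 2 * real l * exp (- (2 * e * real l)) / sin (1 / (real l / pi + 1)) < 1"
  proof -
    have "((\<lambda>x::real. 16 * (c * x ^ 3) ^ 2 * x * exp (- (2 * e * x)) / sin (1 / (x / pi + 1))) \<longlongrightarrow> 0) at_top" if "0 < c" for c
      using e(1) that by real_asymp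
    from ev[OF this[of "real K"]] K0 show ?thesis by simp
  qed
  have 11: "\<forall>\<^sub>F l in sequentially. real (K * l ^ 3) * ((real l + 1) * exp (- real l)) < 1"
  proof -
    have "((\<lambda>x::real. (c * x ^ 3) * ((x + 1) * exp (- x))) \<longlongrightarrow> 0) at_top" for c by real_asymp
    from ev[OF this[of "real K"]] show ?thesis by simp
  qed
  have 12: "\<forall>\<^sub>F l in sequentially. real (K * l ^ 3) ^ 2 * exp (- real l) < 1"
  proof -
    have "((\<lambda>x::real. (c * x ^ 3) ^ 2 * exp (- x)) \<longlongrightarrow> 0) at_top" if "0 < c" for c
      using that by real_asymp
    from ev[OF this[of "real K"]] K0 show ?thesis by simp
  qed
  show ?thesis
    using 1 2 3 4 5 6 7 9 10 11 12 by eventually_elim (use 8 in auto)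
qed

text \<open>A diagonal choice: \<eta> n is essentially the least slack \<epsilon> for which the
  failure probability is at most \<epsilon>.\<close>

lemma vanishing_slack:
  fixes P :: "nat \<Rightarrow> real \<Rightarrow> real"
  assumes mono: "\<And>n \<epsilon> \<epsilon>'. \<epsilon> \<le> \<epsilon>' \<Longrightarrow> P n \<epsilon> \<le> P n \<epsilon>'"
    and P: "\<And>n \<epsilon>. 0 \<le> P n \<epsilon>" "\<And>n \<epsilon>. P n \<epsilon> \<le> 1"
    and lim: "\<And>\<epsilon>. 0 < \<epsilon> \<Longrightarrow> (\<lambda>n. P n \<epsilon>) \<longlonglongrightarrow> 1"
  shows "\<exists>\<eta>. \<eta> \<longlonglongrightarrow> 0 \<and> (\<lambda>n. P n (\<eta> n)) \<longlonglongrightarrow> 1"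
proof -
  define S where "S n = {\<epsilon>. 0 < \<epsilon> \<and> 1 - \<epsilon> \<le> P n \<epsilon>}" for n
  \<comment> \<open>The infimum need not be attained; the extra term leaves an admissible slack
    strictly below \<eta> n.\<close>
  define \<eta> where "\<eta> n = Inf (S n) + inverse (real (Suc n))" for n
  have S1: "1 \<in> S n" for n using P(1) by (simp add: S_def)
  have bdd: "bdd_below (S n)" for n by (rule bdd_belowI[of _ 0]) (auto simp: S_def)
  have Inf0: "0 \<le> Inf (S n)" for n by (rule cInf_greatest) (use S1 in blast, simp add: S_def)
  have P\<eta>: "1 - \<eta> n \<le> P n (\<eta> n)" for n
  proof -
    have "Inf (S n) < \<eta> n" by (simp add: \<eta>_def)
    then obtain s where s: "s \<in> S n" "s < \<eta> n" using cInf_lessD[of "S n" "\<eta> n"] S1 by blast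
    have "1 - \<eta> n \<le> 1 - s" "1 - s \<le> P n s" "P n s \<le> P n (\<eta> n)" using s mono by (auto simp: S_def)
    thus ?thesis by linarith
  qed
  have \<eta>0: "\<eta> \<longlonglongrightarrow> 0"
  proof (rule LIMSEQ_I)
    fix r :: real assume r: "0 < r"
    have "\<forall>\<^sub>F n in sequentially. 1 - r / 2 < P n (r / 2)"
      using order_tendstoD(1)[OF lim[of "r / 2"], of "1 - r / 2"] r by simp
    moreover have "\<forall>\<^sub>F n in sequentially. inverse (real (Suc n)) < r / 2"
      using order_tendstoD(2)[OF LIMSEQ_inverse_real_of_nat, of "r / 2"] r by simp
    ultimately have "\<forall>\<^sub>F n in sequentially. norm (\<eta> n - 0) < r"
    proof eventually_elim
      case (elim n)
      have "Inf (S n) \<le> r / 2" using elim(1) r by (intro cInf_lower bdd) (auto simp: S_def)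
      moreover have "0 \<le> \<eta> n" using Inf0[of n] by (simp add: \<eta>_def)
      ultimately show ?case using elim(2) by (simp add: \<eta>_def)
    qed
    thus "\<exists>no. \<forall>n\<ge>no. norm (\<eta> n - 0) < r" by (simp add: eventually_sequentially)
  qed
  have "(\<lambda>n. P n (\<eta> n)) \<longlonglongrightarrow> 1"
  proof (rule tendsto_sandwich[where h = "\<lambda>_. 1"])
    show "(\<lambda>n. 1 - \<eta> n) \<longlonglongrightarrow> 1" using tendsto_diff[OF tendsto_const \<eta>0, of 1] by simp
  qed (use P\<eta> P(2) in \<open>auto intro: always_eventually\<close>)
  thus ?thesis using \<eta>0 by blast
qed

text \<open>Three slacks add up: the excess 4 e, the contribution 1/K \<le> 4 e of the final height,
  and a factor (1 + 5 e)^2 from replacing \<open>l\<close> by \<open>ln n\<close>. With \<pi>^2/2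
  \<le> 8 the total stays below 200 e.\<close>

lemma slack_bound:
  fixes \<epsilon> e :: real and K :: nat
  assumes e: "0 < e" "e \<le> 1 / 4" "200 * e \<le> \<epsilon>" and K: "1 \<le> 4 * e * real K"
  shows "\<forall>\<^sub>F n in sequentially. mean_scale e (nat \<lfloor>ln (real n) / (1 + 4 * e)\<rfloor>) *
      (1 + 1 / (real K * (real (nat \<lfloor>ln (real n) / (1 + 4 * e)\<rfloor>))\<^sup>2))
    \<le> exp (- 1) * (1 + (pi\<^sup>2 / 2 + \<epsilon>) / (ln (real n))\<^sup>2)"
    and "filterlim (\<lambda>n. nat \<lfloor>ln (real n) / (1 + 4 * e)\<rfloor>) sequentially sequentially"
proof -
  define L where "L n = nat \<lfloor>ln (real n) / (1 + 4 * e)\<rfloor>" for n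
  have lnat: "filterlim (\<lambda>n. ln (real n)) at_top sequentially"
    by (rule filterlim_compose[OF ln_at_top filterlim_real_sequentially])
  have Lge: "ln (real n) / (1 + 4 * e) - 1 \<le> real (L n)" for n
    unfolding L_def by linarith
  have L: "filterlim L sequentially sequentially"
  proof -
    have "filterlim (\<lambda>x. x / (1 + 4 * e) - 1) at_top at_top" using e by real_asymp
    from filterlim_at_top_mono[OF filterlim_compose[OF this lnat] always_eventually[OF allI[OF Lge]]]
    have "filterlim (\<lambda>n. real (L n)) at_top sequentially" .
    thus ?thesis by (simp add: filterlim_sequentially_iff_filterlim_real)
  qed
  show "filterlim (\<lambda>n. nat \<lfloor>ln (real n) / (1 + 4 * e)\<rfloor>) sequentially sequentially"
    using L by (simp add: L_def[abs_def])
  have K0: "0 < real K" using K e by (cases K) auto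
  have K4: "1 / real K \<le> 4 * e" using K K0 by (simp add: field_simps)
  define A where "A = pi\<^sup>2 / 2 + 4 * e"
  have A: "0 < A" "pi\<^sup>2 / 2 \<le> 8"
  proof -
    show "0 < A" unfolding A_def using e by (intro add_nonneg_pos) auto
    have "pi\<^sup>2 \<le> 4\<^sup>2" using pi_less_4 by (intro power_mono) auto
    thus "pi\<^sup>2 / 2 \<le> 8" by simp
  qed
  have "((\<lambda>u. (exp (A * u) * (1 + 4 * e * u) - 1) / u) \<longlongrightarrow> A + 4 * e) (at_right 0)"
    using A(1) e(1) by real_asymp
  moreover have "filterlim (\<lambda>l. 1 / (real l)\<^sup>2) (at_right 0) sequentially"
  proof (rule filterlim_compose[OF _ filterlim_real_sequentially])
    show "filterlim (\<lambda>x::real. 1 / x\<^sup>2) (at_right 0) at_top" by real_asymp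
  qed
  ultimately have "(\<lambda>l. (exp (A * (1 / (real l)\<^sup>2)) * (1 + 4 * e * (1 / (real l)\<^sup>2)) - 1) / (1 / (real l)\<^sup>2)) \<longlonglongrightarrow> A + 4 * e"
    by (rule filterlim_compose)
  hence "\<forall>\<^sub>F l in sequentially. (exp (A * (1 / (real l)\<^sup>2)) * (1 + 4 * e * (1 / (real l)\<^sup>2)) - 1) / (1 / (real l)\<^sup>2) < A + 5 * e"
    using e by (intro order_tendstoD(2)) auto
  hence "\<forall>\<^sub>F n in sequentially. (exp (A * (1 / (real (L n))\<^sup>2)) * (1 + 4 * e * (1 / (real (L n))\<^sup>2)) - 1) / (1 / (real (L n))\<^sup>2) < A + 5 * e"
    using L by (rule eventually_compose_filterlim)
  moreover have "\<forall>\<^sub>F n in sequentially. 0 < L n"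
    using L eventually_gt_at_top[of 0] by (rule eventually_compose_filterlim[rotated])
  moreover have "\<forall>\<^sub>F n in sequentially. (1 + 5 * e) * (1 + 4 * e) / e \<le> ln (real n)"
    using lnat by (simp add: filterlim_at_top)
  ultimately have "\<forall>\<^sub>F n in sequentially. mean_scale e (L n) * (1 + 1 / (real K * (real (L n))\<^sup>2))
    \<le> exp (- 1) * (1 + (pi\<^sup>2 / 2 + \<epsilon>) / (ln (real n))\<^sup>2)"
  proof eventually_elim
    case (elim n)
    define u where "u = 1 / (real (L n))\<^sup>2"
    have u: "0 < u" using elim(2) by (simp add: u_def)
    have 1: "exp (A * u) * (1 + 4 * e * u) \<le> 1 + (pi\<^sup>2 / 2 + 9 * e) * u"
      using elim(1) u unfolding u_def[symmetric] by (simp add: A_def field_simps)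
    have lp: "0 < ln (real n)"
    proof -
      have "0 < (1 + 5 * e) * (1 + 4 * e) / e" using e by simp
      thus ?thesis using elim(3) by linarith
    qed
    \<comment> \<open>Rounding down costs at most 1, which for such large \<open>n\<close> fits into
      the increase from 1 + 4 e to 1 + 5 e.\<close>
    have "ln (real n) \<le> (1 + 5 * e) * real (L n)"
    proof -
      define v where "v = ln (real n) / (1 + 4 * e)"
      have "1 + 5 * e \<le> e * v" using elim(3) e by (simp add: v_def field_simps)
      moreover have "(1 + 5 * e) * (v - 1) \<le> (1 + 5 * e) * real (L n)"
        unfolding v_def using Lge e by (intro mult_left_mono) auto
      moreover have "ln (real n) = (1 + 4 * e) * v" using e by (simp add: v_def)
      ultimately show ?thesis by (simp add: algebra_simps)
    qed
    hence "(ln (real n))\<^sup>2 \<le> ((1 + 5 * e) * real (L n))\<^sup>2" using lp by (intro power_mono) auto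
    moreover have "1 / b \<le> q / c" if "c \<le> q * b" "0 < b" "0 < c" for b c q :: real
      using that by (simp add: field_simps)
    ultimately have 2: "u \<le> (1 + 5 * e)\<^sup>2 / (ln (real n))\<^sup>2"
      using elim(2) lp unfolding u_def power_mult_distrib by simp
    have 3: "(pi\<^sup>2 / 2 + 9 * e) * (1 + 5 * e)\<^sup>2 \<le> pi\<^sup>2 / 2 + \<epsilon>"
    proof -
      have "e * e \<le> e * (1 / 4)" using e by (intro mult_left_mono) auto
      hence "(1 + 5 * e)\<^sup>2 \<le> 1 + 17 * e" using e by (simp add: power2_eq_square algebra_simps)
      hence "(pi\<^sup>2 / 2 + 9 * e) * (1 + 5 * e)\<^sup>2 \<le> (pi\<^sup>2 / 2 + 9 * e) * (1 + 17 * e)"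
        using e by (intro mult_left_mono) auto
      also have "\<dots> = pi\<^sup>2 / 2 + 17 * (pi\<^sup>2 / 2 * e) + 9 * e + 153 * (e * e)" by (simp add: algebra_simps)
      also have "\<dots> \<le> pi\<^sup>2 / 2 + \<epsilon>"
        using mult_right_mono[OF A(2), of e] e \<open>e * e \<le> e * (1 / 4)\<close> by linarith
      finally show ?thesis .
    qed
    have "mean_scale e (L n) * (1 + 1 / (real K * (real (L n))\<^sup>2)) = exp (- 1) * (exp (A * u) * (1 + 1 / real K * u))"
      by (simp only: mean_scale_def exp_add) (simp add: A_def u_def)
    also have "\<dots> \<le> exp (- 1) * (exp (A * u) * (1 + 4 * e * u))"
      using K4 u by (intro mult_left_mono add_left_mono mult_right_mono) auto
    also have "\<dots> \<le> exp (- 1) * (1 + (pi\<^sup>2 / 2 + 9 * e) * u)" using 1 by (intro mult_left_mono) auto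
    also have "\<dots> \<le> exp (- 1) * (1 + (pi\<^sup>2 / 2 + 9 * e) * ((1 + 5 * e)\<^sup>2 / (ln (real n))\<^sup>2))"
      using 2 e by (intro mult_left_mono add_left_mono) auto
    also have "\<dots> \<le> exp (- 1) * (1 + (pi\<^sup>2 / 2 + \<epsilon>) / (ln (real n))\<^sup>2)"
      using 3 by (simp add: divide_right_mono)
    finally show ?case .
  qed
  thus "\<forall>\<^sub>F n in sequentially. mean_scale e (nat \<lfloor>ln (real n) / (1 + 4 * e)\<rfloor>) *
      (1 + 1 / (real K * (real (nat \<lfloor>ln (real n) / (1 + 4 * e)\<rfloor>))\<^sup>2))
    \<le> exp (- 1) * (1 + (pi\<^sup>2 / 2 + \<epsilon>) / (ln (real n))\<^sup>2)"
    by (simp add: L_def)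
qed

section \<open>The minimum mean-weight cycle\<close>

lemma awalk_verts_darcs:
  "pre_digraph.awalk_verts (with_proj (complete_pair_digraph n)) v (map fst (darcs v l)) = v # map fst l"
  by (induction v l rule: darcs.induct) (auto simp: pre_digraph.awalk_verts.simps)

lemma cas_darcs:
  "last (v # map fst l) = w \<Longrightarrow> pre_digraph.cas (with_proj (complete_pair_digraph n)) v (map fst (darcs v l)) w"
  by (induction v l rule: darcs.induct) (auto simp: pre_digraph.cas.simps)

lemma parcs_complete: "parcs (complete_pair_digraph n) = {(u, v). u < n \<and> v < n \<and> u \<noteq> v}"
  by (simp add: complete_pair_digraph_def)

lemma closed_darcs_cycle:
  assumes "2 \<le> length c" "distinct (map fst c)" "fst ` set c \<subseteq> {..<n}"
  shows "map fst (closed_darcs c) \<in> directed_cycles n"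
proof -
  define t where "t = fst (last c)"
  have c: "c \<noteq> []" using assms(1) by auto
  have "t \<in> fst ` set c" using c by (simp add: t_def)
  hence t: "t < n" using assms(3) by auto
  have "set (map fst (closed_darcs c)) \<subseteq> parcs (complete_pair_digraph n)"
  proof
    fix a assume "a \<in> set (map fst (closed_darcs c))"
    then obtain u w i where a: "a = (u, w)" "((u, w), i) \<in> set (closed_darcs c)" by auto
    show "a \<in> parcs (complete_pair_digraph n)"
      using closed_darcs_vertices[OF c a(2)] closed_darcs_irrefl[OF assms(1,2) a(2)] assms(3)
      by (auto simp: a parcs_complete)
  qed
  moreover have "last (t # map fst c) = t" using c by (simp add: t_def last_map)
  ultimately show ?thesis
    using t c assms(2) cas_darcs[of t c t n] awalk_verts_darcs[of n t c]
    by (auto simp: directed_cycles_def pre_digraph.cycle_def pre_digraph.awalk_def closed_darcs_def t_def[symmetric]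
        complete_pair_digraph_def intro!: exI[of _ t] dest: arg_cong[where f = length])
qed

text \<open>Positive weight forces every height into the band, in particular the final one, which
  encodes the total of the rounded weights.\<close>

lemma (in lattice) band_weight_steps:
  assumes "0 < band_weight x l" "in_band B x"
  shows "x + int (sum_list (map snd l)) - int (length l) * int D < int B"
  using assms
proof (induction l arbitrary: x)
  case (Cons a l)
  have "step_weight x (snd a) \<noteq> 0" "0 < band_weight (move x (snd a)) l"
    using Cons.prems band_weight_nonneg[of "move x (snd a)" l] step_weight_nonneg[of x "snd a"]
    by (auto simp: zero_less_mult_iff)
  hence "0 < band_weight (move x (snd a)) l" "in_band B (move x (snd a))"
    by (auto simp: step_weight_def split: if_splits)
  from Cons.IH[OF this] show ?case by (simp add: move_def algebra_simps)
qed (simp add: in_band_def)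

lemma (in exp_weights) bins_sum_le:
  "\<omega> \<in> bins L \<Longrightarrow> (\<Sum>e\<leftarrow>map fst L. W e \<omega>) \<le> h * real (sum_list (map snd L))"
proof (induction L)
  case (Cons a L)
  have "\<omega> \<in> bins L" "W (fst a) \<omega> \<le> h * real (snd a)" using Cons.prems by (auto simp: bins_def)
  thus ?case using Cons.IH by (simp add: algebra_simps)
qed simp

text \<open>The rounded weights total less than B + k D, and B/(k D) = l/k = 1/(K l^2) is the
  relative excess over h D = c/n.\<close>

lemma (in scaled_cycle_model) good_cycle_mean_weight:
  assumes c': "c' \<in> cycles k" "0 < band_weight x0 c'" and \<omega>: "\<omega> \<in> bins (key_steps c')"
  shows "mean_weight (\<lambda>a. W (key a) \<omega>) (map fst (closed_darcs c')) \<le> c / real n * (1 + 1 / (real K * (real l)\<^sup>2))"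
proof -
  have len: "length c' = k" using cyclesD(1)[OF k_ge_3 c'(1)] .
  have kp: "0 < real k" using k_ge_3 by simp
  have "int (sum_list (map snd c')) < int B + int k * int D"
    using band_weight_steps[OF c'(2) x0_band] len by (simp add: x0_def)
  hence st: "real (sum_list (map snd c')) \<le> real B + real k * real D"
    by (metis of_nat_add of_nat_mult of_nat_less_iff less_imp_le of_nat_le_iff)
  have "sum_list (map (\<lambda>a. W (key a) \<omega>) (map fst (closed_darcs c'))) = (\<Sum>e\<leftarrow>map fst (key_steps c'). W e \<omega>)"
    by (simp add: key_steps_def o_def case_prod_unfold)
  also have "\<dots> \<le> h * real (sum_list (map snd (key_steps c')))" using bins_sum_le[OF \<omega>] .
  also have "map snd (key_steps c') = map snd c'"
    using darcs_steps[of "fst (last c')" c'] by (simp add: key_steps_def closed_darcs_def o_def case_prod_unfold)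
  also have "h * real (sum_list (map snd c')) \<le> h * (real B + real k * real D)"
    using st h by (intro mult_left_mono) auto
  finally have "mean_weight (\<lambda>a. W (key a) \<omega>) (map fst (closed_darcs c')) \<le> h * (real B + real k * real D) / real k"
    using kp len by (simp add: mean_weight_def divide_right_mono)
  also have "\<dots> = c / real n * (1 + 1 / (real K * (real l)\<^sup>2))"
    using kp l_pos n_ge K by (simp add: hc k B D eval_nat_numeral field_simps)
  finally show ?thesis .
qed

text \<open>The second moment produces cycles of length at least 3, so \<open>CY\<close> need only
  contain those. Additional members, such as directed 2-cycles, can only lower the minimum, and one
  statement serves both graphs.\<close>

theorem min_mean_cycle_upper_bound:
  fixes key :: "nat \<times> nat \<Rightarrow> 'e" and M :: "nat \<Rightarrow> 'a measure" and W :: "nat \<Rightarrow> 'e \<Rightarrow> 'a \<Rightarrow> real"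
    and CY :: "nat \<Rightarrow> (nat \<times> nat) awalk set"
  assumes key: "\<And>a b. key a = key b \<Longrightarrow> a = b \<or> a = prod.swap b"
    and iid: "\<And>n. iid_exponential (M n) (key ` parcs (complete_pair_digraph n)) (W n)"
    and CY: "\<And>n. CY n \<subseteq> directed_cycles n" "\<And>n p. p \<in> directed_cycles n \<Longrightarrow> 3 \<le> length p \<Longrightarrow> p \<in> CY n"
  shows "\<exists>\<eta> :: nat \<Rightarrow> real. \<eta> \<longlonglongrightarrow> 0 \<and>
      (\<lambda>n. measure (M n) {\<omega> \<in> space (M n). Min (mean_weight (\<lambda>a. W n (key a) \<omega>) ` CY n)
             \<le> 1 / (exp 1 * real n) * (1 + (pi\<^sup>2 / 2 + \<eta> n) / (ln (real n))\<^sup>2)}) \<longlonglongrightarrow> 1"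
proof -
  define mm where "mm n \<omega> = Min (mean_weight (\<lambda>a. W n (key a) \<omega>) ` CY n)" for n \<omega>
  define bd where "bd n \<epsilon> = 1 / (exp 1 * real n) * (1 + (pi\<^sup>2 / 2 + \<epsilon>) / (ln (real n))\<^sup>2)" for n \<epsilon>
  define P where "P n \<epsilon> = measure (M n) {\<omega> \<in> space (M n). mm n \<omega> \<le> bd n \<epsilon>}" for n \<epsilon>
  have ps: "prob_space (M n)" for n using iid by (simp add: iid_exponential_def)
  have fin: "finite (CY n)" for n using CY(1) finite_directed_cycles finite_subset by blast
  have rv: "W n (key a) \<in> borel_measurable (M n)" if "a \<in> parcs (complete_pair_digraph n)" for n a
  proof -
    \<comment> \<open>The bin width 1 is a dummy; only measurability of the weights is taken from
      the locale.\<close>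
    interpret exp_weights "M n" "key ` parcs (complete_pair_digraph n)" "W n" 1
      using ps iid by (simp add: exp_weights_def exp_weights_axioms_def)
    show ?thesis using rv that by blast
  qed
  have mean_rv: "(\<lambda>\<omega>. mean_weight (\<lambda>a. W n (key a) \<omega>) p) \<in> borel_measurable (M n)" if "p \<in> CY n" for n p
  proof -
    have "set p \<subseteq> parcs (complete_pair_digraph n)" using that CY(1) directed_cycles_subset by blast
    hence "(\<lambda>\<omega>. \<Sum>a\<leftarrow>p. W n (key a) \<omega>) \<in> borel_measurable (M n)"
      using rv by (induction p) (auto intro!: borel_measurable_add)
    thus ?thesis by (simp add: mean_weight_def)
  qed
  have ev: "{\<omega> \<in> space (M n). mm n \<omega> \<le> b} \<in> sets (M n)" for n b
  proof (cases "CY n = {}")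
    \<comment> \<open>The minimum over the empty set does not depend on \<omega>, so the event is
      either empty or the whole space.\<close>
    case True
    thus ?thesis by (simp add: mm_def)
  next
    case False
    have "{\<omega> \<in> space (M n). mm n \<omega> \<le> b} = (\<Union>p\<in>CY n. {\<omega> \<in> space (M n). mean_weight (\<lambda>a. W n (key a) \<omega>) p \<le> b})"
      using False fin by (auto simp: mm_def Min_le_iff)
    moreover have "{\<omega> \<in> space (M n). mean_weight (\<lambda>a. W n (key a) \<omega>) p \<le> b} \<in> sets (M n)" if "p \<in> CY n" for p
      using mean_rv[OF that] by measurable
    ultimately show ?thesis using fin by (auto intro!: sets.finite_UN)
  qed
  have "\<exists>\<eta>. \<eta> \<longlonglongrightarrow> 0 \<and> (\<lambda>n. P n (\<eta> n)) \<longlonglongrightarrow> 1"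
  proof (rule vanishing_slack)
    show P01: "0 \<le> P n \<epsilon>" "P n \<epsilon> \<le> 1" for n \<epsilon>
      using prob_space.prob_le_1[OF ps] by (auto simp: P_def)
    show "P n \<epsilon> \<le> P n \<epsilon>'" if "\<epsilon> \<le> \<epsilon>'" for n \<epsilon> \<epsilon>'
    proof -
      interpret prob_space "M n" by (rule ps)
      have "bd n \<epsilon> \<le> bd n \<epsilon>'" unfolding bd_def using that
        by (intro mult_left_mono add_left_mono divide_right_mono) auto
      thus ?thesis unfolding P_def by (intro finite_measure_mono ev) auto
    qed
    fix \<epsilon> :: real assume \<epsilon>: "0 < \<epsilon>"
    define e where "e = min (1 / 4) (\<epsilon> / 200)"
    have e: "0 < e" "e \<le> 1 / 4" "200 * e \<le> \<epsilon>" using \<epsilon> by (auto simp: e_def)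
    \<comment> \<open>With 4 e K at least 1 the growth exponent 4 e K l is at least
      \<open>l\<close>, and the share 1/K of the final height in the mean weight is at most 4
      e.\<close>
    define K where "K = nat \<lceil>1 / (4 * e)\<rceil>"
    have "1 / (4 * e) \<le> real K" unfolding K_def by linarith
    hence K: "1 \<le> 4 * e * real K" using e by (simp add: field_simps)
    hence K1: "0 < K" by (cases K) auto
    define L where "L n = nat \<lfloor>ln (real n) / (1 + 4 * e)\<rfloor>" for n
    have L: "filterlim L sequentially sequentially" using slack_bound(2)[OF e K] by (simp add: L_def[abs_def])
    define p where "p l = real K * real l * (4 * e - e / (4 * real K))" for l
    define F where "F l = 2 - (1 + overlap_bound K e l) / (loss_factor K l)\<^sup>2" for l
    have "F \<longlonglongrightarrow> 2 - (1 + 0) / 1\<^sup>2"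
      unfolding F_def using overlap_bound_tendsto[OF e(1) K1] loss_factor_tendsto[OF K1]
      by (intro tendsto_intros) auto
    hence "(\<lambda>n. F (L n)) \<longlonglongrightarrow> 1" using filterlim_compose[OF _ L, of F "nhds 1"] by simp
    moreover have "\<forall>\<^sub>F n in sequentially. F (L n) \<le> P n \<epsilon>"
      using eventually_compose_filterlim[OF eventually_params[OF e(1,2) K] L]
        slack_bound(1)[OF e K, folded L_def] eventually_gt_at_top[of 1]
    proof eventually_elim
      case (elim n)
      define l where "l = L n"
      define h where "h = mean_scale e l / (real n * real l ^ 3)"
      note par = elim(1)[folded l_def p_def]
      have n1: "1 < real n" using elim(3) by simp
      have l3: "3 \<le> l" using par by simp
      have h: "0 < h" unfolding h_def using n1 l3 by (intro divide_pos_pos) (auto simp: mean_scale_def)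
      have z: "0 < rate 0 (real l / pi)" "rate 0 (real l / pi) < 1"
      proof -
        have eq: "rate 0 (real l / pi) = sin (pi / real l - pi / real l ^ 4) / sin (pi / real l)"
          by (simp add: rate_def power_divide eval_nat_numeral)
        have "real l ^ 1 < real l ^ 4" using l3 by (intro power_strict_increasing) auto
        hence 1: "0 < pi / real l - pi / real l ^ 4" "pi / real l - pi / real l ^ 4 < pi / real l"
          using l3 by (auto simp: frac_less2)
        have 2: "pi / real l \<le> pi / 2" using l3 by (intro divide_left_mono) auto
        have "sin (pi / real l - pi / real l ^ 4) < sin (pi / real l)"
          using 1 2 by (intro sin_monotone_2pi) auto
        moreover have "0 < sin (pi / real l - pi / real l ^ 4)"
          using 1 2 pi_gt_zero by (intro sin_gt_zero) linarith+
        ultimately show "0 < rate 0 (real l / pi)" "rate 0 (real l / pi) < 1" by (simp_all add: eq)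
      qed
      have n_large: "exp ((1 + 4 * e) * real l) \<le> real n"
      proof -
        have "0 \<le> ln (real n) / (1 + 4 * e)" using n1 e by simp
        hence "real l \<le> ln (real n) / (1 + 4 * e)" unfolding l_def L_def by linarith
        hence "(1 + 4 * e) * real l \<le> ln (real n)" using e by (simp add: field_simps)
        thus ?thesis using n1 by (metis exp_le_cancel_iff exp_ln less_trans zero_less_one)
      qed
      interpret prob_space "M n" by (rule ps)
      interpret scaled_cycle_model n "l ^ 4" "l ^ 3" h "rate 0 (real l / pi)" key "M n"
        "key ` parcs (complete_pair_digraph n)" "W n" l K "K * l ^ 3" "mean_scale e l" "real l / pi" e "p l"
      proof unfold_locales
        show "key ` parcs (complete_pair_digraph n) = key ` {(u, v). u < n \<and> v < n \<and> u \<noteq> v}"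
          by (simp add: parcs_complete)
      qed (use key iid h z par e n_large K1 in \<open>auto simp: h_def mean_scale_def\<close>)
      define G where "G = (\<Union>c\<in>{c \<in> cycles (K * l ^ 3). 0 < band_weight x0 c}. bins (key_steps c))"
      have "G \<subseteq> {\<omega> \<in> space (M n). mm n \<omega> \<le> bd n \<epsilon>}"
      proof
        fix \<omega> assume "\<omega> \<in> G"
        then obtain c where c: "c \<in> cycles (K * l ^ 3)" "0 < band_weight x0 c" "\<omega> \<in> bins (key_steps c)"
          by (auto simp: G_def)
        note cD = cyclesD[OF k_ge_3 c(1)]
        have "map fst (closed_darcs c) \<in> directed_cycles n"
          using cD k_ge_3 by (intro closed_darcs_cycle) auto
        hence "map fst (closed_darcs c) \<in> CY n" using cD(1) k_ge_3 by (intro CY(2)) auto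
        hence "mm n \<omega> \<le> mean_weight (\<lambda>a. W n (key a) \<omega>) (map fst (closed_darcs c))"
          using fin by (simp add: mm_def)
        also have "\<dots> \<le> mean_scale e l / real n * (1 + 1 / (real K * (real l)\<^sup>2))"
          using good_cycle_mean_weight[OF c] .
        also have "\<dots> = mean_scale e l * (1 + 1 / (real K * (real l)\<^sup>2)) / real n" by simp
        also have "\<dots> \<le> exp (- 1) * (1 + (pi\<^sup>2 / 2 + \<epsilon>) / (ln (real n))\<^sup>2) / real n"
          using elim(2) n1 by (intro divide_right_mono) (auto simp: l_def)
        also have "\<dots> = bd n \<epsilon>" by (simp add: bd_def exp_minus field_simps)
        finally show "\<omega> \<in> {\<omega> \<in> space (M n). mm n \<omega> \<le> bd n \<epsilon>}" using c(3) by (auto simp: bins_def)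
      qed
      hence "prob G \<le> P n \<epsilon>" unfolding P_def by (intro finite_measure_mono ev)
      moreover have "F l \<le> prob G" unfolding F_def G_def by (rule prob_good_cycle)
      ultimately show ?case by (simp add: l_def)
    qed
    ultimately show "(\<lambda>n. P n \<epsilon>) \<longlonglongrightarrow> 1"
      using P01(2) by (intro tendsto_sandwich[of "\<lambda>n. F (L n)" "\<lambda>n. P n \<epsilon>" sequentially "\<lambda>_. 1"]) auto
  qed
  thus ?thesis by (simp add: P_def mm_def bd_def)
qed

lemma undirected_edges_eq: "undirected_edges n = (\<lambda>(u, v). {u, v}) ` parcs (complete_pair_digraph n)"
  by (auto simp: undirected_edges_def parcs_complete card_2_iff image_iff)

theorem theorem6p5:
  fixes M :: "nat \<Rightarrow> 'a measure" and W :: "nat \<Rightarrow> nat \<times> nat \<Rightarrow> 'a \<Rightarrow> real"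
    and N :: "nat \<Rightarrow> 'b measure" and V :: "nat \<Rightarrow> nat set \<Rightarrow> 'b \<Rightarrow> real"
  assumes "\<And>n. iid_exponential (M n) (parcs (complete_pair_digraph n)) (W n)"
    and "\<And>n. iid_exponential (N n) (undirected_edges n) (V n)"
  shows "(\<exists>\<eta> :: nat \<Rightarrow> real. \<eta> \<longlonglongrightarrow> 0 \<and>
      (\<lambda>n. measure (M n) {\<omega> \<in> space (M n). min_mean_directed n (\<lambda>e. W n e \<omega>)
             \<le> 1 / (exp 1 * real n) * (1 + (pi\<^sup>2 / 2 + \<eta> n) / (ln (real n))\<^sup>2)}) \<longlonglongrightarrow> 1) \<and>
    (\<exists>\<eta> :: nat \<Rightarrow> real. \<eta> \<longlonglongrightarrow> 0 \<and>
      (\<lambda>n. measure (N n) {\<omega> \<in> space (N n). min_mean_undirected n (\<lambda>e. V n e \<omega>)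
             \<le> 1 / (exp 1 * real n) * (1 + (pi\<^sup>2 / 2 + \<eta> n) / (ln (real n))\<^sup>2)}) \<longlonglongrightarrow> 1)"
proof
  show "\<exists>\<eta> :: nat \<Rightarrow> real. \<eta> \<longlonglongrightarrow> 0 \<and>
      (\<lambda>n. measure (M n) {\<omega> \<in> space (M n). min_mean_directed n (\<lambda>e. W n e \<omega>)
             \<le> 1 / (exp 1 * real n) * (1 + (pi\<^sup>2 / 2 + \<eta> n) / (ln (real n))\<^sup>2)}) \<longlonglongrightarrow> 1"
    unfolding min_mean_directed_def
    by (rule min_mean_cycle_upper_bound[where key = "\<lambda>a. a" and CY = directed_cycles]) (use assms(1) in auto)
  have eq: "(\<lambda>(u, v). V n {u, v} \<omega>) = (\<lambda>a. V n ((\<lambda>(u, v). {u, v}) a) \<omega>)" for n \<omega>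
    by (auto simp: case_prod_unfold)
  show "\<exists>\<eta> :: nat \<Rightarrow> real. \<eta> \<longlonglongrightarrow> 0 \<and>
      (\<lambda>n. measure (N n) {\<omega> \<in> space (N n). min_mean_undirected n (\<lambda>e. V n e \<omega>)
             \<le> 1 / (exp 1 * real n) * (1 + (pi\<^sup>2 / 2 + \<eta> n) / (ln (real n))\<^sup>2)}) \<longlonglongrightarrow> 1"
    \<comment> \<open>In the form given by \<open>eq\<close> the key is the unordered pair of
      endpoints, and equal pairs come from equal or reversed arcs.\<close>
    unfolding min_mean_undirected_def eq
    by (rule min_mean_cycle_upper_bound[where CY = undirected_cycles])
      (use assms(2) in \<open>auto simp: undirected_edges_eq doubleton_eq_iff directed_cycles_def undirected_cycles_def\<close>)
qed

end
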